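(* Let $\{f_k\}_{k=1}^\infty$ be a frame for $L^2(\mathbb R)$ with frame bounds $A,B$, consisting of compactly supported functions. Let $\{g_k\}_{k=1}^\infty$ denote an enumeration of the functions from $\{f_k\}_{k=1}^\infty$ that are supported within $[0,\infty[$, and let $\{h_k\}_{k=1}^\infty$ denote an enumeration of the remaining functions (both families are infinite as a consequence of the frame condition). For $k\in\mathbb N$ choose $a(k),b(k),c(k),d(k)\in\mathbb R$ such that $\operatorname{supp} g_k\subseteq[a(k),b(k)]$ and $\operatorname{supp}h_k\subseteq[c(k),d(k)]$, and assume that $$L:=\sup_{k\in\mathbb N}\max\bigl(b(k)-a(k),\,d(k)-c(k)\bigr)<\infty.$$ Fix $\lambda>1$ and define operators on $L^2(\mathbb R)$ by $$U_1f(x)=\lambda^{-1}f(x-1),\quad T_1f(x)=\lambda f(x+1)\chi_{[0,\infty[}(x),$$ $$U_2f(x)=\lambda^{-1}f(x+1),\quad T_2f(x)=\lambda f(x-1)\chi_{]-\infty,L]}(x).$$ Let $\{\alpha(k)\}_{k=1}^\infty$, $\{\gamma(k)\}_{k=1}^\infty$ be strictly increasing sequences of nonnegative integers such that $\alpha(k+1)-\alpha(k)\ge b(k)$ and $\gamma(k+1)-\gamma(k)\ge L-c(k)$ for all $k\in\mathbb N$, and let $$\varphi_1:=\sum_{n=1}^\infty U_1^{\alpha(n)}g_n,\qquad \varphi_2:=\sum_{n=1}^\infty U_2^{\gamma(n)}h_n$$ (both series converge). Then for all $k\in\mathbb N$, $$\|g_k-T_1^{\alpha(k)}\varphi_1\|^2\le\frac{B\lambda^2}{\lambda^2-1}\lambda^{-2[\alpha(k+1)-\alpha(k)]}\quad\text{and}\quad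 \|h_k-T_2^{\gamma(k)}\varphi_2\|^2\le\frac{B\lambda^2}{\lambda^2-1}\lambda^{-2[\gamma(k+1)-\gamma(k)]}.$$ In particular, if for some $\epsilon\in\,]0,A[$ the sequences are chosen such that $\alpha(1)=\gamma(1)=0$ and, for all $k\in\mathbb N$, $$\alpha(k+1)-\alpha(k)\ge\max\left(b(k),\ \frac{k\ln2+\ln\left(\frac{2B}\epsilon\right)+\ln\left(\frac{\lambda^2}{\lambda^2-1}\right)}{2\ln\lambda}\right),$$ $$\gamma(k+1)-\gamma(k)\ge\max\left(L-c(k),\ \frac{k\ln2+\ln\left(\frac{2B}\epsilon\right)+\ln\left(\frac{\lambda^2}{\lambda^2-1}\right)}{2\ln\lambda}\right),$$ then $\{T_1^{\alpha(k)}\varphi_1\}_{k=1}^\infty\cup\{T_2^{\gamma(k)}\varphi_2\}_{k=1}^\infty$ is an $\epsilon$-approximation of the frame $\{g_k\}_{k=1}^\infty\cup\{h_k\}_{k=1}^\infty=\{f_k\}_{k=1}^\infty$ (where $T_1^{\alpha(k)}\varphi_1$ corresponds to $g_k$ and $T_2^{\gamma(k)}\varphi_2$ to $h_k$). Consequently: (i) $\{T_1^{\alpha(k)}\varphi_1\}_{k=1}^\infty\cup\{T_2^{\gamma(k)}\varphi_2\}_{k=1}^\infty$ is a frame for $L^2(\mathbb R)$ with bounds $A(1-\sqrt{\epsilon/A})^2$ and $B(1+\sqrt{\epsilon/B})^2$, and it has the same excess as $\{f_k\}_{k=1}^\infty$; (ii) with $V,\widetilde V$ the synthesis operators and $S,\widetilde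 S$ the frame operators of $\{g_k\}_{k=1}^\infty\cup\{h_k\}_{k=1}^\infty$ and $\{T_1^{\alpha(k)}\varphi_1\}_{k=1}^\infty\cup\{T_2^{\gamma(k)}\varphi_2\}_{k=1}^\infty$, respectively, $$\|V-\widetilde V\|\le\sqrt\epsilon,\quad \|S-\widetilde S\|\le\sqrt{\epsilon B}\left(2+\sqrt{\tfrac{\epsilon}{B}}\right),\quad \|S^{-1}-\widetilde S^{-1}\|\le\frac{\sqrt{\epsilon B}\,(2+\sqrt{\epsilon/B})}{A^2(1-\sqrt{\epsilon/A})^2}.$$
   Context: For a countable index set $I$, a family $\{f_k\}_{k\in I}$ in a Hilbert space $\mathcal H$ is a frame with (lower, upper) frame bounds $A,B>0$ if $A\|f\|^2\le\sum_{k\in I}|\langle f,f_k\rangle|^2\le B\|f\|^2$ for all $f\in\mathcal H$. Its synthesis operator is $V:\ell^2(I)\to\mathcal H$, $V\{c_k\}=\sum_k c_kf_k$, and its frame operator is $S=VV^*$. The excess of a frame is the supremum (in $\mathbb N_0\cup\{\infty\}$) of the numbers $n$ such that some $n$ elements can be removed leaving a frame; equivalently, it is the dimension of the kernel of the synthesis operator (finite or $\infty$). A family $\{\widetilde f_k\}_{k\in I}\subset\mathcal H$ is an $\epsilon$-approximation of a frame $\{f_k\}_{k\in I}$ if $\left\|\sum c_k(f_k-\widetilde f_k)\right\|^2\le\epsilon\sum|c_k|^2$ for all finite scalar sequences $\{c_k\}$. $\chi_E$ is the indicator function of $E$. Unions of sequences are understood as families indexed by the disjoint union of the index sets (counting multiplicities).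 *)

theory Defs
  imports "HOL-Analysis.Analysis"
begin

text \<open>Inner products are linear in the first argument. The norm, topology and real inner product
  of the library classes are the ones induced by the complex inner product.\<close>

class complex_inner = real_inner +
  fixes scaleC :: "complex \<Rightarrow> 'a \<Rightarrow> 'a" (infixr "*\<^sub>C" 75)
    and cinner :: "'a \<Rightarrow> 'a \<Rightarrow> complex"
  assumes scaleC_add_right: "c *\<^sub>C (x + y) = c *\<^sub>C x + c *\<^sub>C y"
    and scaleC_add_left: "(c + d) *\<^sub>C x = c *\<^sub>C x + d *\<^sub>C x"
    and scaleC_scaleC: "c *\<^sub>C d *\<^sub>C x = (c * d) *\<^sub>C x"
    and scaleC_of_real: "complex_of_real r *\<^sub>C x = r *\<^sub>R x"
    and cinner_commute: "cinner x y = cnj (cinner y x)"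
    and cinner_add_left: "cinner (x + y) z = cinner x z + cinner y z"
    and cinner_scaleC_left: "cinner (c *\<^sub>C x) y = c * cinner x y"
    and inner_eq_Re_cinner: "inner x y = Re (cinner x y)"

definition cadjoint :: "('a::complex_inner \<Rightarrow> 'b::complex_inner) \<Rightarrow> 'b \<Rightarrow> 'a" where
  "cadjoint T = (THE G. \<forall>x y. cinner (T x) y = cinner x (G y))"

lemma cmod_add_square_le: "(cmod (a + b))\<^sup>2 \<le> 2 * (cmod a)\<^sup>2 + 2 * (cmod b)\<^sup>2"
proof -
  have "(cmod (a + b))\<^sup>2 \<le> (cmod a + cmod b)\<^sup>2"
    by (intro power_mono norm_triangle_ineq norm_ge_zero)
  also have "\<dots> \<le> 2 * (cmod a)\<^sup>2 + 2 * (cmod b)\<^sup>2"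
    using sum_squares_bound[of "cmod a" "cmod b"] by (simp add: power2_sum)
  finally show ?thesis .
qed

lemma cmod_mult_cnj_le: "cmod (a * cnj b) \<le> (cmod a)\<^sup>2 + (cmod b)\<^sup>2"
proof -
  have "2 * (cmod a * cmod b) \<le> (cmod a)\<^sup>2 + (cmod b)\<^sup>2"
    using sum_squares_bound[of "cmod a" "cmod b"] by simp
  moreover have "0 \<le> cmod a * cmod b"
    by simp
  ultimately show ?thesis
    unfolding norm_mult complex_mod_cnj by linarith
qed

text \<open>$l^2(I)$ with the index set $I$ given as a type.\<close>

typedef 'i ell2 = "{c :: 'i \<Rightarrow> complex. (\<lambda>i. (cmod (c i))\<^sup>2) summable_on UNIV}"
  morphisms ell2_coord Abs_ell2
  by (rule exI[of _ "\<lambda>_. 0"]) simp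

setup_lifting type_definition_ell2

lemma ell2_add_closed:
  assumes "(\<lambda>i. (cmod (c i))\<^sup>2) summable_on UNIV" "(\<lambda>i. (cmod (d i))\<^sup>2) summable_on UNIV"
  shows "(\<lambda>i. (cmod (c i + d i))\<^sup>2) summable_on UNIV"
  by (rule summable_on_comparison_test[where f = "\<lambda>i. 2 * (cmod (c i))\<^sup>2 + 2 * (cmod (d i))\<^sup>2"])
     (use assms in \<open>auto intro!: summable_on_add summable_on_cmult_right cmod_add_square_le\<close>)

lemma ell2_scale_closed:
  assumes "(\<lambda>i. (cmod (c i))\<^sup>2) summable_on UNIV"
  shows "(\<lambda>i. (cmod (z * c i))\<^sup>2) summable_on UNIV"
  unfolding norm_mult power_mult_distrib by (intro summable_on_cmult_right assms)

lemma ell2_mult_summable: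
  assumes "(\<lambda>i. (cmod (c i))\<^sup>2) summable_on UNIV" "(\<lambda>i. (cmod (d i))\<^sup>2) summable_on UNIV"
  shows "(\<lambda>i. c i * cnj (d i)) summable_on UNIV"
proof (rule abs_summable_summable)
  show "(\<lambda>i. cmod (c i * cnj (d i))) summable_on UNIV"
    by (rule Infinite_Sum.abs_summable_on_comparison_test'[OF summable_on_add[OF assms]])
       (rule cmod_mult_cnj_le)
qed

lemma ell2_coord_summable: "(\<lambda>i. (cmod (ell2_coord x i))\<^sup>2) summable_on UNIV"
  using ell2_coord[of x] by simp

instantiation ell2 :: (type) complex_inner
begin

lift_definition zero_ell2 :: "'a ell2" is "\<lambda>_. 0"
  by simp

lift_definition plus_ell2 :: "'a ell2 \<Rightarrow> 'a ell2 \<Rightarrow> 'a ell2" is "\<lambda>c d i. c i + d i"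
  by (rule ell2_add_closed)

lift_definition scaleC_ell2 :: "complex \<Rightarrow> 'a ell2 \<Rightarrow> 'a ell2" is "\<lambda>z c i. z * c i"
  by (rule ell2_scale_closed)

lift_definition uminus_ell2 :: "'a ell2 \<Rightarrow> 'a ell2" is "\<lambda>c i. - c i"
  by simp

lift_definition minus_ell2 :: "'a ell2 \<Rightarrow> 'a ell2 \<Rightarrow> 'a ell2" is "\<lambda>c d i. c i - d i"
  subgoal for c d using ell2_add_closed[of c "\<lambda>i. - d i"] by simp
  done

lift_definition cinner_ell2 :: "'a ell2 \<Rightarrow> 'a ell2 \<Rightarrow> complex"
  is "\<lambda>c d. \<Sum>\<^sub>\<infinity>i\<in>UNIV. c i * cnj (d i)" .

definition scaleR_ell2 :: "real \<Rightarrow> 'a ell2 \<Rightarrow> 'a ell2" where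
  "scaleR_ell2 r x = complex_of_real r *\<^sub>C x"
definition inner_ell2 :: "'a ell2 \<Rightarrow> 'a ell2 \<Rightarrow> real" where
  "inner_ell2 x y = Re (cinner x y)"
definition norm_ell2 :: "'a ell2 \<Rightarrow> real" where
  "norm_ell2 x = sqrt (inner x x)"
definition dist_ell2 :: "'a ell2 \<Rightarrow> 'a ell2 \<Rightarrow> real" where
  "dist_ell2 x y = norm (x - y)"
definition sgn_ell2 :: "'a ell2 \<Rightarrow> 'a ell2" where
  "sgn_ell2 x = inverse (norm x) *\<^sub>R x"
definition uniformity_ell2 :: "('a ell2 \<times> 'a ell2) filter" where
  "uniformity_ell2 = (INF e\<in>{0<..}. principal {(x, y). dist x y < e})"
definition open_ell2 :: "'a ell2 set \<Rightarrow> bool" where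
  "open_ell2 U \<longleftrightarrow> (\<forall>x\<in>U. eventually (\<lambda>(x', y). x' = x \<longrightarrow> y \<in> U) uniformity)"

lemma cinner_add_ell2: "cinner (x + y) z = cinner x z + cinner y (z :: 'a ell2)"
  by transfer (simp add: distrib_right infsum_add ell2_mult_summable)

lemma cinner_scaleC_ell2: "cinner (c *\<^sub>C x) y = c * cinner x (y :: 'a ell2)"
  by transfer (simp add: mult.assoc infsum_cmult_right')

lemma cinner_commute_ell2: "cinner x y = cnj (cinner y (x :: 'a ell2))"
  by transfer (simp flip: infsum_cnj add: mult.commute)

lemma Re_cinner_self_ell2:
  "Re (cinner x x) = (\<Sum>\<^sub>\<infinity>i\<in>UNIV. (cmod (ell2_coord x i))\<^sup>2)"
proof -
  have "Re (ell2_coord x i * cnj (ell2_coord x i)) = (cmod (ell2_coord x i))\<^sup>2" for i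
    by (simp add: complex_mult_cnj cmod_power2)
  thus ?thesis
    using infsum_Re[OF ell2_mult_summable[OF ell2_coord_summable[of x] ell2_coord_summable[of x]]]
    by (simp only: cinner_ell2.rep_eq)
qed

instance
proof
  fix x y z :: "'a ell2" and r s :: real and c d :: complex
  show "x + y + z = x + (y + z)" by transfer (simp add: add.assoc)
  show "x + y = y + x" by transfer (simp add: add.commute)
  show "0 + x = x" by transfer simp
  show "- x + x = 0" by transfer simp
  show "x - y = x + - y" by transfer simp
  show C1: "c *\<^sub>C (x + y) = c *\<^sub>C x + c *\<^sub>C y" for x y :: "'a ell2" and c
    by transfer (simp add: distrib_left)
  show C2: "(c + d) *\<^sub>C x = c *\<^sub>C x + d *\<^sub>C x" for x :: "'a ell2" and c d
    by transfer (simp add: distrib_right)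
  show C3: "c *\<^sub>C d *\<^sub>C x = (c * d) *\<^sub>C x" for x :: "'a ell2" and c d
    by transfer (simp add: mult.assoc)
  show "complex_of_real r *\<^sub>C x = r *\<^sub>R x" by (simp add: scaleR_ell2_def)
  show "r *\<^sub>R (x + y) = r *\<^sub>R x + r *\<^sub>R y" by (simp add: scaleR_ell2_def C1)
  show "(r + s) *\<^sub>R x = r *\<^sub>R x + s *\<^sub>R x" by (simp add: scaleR_ell2_def C2)
  show "r *\<^sub>R s *\<^sub>R x = (r * s) *\<^sub>R x" by (simp add: scaleR_ell2_def C3)
  show "1 *\<^sub>R x = x" unfolding scaleR_ell2_def by transfer simp
  show "cinner x y = cnj (cinner y x)" by (rule cinner_commute_ell2)
  show "cinner (x + y) z = cinner x z + cinner y z" by (rule cinner_add_ell2)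
  show "cinner (c *\<^sub>C x) y = c * cinner x y" by (rule cinner_scaleC_ell2)
  show "inner x y = Re (cinner x y)" by (simp add: inner_ell2_def)
  show "inner x y = inner y x"
    unfolding inner_ell2_def by (subst cinner_commute_ell2) simp
  show "inner (x + y) z = inner x z + inner y z"
    by (simp add: inner_ell2_def cinner_add_ell2)
  show "inner (r *\<^sub>R x) y = r * inner x y"
    by (simp add: inner_ell2_def scaleR_ell2_def cinner_scaleC_ell2)
  show "0 \<le> inner x x"
    by (simp add: inner_ell2_def Re_cinner_self_ell2 infsum_nonneg)
  show "inner x x = 0 \<longleftrightarrow> x = 0"
  proof
    assume "inner x x = 0"
    hence 0: "(\<Sum>\<^sub>\<infinity>i\<in>UNIV. (cmod (ell2_coord x i))\<^sup>2) \<le> 0"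
      by (simp add: inner_ell2_def Re_cinner_self_ell2)
    have "(cmod (ell2_coord x i))\<^sup>2 = 0" for i
      by (rule nonneg_infsum_le_0D[OF 0 ell2_coord_summable]) auto
    thus "x = 0"
      by transfer auto
  next
    assume "x = 0"
    thus "inner x x = 0"
      unfolding inner_ell2_def by transfer simp
  qed
  show "norm x = sqrt (inner x x)" by (rule norm_ell2_def)
  show "dist x y = norm (x - y)" by (rule dist_ell2_def)
  show "sgn x = inverse (norm x) *\<^sub>R x" by (rule sgn_ell2_def)
  show "uniformity = (INF e\<in>{0<..}. principal {(x, y :: 'a ell2). dist x y < e})"
    by (rule uniformity_ell2_def)
  show "open U \<longleftrightarrow> (\<forall>x\<in>U. eventually (\<lambda>(x', y). x' = x \<longrightarrow> y \<in> U) uniformity)" for U :: "'a ell2 set"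
    by (rule open_ell2_def)
qed

end

lemma borel_measurable_cnj [measurable (raw)]:
  "f \<in> borel_measurable M \<Longrightarrow> (\<lambda>x. cnj (f x)) \<in> borel_measurable M"
  by (rule borel_measurable_continuous_on[of cnj]) (intro continuous_intros)

definition sq_integrable :: "(real \<Rightarrow> complex) \<Rightarrow> bool" where
  "sq_integrable f \<longleftrightarrow> f \<in> borel_measurable lborel \<and> integrable lborel (\<lambda>x. (cmod (f x))\<^sup>2)"

text \<open>Equality almost everywhere. Every Lebesgue measurable function agrees almost everywhere with
  a Borel measurable one, so restricting to Borel measurable representatives loses no elements.\<close>

definition L2_eq :: "(real \<Rightarrow> complex) \<Rightarrow> (real \<Rightarrow> complex) \<Rightarrow> bool" where
  "L2_eq f g \<longleftrightarrow> sq_integrable f \<and> sq_integrable g \<and> (AE x in lborel. f x = g x)"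

lemma sq_integrable_0: "sq_integrable (\<lambda>_. 0)"
  by (simp add: sq_integrable_def)

lemma sq_integrable_add:
  assumes "sq_integrable f" "sq_integrable g"
  shows "sq_integrable (\<lambda>x. f x + g x)"
proof -
  have [measurable]: "f \<in> borel_measurable borel" "g \<in> borel_measurable borel"
    using assms by (auto simp: sq_integrable_def)
  have "integrable lborel (\<lambda>x. 2 * (cmod (f x))\<^sup>2 + 2 * (cmod (g x))\<^sup>2)"
    using assms by (auto simp: sq_integrable_def)
  hence "integrable lborel (\<lambda>x. (cmod (f x + g x))\<^sup>2)"
    by (rule Bochner_Integration.integrable_bound)
       (auto intro!: AE_I2 cmod_add_square_le)
  thus ?thesis
    by (simp add: sq_integrable_def)
qed

lemma sq_integrable_scale: "sq_integrable f \<Longrightarrow> sq_integrable (\<lambda>x. c * f x)"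
  by (auto simp: sq_integrable_def norm_mult power_mult_distrib)

lemma sq_integrable_uminus: "sq_integrable f \<Longrightarrow> sq_integrable (\<lambda>x. - f x)"
  using sq_integrable_scale[of f "-1"] by simp

lemma sq_integrable_diff: "sq_integrable f \<Longrightarrow> sq_integrable g \<Longrightarrow> sq_integrable (\<lambda>x. f x - g x)"
  using sq_integrable_add[OF _ sq_integrable_uminus, of f g] by simp

lemma sq_integrable_shift:
  assumes "sq_integrable f"
  shows "sq_integrable (\<lambda>x. f (x + t))"
proof -
  have [measurable]: "f \<in> borel_measurable borel"
    using assms by (auto simp: sq_integrable_def)
  show ?thesis
    using assms lborel_integrable_real_affine[of "\<lambda>x. (cmod (f x))\<^sup>2" 1 t]
    by (simp add: sq_integrable_def add.commute)
qed

lemma sq_integrable_cut: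
  assumes "sq_integrable f" "E \<in> sets borel"
  shows "sq_integrable (\<lambda>x. f x * indicator E x)"
proof -
  have [measurable]: "f \<in> borel_measurable borel" "E \<in> sets borel"
    using assms by (auto simp: sq_integrable_def)
  have "integrable lborel (\<lambda>x. (cmod (f x))\<^sup>2)"
    using assms by (simp add: sq_integrable_def)
  hence "integrable lborel (\<lambda>x. (cmod (f x * indicator E x))\<^sup>2)"
    by (rule Bochner_Integration.integrable_bound)
       (auto intro!: AE_I2 simp: indicator_def)
  thus ?thesis
    by (simp add: sq_integrable_def)
qed

lemma AE_lborel_shift:
  assumes "sq_integrable f" "sq_integrable g" "AE x in lborel. f x = g x"
  shows "AE x in lborel. f (x + t) = g (x + t)"
proof -
  have [measurable]: "f \<in> borel_measurable borel" "g \<in> borel_measurable borel"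
    using assms by (auto simp: sq_integrable_def)
  show ?thesis
    using AE_borel_affine[OF _ _ assms(3), of 1 t] by (simp add: add.commute)
qed

lemma integrable_mult_cnj:
  assumes "sq_integrable f" "sq_integrable g"
  shows "integrable lborel (\<lambda>x. f x * cnj (g x))"
proof -
  have [measurable]: "f \<in> borel_measurable borel" "g \<in> borel_measurable borel"
    using assms by (auto simp: sq_integrable_def)
  have "integrable lborel (\<lambda>x. (cmod (f x))\<^sup>2 + (cmod (g x))\<^sup>2)"
    using assms by (auto simp: sq_integrable_def)
  thus ?thesis
    by (rule Bochner_Integration.integrable_bound)
       (auto intro!: AE_I2 order_trans[OF cmod_mult_cnj_le])
qed

quotient_type L2R = "real \<Rightarrow> complex" / partial: L2_eq
proof (rule part_equivpI)
  show "\<exists>f. L2_eq f f"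
    by (rule exI[of _ "\<lambda>_. 0"]) (simp add: L2_eq_def sq_integrable_0)
  show "symp L2_eq"
    by (rule sympI) (auto simp: L2_eq_def)
  show "transp L2_eq"
    by (rule transpI) (auto simp: L2_eq_def)
qed

instantiation L2R :: complex_inner
begin

lift_definition zero_L2R :: L2R is "\<lambda>_. 0"
  by (simp add: L2_eq_def sq_integrable_0)

lift_definition plus_L2R :: "L2R \<Rightarrow> L2R \<Rightarrow> L2R" is "\<lambda>f g x. f x + g x"
  by (auto simp: L2_eq_def intro: sq_integrable_add)

lift_definition scaleC_L2R :: "complex \<Rightarrow> L2R \<Rightarrow> L2R" is "\<lambda>c f x. c * f x"
  by (auto simp: L2_eq_def intro: sq_integrable_scale)

lift_definition uminus_L2R :: "L2R \<Rightarrow> L2R" is "\<lambda>f x. - f x"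
  by (auto simp: L2_eq_def intro: sq_integrable_uminus)

lift_definition minus_L2R :: "L2R \<Rightarrow> L2R \<Rightarrow> L2R" is "\<lambda>f g x. f x - g x"
  by (auto simp: L2_eq_def intro: sq_integrable_diff)

lift_definition cinner_L2R :: "L2R \<Rightarrow> L2R \<Rightarrow> complex" is "\<lambda>f g. LINT x|lborel. f x * cnj (g x)"
proof -
  fix f f' g g' assume *: "L2_eq f f'" "L2_eq g g'"
  hence [measurable]: "f \<in> borel_measurable borel" "g \<in> borel_measurable borel"
      "f' \<in> borel_measurable borel" "g' \<in> borel_measurable borel"
    by (auto simp: L2_eq_def sq_integrable_def)
  show "(LINT x|lborel. f x * cnj (g x)) = (LINT x|lborel. f' x * cnj (g' x))"
  proof (rule integral_cong_AE)
    from * have "AE x in lborel. f x = f' x" "AE x in lborel. g x = g' x"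
      by (auto simp: L2_eq_def)
    thus "AE x in lborel. f x * cnj (g x) = f' x * cnj (g' x)"
      by eventually_elim simp
  qed auto
qed

definition scaleR_L2R :: "real \<Rightarrow> L2R \<Rightarrow> L2R" where
  "scaleR_L2R r x = complex_of_real r *\<^sub>C x"
definition inner_L2R :: "L2R \<Rightarrow> L2R \<Rightarrow> real" where
  "inner_L2R x y = Re (cinner x y)"
definition norm_L2R :: "L2R \<Rightarrow> real" where
  "norm_L2R x = sqrt (inner x x)"
definition dist_L2R :: "L2R \<Rightarrow> L2R \<Rightarrow> real" where
  "dist_L2R x y = norm (x - y)"
definition sgn_L2R :: "L2R \<Rightarrow> L2R" where
  "sgn_L2R x = inverse (norm x) *\<^sub>R x"
definition uniformity_L2R :: "(L2R \<times> L2R) filter" where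
  "uniformity_L2R = (INF e\<in>{0<..}. principal {(x, y). dist x y < e})"
definition open_L2R :: "L2R set \<Rightarrow> bool" where
  "open_L2R U \<longleftrightarrow> (\<forall>x\<in>U. eventually (\<lambda>(x', y). x' = x \<longrightarrow> y \<in> U) uniformity)"

lemma cinner_add_L2R: "cinner (x + y) z = cinner x z + cinner y (z :: L2R)"
  by transfer (simp add: L2_eq_def distrib_right integrable_mult_cnj)

lemma cinner_scaleC_L2R: "cinner (c *\<^sub>C x) y = c * cinner x (y :: L2R)"
  by transfer (simp add: mult.assoc)

lemma cinner_commute_L2R: "cinner x y = cnj (cinner y (x :: L2R))"
proof transfer
  fix f g :: "real \<Rightarrow> complex"
  have "cnj (LINT x|lborel. g x * cnj (f x)) = (LINT x|lborel. cnj (g x * cnj (f x)))"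
    by (rule Bochner_Integration.integral_cnj[symmetric])
  also have "\<dots> = (LINT x|lborel. f x * cnj (g x))"
    by (rule Bochner_Integration.integral_cong) (simp_all add: mult.commute)
  finally show "(LINT x|lborel. f x * cnj (g x)) = cnj (LINT x|lborel. g x * cnj (f x))" ..
qed

lemma Re_integral_mult_cnj_self:
  "Re (LINT x|lborel. f x * cnj (f x)) = (LINT x|lborel. (cmod (f x))\<^sup>2)"
proof -
  have "f x * cnj (f x) = complex_of_real ((cmod (f x))\<^sup>2)" for x
    by (simp only: complex_norm_square)
  hence "(LINT x|lborel. f x * cnj (f x)) = (LINT x|lborel. complex_of_real ((cmod (f x))\<^sup>2))"
    by (simp only:)
  also have "\<dots> = complex_of_real (LINT x|lborel. (cmod (f x))\<^sup>2)"
    by (rule integral_complex_of_real)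
  finally show ?thesis
    by simp
qed

lemma Re_cinner_eq_0_L2R: "Re (cinner x x) = 0 \<longleftrightarrow> x = (0 :: L2R)"
proof transfer
  fix f assume "L2_eq f f"
  hence f: "sq_integrable f" by (simp add: L2_eq_def)
  hence "integrable lborel (\<lambda>x. (cmod (f x))\<^sup>2)" by (simp add: sq_integrable_def)
  hence "(LINT x|lborel. (cmod (f x))\<^sup>2) = 0 \<longleftrightarrow> (AE x in lborel. (cmod (f x))\<^sup>2 = 0)"
    by (rule integral_nonneg_eq_0_iff_AE) auto
  thus "(Re (LINT x|lborel. f x * cnj (f x)) = 0) = L2_eq f (\<lambda>_. 0)"
    using f by (simp add: Re_integral_mult_cnj_self L2_eq_def sq_integrable_0)
qed

lemma L2_eqI: "sq_integrable f \<Longrightarrow> f = g \<Longrightarrow> L2_eq f g"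
  by (simp add: L2_eq_def)

instance
proof
  fix x y z :: L2R and r s :: real and c d :: complex
  note [intro] = sq_integrable_add sq_integrable_scale sq_integrable_uminus sq_integrable_diff
    sq_integrable_0
  show "x + y + z = x + (y + z)" by transfer (auto simp: L2_eq_def add.assoc)
  show "x + y = y + x" by transfer (auto simp: L2_eq_def add.commute)
  show "0 + x = x" by transfer (auto simp: L2_eq_def)
  show "- x + x = 0" by transfer (auto simp: L2_eq_def)
  show "x - y = x + - y" by transfer (auto simp: L2_eq_def)
  show C1: "c *\<^sub>C (x + y) = c *\<^sub>C x + c *\<^sub>C y" for x y :: L2R and c
    by transfer (rule L2_eqI, auto simp: L2_eq_def distrib_left)
  show C2: "(c + d) *\<^sub>C x = c *\<^sub>C x + d *\<^sub>C x" for x :: L2R and c d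
    by transfer (rule L2_eqI, auto simp: L2_eq_def distrib_right)
  show C3: "c *\<^sub>C d *\<^sub>C x = (c * d) *\<^sub>C x" for x :: L2R and c d
    by transfer (rule L2_eqI, auto simp: L2_eq_def mult.assoc)
  show "complex_of_real r *\<^sub>C x = r *\<^sub>R x" by (simp add: scaleR_L2R_def)
  show "r *\<^sub>R (x + y) = r *\<^sub>R x + r *\<^sub>R y" by (simp add: scaleR_L2R_def C1)
  show "(r + s) *\<^sub>R x = r *\<^sub>R x + s *\<^sub>R x" by (simp add: scaleR_L2R_def C2)
  show "r *\<^sub>R s *\<^sub>R x = (r * s) *\<^sub>R x" by (simp add: scaleR_L2R_def C3)
  show "1 *\<^sub>R x = x" unfolding scaleR_L2R_def by transfer simp
  show "cinner x y = cnj (cinner y x)" by (rule cinner_commute_L2R)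
  show "cinner (x + y) z = cinner x z + cinner y z" by (rule cinner_add_L2R)
  show "cinner (c *\<^sub>C x) y = c * cinner x y" by (rule cinner_scaleC_L2R)
  show "inner x y = Re (cinner x y)" by (simp add: inner_L2R_def)
  show "inner x y = inner y x"
    unfolding inner_L2R_def by (subst cinner_commute_L2R) simp
  show "inner (x + y) z = inner x z + inner y z"
    by (simp add: inner_L2R_def cinner_add_L2R)
  show "inner (r *\<^sub>R x) y = r * inner x y"
    by (simp add: inner_L2R_def scaleR_L2R_def cinner_scaleC_L2R)
  show "0 \<le> inner x x"
    unfolding inner_L2R_def by transfer (simp add: Re_integral_mult_cnj_self)
  show "inner x x = 0 \<longleftrightarrow> x = 0"
    by (simp add: inner_L2R_def Re_cinner_eq_0_L2R)
  show "norm x = sqrt (inner x x)" by (rule norm_L2R_def)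
  show "dist x y = norm (x - y)" by (rule dist_L2R_def)
  show "sgn x = inverse (norm x) *\<^sub>R x" by (rule sgn_L2R_def)
  show "uniformity = (INF e\<in>{0<..}. principal {(x, y :: L2R). dist x y < e})"
    by (rule uniformity_L2R_def)
  show "open U \<longleftrightarrow> (\<forall>x\<in>U. eventually (\<lambda>(x', y). x' = x \<longrightarrow> y \<in> U) uniformity)" for U :: "L2R set"
    by (rule open_L2R_def)
qed

end

text \<open>The support of an element of $L^2$ is the essential support: the complement of the largest
  open set on which the function vanishes almost everywhere.\<close>

lift_definition L2_vanishes_on :: "L2R \<Rightarrow> real set \<Rightarrow> bool"
  is "\<lambda>f U. AE x in lborel. x \<in> U \<longrightarrow> f x = 0"
proof (rule ext)
  fix f g and U :: "real set" assume "L2_eq f g"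
  hence "AE x in lborel. f x = g x" by (simp add: L2_eq_def)
  hence "AE x in lborel. (x \<in> U \<longrightarrow> f x = 0) = (x \<in> U \<longrightarrow> g x = 0)"
    by eventually_elim simp
  thus "(AE x in lborel. x \<in> U \<longrightarrow> f x = 0) = (AE x in lborel. x \<in> U \<longrightarrow> g x = 0)"
    by (rule eventually_subst)
qed

definition L2_supp :: "L2R \<Rightarrow> real set" where
  "L2_supp f = - \<Union>{U. open U \<and> L2_vanishes_on f U}"

lift_definition U1 :: "real \<Rightarrow> L2R \<Rightarrow> L2R"
  is "\<lambda>lam f x. complex_of_real (inverse lam) * f (x - 1)"
proof -
  fix lam f g assume *: "L2_eq f g"
  hence "AE x in lborel. f (x - 1) = g (x - 1)"
    using AE_lborel_shift[of f g "-1"] by (auto simp: L2_eq_def)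
  thus "L2_eq (\<lambda>x. complex_of_real (inverse lam) * f (x - 1))
              (\<lambda>x. complex_of_real (inverse lam) * g (x - 1))"
    using * sq_integrable_shift[of f "-1"] sq_integrable_shift[of g "-1"]
    unfolding L2_eq_def by (auto intro!: sq_integrable_scale)
qed

lift_definition T1 :: "real \<Rightarrow> L2R \<Rightarrow> L2R"
  is "\<lambda>lam f x. complex_of_real lam * f (x + 1) * indicator {0..} x"
proof -
  fix lam f g assume *: "L2_eq f g"
  hence "AE x in lborel. f (x + 1) = g (x + 1)"
    using AE_lborel_shift[of f g 1] by (auto simp: L2_eq_def)
  thus "L2_eq (\<lambda>x. complex_of_real lam * f (x + 1) * indicator {0..} x)
              (\<lambda>x. complex_of_real lam * g (x + 1) * indicator {0..} x)"
    using * unfolding L2_eq_def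
    by (auto intro!: sq_integrable_cut sq_integrable_scale sq_integrable_shift)
qed

lift_definition U2 :: "real \<Rightarrow> L2R \<Rightarrow> L2R"
  is "\<lambda>lam f x. complex_of_real (inverse lam) * f (x + 1)"
proof -
  fix lam f g assume *: "L2_eq f g"
  hence "AE x in lborel. f (x + 1) = g (x + 1)"
    using AE_lborel_shift[of f g 1] by (auto simp: L2_eq_def)
  thus "L2_eq (\<lambda>x. complex_of_real (inverse lam) * f (x + 1))
              (\<lambda>x. complex_of_real (inverse lam) * g (x + 1))"
    using * unfolding L2_eq_def by (auto intro!: sq_integrable_scale sq_integrable_shift)
qed

lift_definition T2 :: "real \<Rightarrow> real \<Rightarrow> L2R \<Rightarrow> L2R"
  is "\<lambda>lam L f x. complex_of_real lam * f (x - 1) * indicator {..L} x"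
proof -
  fix lam L f g assume *: "L2_eq f g"
  hence "AE x in lborel. f (x - 1) = g (x - 1)"
    using AE_lborel_shift[of f g "-1"] by (auto simp: L2_eq_def)
  thus "L2_eq (\<lambda>x. complex_of_real lam * f (x - 1) * indicator {..L} x)
              (\<lambda>x. complex_of_real lam * g (x - 1) * indicator {..L} x)"
    using * sq_integrable_shift[of f "-1"] sq_integrable_shift[of g "-1"]
    unfolding L2_eq_def by (auto intro!: sq_integrable_cut sq_integrable_scale)
qed

text \<open>The summability conjunct is needed because \<^const>\<open>infsum\<close> is 0 on divergent families.\<close>

definition frame_bounds :: "'i set \<Rightarrow> ('i \<Rightarrow> 'h::complex_inner) \<Rightarrow> real \<Rightarrow> real \<Rightarrow> bool" where
  "frame_bounds I F A B \<longleftrightarrow> countable I \<and> A > 0 \<and> B > 0 \<and>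
     (\<forall>f. (\<lambda>k. (cmod (cinner f (F k)))\<^sup>2) summable_on I \<and>
          A * (norm f)\<^sup>2 \<le> (\<Sum>\<^sub>\<infinity>k\<in>I. (cmod (cinner f (F k)))\<^sup>2) \<and>
          (\<Sum>\<^sub>\<infinity>k\<in>I. (cmod (cinner f (F k)))\<^sup>2) \<le> B * (norm f)\<^sup>2)"

definition is_frame :: "'i set \<Rightarrow> ('i \<Rightarrow> 'h::complex_inner) \<Rightarrow> bool" where
  "is_frame I F \<longleftrightarrow> (\<exists>A B. frame_bounds I F A B)"

text \<open>Elements are removed by index, hence with multiplicity.\<close>

definition excess :: "'i set \<Rightarrow> ('i \<Rightarrow> 'h::complex_inner) \<Rightarrow> enat" where
  "excess I F = Sup {enat (card J) | J. J \<subseteq> I \<and> finite J \<and> is_frame (I - J) F}"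

definition eps_approximation ::
    "real \<Rightarrow> 'i set \<Rightarrow> ('i \<Rightarrow> 'h::complex_inner) \<Rightarrow> ('i \<Rightarrow> 'h) \<Rightarrow> bool" where
  "eps_approximation \<epsilon> I F F' \<longleftrightarrow>
     (\<forall>J c. finite J \<and> J \<subseteq> I \<longrightarrow>
        (norm (\<Sum>k\<in>J. c k *\<^sub>C (F k - F' k)))\<^sup>2 \<le> \<epsilon> * (\<Sum>k\<in>J. (cmod (c k))\<^sup>2))"

definition synthesis :: "('i \<Rightarrow> 'h::complex_inner) \<Rightarrow> 'i ell2 \<Rightarrow> 'h" where
  "synthesis F c = (\<Sum>\<^sub>\<infinity>k\<in>UNIV. ell2_coord c k *\<^sub>C F k)"

definition frame_operator :: "('i \<Rightarrow> 'h::complex_inner) \<Rightarrow> 'h \<Rightarrow> 'h" where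
  "frame_operator F = synthesis F \<circ> cadjoint (synthesis F)"

text \<open>The operator norm bound; boundedness is included because \<^const>\<open>onorm\<close> is unspecified for
  unbounded maps.\<close>

definition opnorm_le :: "('a::real_normed_vector \<Rightarrow> 'b::real_normed_vector) \<Rightarrow> real \<Rightarrow> bool" where
  "opnorm_le T C \<longleftrightarrow> bounded_linear T \<and> onorm T \<le> C"

end

theory Submission
  imports Defs
begin

text \<open>The gaps of \<open>\<alpha>\<close> make the shifted functions \<open>U1\<^sup>\<alpha>\<^sup>n g n\<close> have essentially disjoint supports.
  Applying \<open>T1\<^sup>\<alpha>\<^sup>k\<close> to their sum therefore kills the terms before the \<open>k\<close>-th, recovers \<open>g k\<close> and leaves
  an orthogonal tail, whose norm is a geometric series. A reflection turns the family \<open>h\<close> into the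
  same situation. With the stronger gaps the errors sum up to at most \<open>\<epsilon>\<close>, and Cauchy-Schwarz gives
  the \<open>\<epsilon>\<close>-approximation. The frame bounds and operator estimates are the triangle inequality for the
  synthesis and analysis operators. For the excess, \<open>n\<close> elements can be removed iff the kernel of the
  synthesis operator maps onto the corresponding \<open>n\<close> coordinates, which is possible for some choice
  of \<open>n\<close> elements iff the kernel has dimension at least \<open>n\<close>; and the two kernels embed linearly into
  each other, because a right inverse of \<open>V\<close> is, up to a bijection, also one of the perturbed
  operator.\<close>

section \<open>Complex inner product spaces\<close>

text \<open>In the orthogonal tail squared norms add up, so the error constant is B times the sum of
  lam^(-2j), that is B lam^2 / (lam^2 - 1); adding norms would give a worse one. The logarithmic gap
  is this bound solved for the exponent, with target \<epsilon>/2 * 2^(-k), so each of the two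
  families gets \<epsilon>/2. On the left side the cut-off sits at L because a support that meets
  the negative axis and has length at most L ends before L.

  No dimension is ever defined: that a kernel has dimension at least n is expressed by some n
  coordinates onto which it maps. Injective linear maps transport the existence of such coordinates,
  and they are exactly the removable elements. To reach every \<epsilon> < A, the argument needs a
  right inverse of V of norm at most 1 / sqrt A, which is the pseudo-inverse. Bijectivity comes from
  Banach's fixed point theorem, which, like the convergence of the synthesis series, rests on the
  completeness of L^2(R), proved below. Since \<open>bounded_linear\<close> is only real linear,
  complex homogeneity is tracked separately.\<close>

lemma scaleC_zero_left [simp]: "0 *\<^sub>C x = (0 :: 'a::complex_inner)"
  using scaleC_of_real[of 0 x] by simp

lemma scaleC_one [simp]: "1 *\<^sub>C x = (x :: 'a::complex_inner)"
  using scaleC_of_real[of 1 x] by simp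

lemma scaleC_minus_one: "(-1) *\<^sub>C x = - (x :: 'a::complex_inner)"
  using scaleC_of_real[of "-1" x] by simp

lemma scaleC_zero_right [simp]: "c *\<^sub>C 0 = (0 :: 'a::complex_inner)"
  using scaleC_add_right[of c 0 "0 :: 'a"] by simp

lemma scaleC_minus_right: "c *\<^sub>C (- x) = - (c *\<^sub>C x :: 'a::complex_inner)"
  using scaleC_scaleC[of c "-1" x] scaleC_scaleC[of "-1" c x] by (simp add: scaleC_minus_one)

lemma scaleC_diff_right: "c *\<^sub>C (x - y) = c *\<^sub>C x - (c *\<^sub>C y :: 'a::complex_inner)"
  using scaleC_add_right[of c x "- y"] by (simp add: scaleC_minus_right)

lemma scaleC_scaleR_right: "c *\<^sub>C (r *\<^sub>R x) = r *\<^sub>R (c *\<^sub>C (x :: 'a::complex_inner))"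
  by (simp add: scaleC_scaleC mult.commute flip: scaleC_of_real)

lemma cinner_zero_left [simp]: "cinner 0 (y :: 'a::complex_inner) = 0"
  using cinner_scaleC_left[of 0 0 y] by simp

lemma cinner_zero_right [simp]: "cinner (y :: 'a::complex_inner) 0 = 0"
  by (subst cinner_commute) simp

lemma cinner_add_right: "cinner x (y + z) = cinner x y + cinner x (z :: 'a::complex_inner)"
proof -
  have "cinner x (y + z) = cnj (cinner (y + z) x)" by (rule cinner_commute)
  also have "\<dots> = cnj (cinner y x) + cnj (cinner z x)" by (simp add: cinner_add_left)
  finally show ?thesis by (simp flip: cinner_commute)
qed

lemma cinner_scaleC_right: "cinner x (c *\<^sub>C y) = cnj c * cinner x (y :: 'a::complex_inner)"
proof -
  have "cinner x (c *\<^sub>C y) = cnj (cinner (c *\<^sub>C y) x)" by (rule cinner_commute)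
  also have "\<dots> = cnj c * cnj (cinner y x)" by (simp add: cinner_scaleC_left)
  finally show ?thesis by (simp flip: cinner_commute)
qed

lemma cinner_diff_right: "cinner x (y - z) = cinner x y - cinner x (z :: 'a::complex_inner)"
  using cinner_add_right[of x y "(-1) *\<^sub>C z"] cinner_scaleC_right[of x "-1" z]
  by (simp add: scaleC_minus_one)

lemma cinner_sum_left: "cinner (sum f J) (y :: 'a::complex_inner) = (\<Sum>k\<in>J. cinner (f k) y)"
  by (induction J rule: infinite_finite_induct) (simp_all add: cinner_add_left)

lemma cinner_self: "cinner x (x :: 'a::complex_inner) = complex_of_real ((norm x)\<^sup>2)"
proof (rule complex_eqI)
  have "cinner x x = cnj (cinner x x)" by (rule cinner_commute)
  hence "Im (cinner x x) = Im (cnj (cinner x x))" by simp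
  thus "Im (cinner x x) = Im (complex_of_real ((norm x)\<^sup>2))" by simp
  show "Re (cinner x x) = Re (complex_of_real ((norm x)\<^sup>2))"
    by (simp add: power2_norm_eq_inner inner_eq_Re_cinner)
qed

lemma norm_scaleC: "norm (c *\<^sub>C x) = cmod c * norm (x :: 'a::complex_inner)"
proof -
  have "complex_of_real ((norm (c *\<^sub>C x))\<^sup>2) = (c * cnj c) * complex_of_real ((norm x)\<^sup>2)"
    unfolding cinner_self[symmetric] by (simp add: cinner_scaleC_left cinner_scaleC_right)
  also have "c * cnj c = complex_of_real ((cmod c)\<^sup>2)"
    by (simp only: complex_norm_square)
  finally have "(norm (c *\<^sub>C x))\<^sup>2 = (cmod c * norm x)\<^sup>2"
    unfolding power_mult_distrib by (simp only: of_real_mult[symmetric] of_real_eq_iff)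
  thus ?thesis by (simp add: power2_eq_iff_nonneg)
qed

text \<open>Real Cauchy-Schwarz bounds only the real part. Multiplying \<open>x\<close> by a
  unimodular \<open>u\<close> changes no norm and turns the inner product into its modulus.\<close>

lemma norm_cinner_le: "cmod (cinner x y) \<le> norm x * norm (y :: 'a::complex_inner)"
proof (cases "cinner x y = 0")
  case False
  define u where "u = cnj (sgn (cinner x y))"
  have u: "cmod u = 1" using False by (simp add: u_def norm_sgn)
  have "complex_of_real (cmod (cinner x y)) = u * cinner x y"
    using False complex_norm_square[of "cinner x y"]
    by (simp add: u_def sgn_eq field_simps power2_eq_square)
  hence "cmod (cinner x y) = Re (cinner (u *\<^sub>C x) y)"
    by (metis Re_complex_of_real cinner_scaleC_left)
  also have "\<dots> \<le> norm (u *\<^sub>C x) * norm y"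
    unfolding inner_eq_Re_cinner[symmetric] by (rule norm_cauchy_schwarz)
  finally show ?thesis by (simp add: norm_scaleC u)
qed simp

lemma bounded_linear_cinner_left: "bounded_linear (\<lambda>x. cinner x (y :: 'a::complex_inner))"
proof (rule bounded_linear_intro[where K = "norm y"])
  show "cinner (r *\<^sub>R x) y = r *\<^sub>R cinner x y" for r x
    by (simp add: cinner_scaleC_left scaleR_conv_of_real flip: scaleC_of_real)
qed (auto simp: cinner_add_left norm_cinner_le)

lemma bounded_linear_scaleC: "bounded_linear (\<lambda>x :: 'a::complex_inner. c *\<^sub>C x)"
  by (rule bounded_linear_intro[where K = "cmod c"])
     (auto simp: scaleC_add_right scaleC_scaleR_right norm_scaleC)

lemma cinner_eqI:
  assumes "\<And>x. cinner x y = cinner x (z :: 'a::complex_inner)"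
  shows "y = z"
proof -
  have "cinner (y - z) (y - z) = 0"
    using assms[of "y - z"] by (simp add: cinner_diff_right)
  thus ?thesis by (simp add: cinner_self)
qed

lemma cadjoint_eqI:
  assumes "\<And>x y. cinner (T x) y = cinner x (G y)"
  shows "cadjoint T = G"
  unfolding cadjoint_def
proof (rule the_equality)
  show "\<forall>x y. cinner (T x) y = cinner x (G y)" using assms by blast
  show "H = G" if "\<forall>x y. cinner (T x) y = cinner x (H y)" for H
    by (rule ext, rule cinner_eqI) (metis assms that)
qed

lemma opnorm_leI:
  assumes "bounded_linear T" "0 \<le> C" "\<And>x. norm (T x) \<le> C * norm x"
  shows "opnorm_le T C"
  using assms unfolding opnorm_le_def by (auto intro: onorm_bound)

section \<open>Square summable sequences\<close>

lemma ell2_norm_square_has_sum: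
  "((\<lambda>i. (cmod (ell2_coord c i))\<^sup>2) has_sum (norm c)\<^sup>2) UNIV"
proof -
  have "(norm c)\<^sup>2 = (\<Sum>\<^sub>\<infinity>i. (cmod (ell2_coord c i))\<^sup>2)"
    using Re_cinner_self_ell2[of c] cinner_self[of c] by simp
  thus ?thesis
    using has_sum_infsum[OF ell2_coord_summable[of c]] by simp
qed

lemma L2_set_le_norm_ell2: "L2_set (\<lambda>i. cmod (ell2_coord c i)) J \<le> norm c"
proof (cases "finite J")
  case True
  have "(\<Sum>i\<in>J. (cmod (ell2_coord c i))\<^sup>2) \<le> (norm c)\<^sup>2"
    using finite_sum_le_has_sum[OF ell2_norm_square_has_sum, of J] True by simp
  thus ?thesis unfolding L2_set_def
    using real_sqrt_le_mono by fastforce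
qed simp

lemma square_summable_le:
  assumes "\<And>J. finite J \<Longrightarrow> L2_set (\<lambda>i. cmod (c i)) J \<le> M"
  shows "(\<lambda>i. (cmod (c i))\<^sup>2) summable_on UNIV" "(\<Sum>\<^sub>\<infinity>i. (cmod (c i))\<^sup>2) \<le> M\<^sup>2"
proof -
  have *: "(\<Sum>i\<in>J. (cmod (c i))\<^sup>2) \<le> M\<^sup>2" if "finite J" for J
    using assms[OF that] unfolding L2_set_def by (rule sqrt_le_D)
  show 1: "(\<lambda>i. (cmod (c i))\<^sup>2) summable_on UNIV"
    by (rule nonneg_bdd_above_summable_on) (auto intro!: bdd_aboveI2[where M = "M\<^sup>2"] *)
  show "(\<Sum>\<^sub>\<infinity>i. (cmod (c i))\<^sup>2) \<le> M\<^sup>2"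
    by (rule infsum_le_finite_sums[OF 1]) (use * in auto)
qed

lemma ell2_coord_diff: "ell2_coord (x - y) i = ell2_coord x i - ell2_coord y i"
  by transfer simp

lemma ell2_coord_add: "ell2_coord (x + y) i = ell2_coord x i + ell2_coord y i"
  by transfer simp

lemma ell2_coord_scaleC: "ell2_coord (z *\<^sub>C x) i = z * ell2_coord x i"
  by transfer simp

lemma ell2_coord_zero [simp]: "ell2_coord 0 i = 0"
  by transfer simp

lemma ell2_coord_sum: "ell2_coord (sum f J) i = (\<Sum>j\<in>J. ell2_coord (f j) i)"
  by (induction J rule: infinite_finite_induct) (simp_all add: ell2_coord_add)

lemma ell2_eqI: "(\<And>i. ell2_coord x i = ell2_coord y i) \<Longrightarrow> x = y"
  by (simp add: ell2_coord_inject[symmetric] fun_eq_iff)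

section \<open>Bessel families\<close>

text \<open>\<open>M\<close> bounds the synthesis operator on finite sums, so it is the square root
  of the usual Bessel bound. In this form bounds add up when families are subtracted, and an
  \<epsilon>-approximation amounts to a Bessel difference with
  \<open>M = sqrt \<epsilon>\<close>.\<close>

definition bessel :: "real \<Rightarrow> ('i \<Rightarrow> 'h::complex_inner) \<Rightarrow> bool" where
  "bessel M F \<longleftrightarrow> 0 \<le> M \<and>
     (\<forall>J c. finite J \<longrightarrow> norm (\<Sum>k\<in>J. c k *\<^sub>C F k) \<le> M * L2_set (\<lambda>k. cmod (c k)) J)"

lemma besselD:
  assumes "bessel M F" "finite J"
  shows "norm (\<Sum>k\<in>J. c k *\<^sub>C F k) \<le> M * L2_set (\<lambda>k. cmod (c k)) J"
  using assms unfolding bessel_def by blast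

lemma bessel_nonneg: "bessel M F \<Longrightarrow> 0 \<le> M"
  by (simp add: bessel_def)

lemma bessel_diff:
  assumes "bessel M F" "bessel N G"
  shows "bessel (M + N) (\<lambda>k. F k - G k)"
  unfolding bessel_def
proof safe
  show "0 \<le> M + N" using assms by (auto simp: bessel_def)
next
  fix J :: "'a set" and c assume J: "finite J"
  have "norm (\<Sum>k\<in>J. c k *\<^sub>C (F k - G k)) = norm ((\<Sum>k\<in>J. c k *\<^sub>C F k) - (\<Sum>k\<in>J. c k *\<^sub>C G k))"
    by (simp add: scaleC_diff_right sum_subtractf)
  also have "\<dots> \<le> norm (\<Sum>k\<in>J. c k *\<^sub>C F k) + norm (\<Sum>k\<in>J. c k *\<^sub>C G k)"
    by (rule norm_triangle_ineq4)
  also have "\<dots> \<le> M * L2_set (\<lambda>k. cmod (c k)) J + N * L2_set (\<lambda>k. cmod (c k)) J"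
    by (intro add_mono besselD assms J)
  finally show "norm (\<Sum>k\<in>J. c k *\<^sub>C (F k - G k)) \<le> (M + N) * L2_set (\<lambda>k. cmod (c k)) J"
    by (simp add: distrib_right)
qed

text \<open>Duality: for the coefficients \<open>cinner x (F k)\<close> the synthesized vector
  \<open>y\<close> has inner product \<open>s\<^sup>2\<close> with \<open>x\<close>. Cauchy-Schwarz
  and the Bessel bound for \<open>y\<close> leave a factor \<open>s\<close> to cancel.\<close>

lemma bessel_analysis_le:
  assumes F: "bessel M F" and J: "finite J"
  shows "L2_set (\<lambda>k. cmod (cinner x (F k))) J \<le> M * norm x"
proof -
  define s where "s = L2_set (\<lambda>k. cmod (cinner x (F k))) J"
  define y where "y = (\<Sum>k\<in>J. cinner x (F k) *\<^sub>C F k)"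
  have "cinner y x = (\<Sum>k\<in>J. cinner x (F k) * cnj (cinner x (F k)))"
    unfolding y_def cinner_sum_left cinner_scaleC_left by (metis cinner_commute)
  also have "\<dots> = complex_of_real (s\<^sup>2)"
    unfolding s_def L2_set_def
    by (simp add: sum_nonneg flip: complex_norm_square of_real_power)
  finally have "s\<^sup>2 = cmod (cinner y x)"
    by (simp add: norm_power s_def)
  also have "\<dots> \<le> norm y * norm x" by (rule norm_cinner_le)
  also have "\<dots> \<le> M * s * norm x"
    unfolding y_def s_def by (intro mult_right_mono besselD[OF F J] norm_ge_zero)
  finally have "s * s \<le> s * (M * norm x)" by (simp add: power2_eq_square mult_ac)
  moreover have "0 \<le> s" "0 \<le> M * norm x"
    using bessel_nonneg[OF F] by (simp_all add: s_def)
  ultimately show ?thesis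
    unfolding s_def[symmetric] by (cases "s = 0") (auto simp: mult_le_cancel_left)
qed

text \<open>The other half of the duality: expanding \<open>cinner y y\<close> in the first argument
  and applying Cauchy-Schwarz to the coefficients brings in the analysis of \<open>y\<close> itself,
  after which a factor \<open>norm y\<close> cancels.\<close>

lemma bessel_of_analysis_le:
  fixes F :: "'i \<Rightarrow> 'h::complex_inner"
  assumes M: "0 \<le> M"
    and le: "\<And>x J. finite J \<Longrightarrow> L2_set (\<lambda>k. cmod (cinner x (F k))) J \<le> M * norm x"
  shows "bessel M F"
  unfolding bessel_def
proof safe
  fix J :: "'i set" and c assume J: "finite J"
  define y where "y = (\<Sum>k\<in>J. c k *\<^sub>C F k)"
  define s where "s = L2_set (\<lambda>k. cmod (c k)) J"
  have "(norm y)\<^sup>2 = cmod (cinner y y)"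
    by (simp add: cinner_self norm_power)
  also have "cinner y y = (\<Sum>k\<in>J. c k * cinner (F k) y)"
    by (subst y_def) (simp only: cinner_sum_left cinner_scaleC_left)
  also have "cmod \<dots> \<le> (\<Sum>k\<in>J. \<bar>cmod (c k)\<bar> * \<bar>cmod (cinner y (F k))\<bar>)"
  proof (rule order_trans[OF norm_sum], rule sum_mono)
    fix k show "cmod (c k * cinner (F k) y) \<le> \<bar>cmod (c k)\<bar> * \<bar>cmod (cinner y (F k))\<bar>"
      by (subst cinner_commute) (simp add: norm_mult)
  qed
  also have "\<dots> \<le> s * L2_set (\<lambda>k. cmod (cinner y (F k))) J"
    unfolding s_def by (rule L2_set_mult_ineq)
  also have "\<dots> \<le> s * (M * norm y)"
    by (intro mult_left_mono le J) (simp add: s_def)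
  finally have "norm y * norm y \<le> norm y * (M * s)" by (simp add: power2_eq_square mult_ac)
  moreover have "0 \<le> M * s" using M by (simp add: s_def)
  ultimately show "norm (\<Sum>k\<in>J. c k *\<^sub>C F k) \<le> M * L2_set (\<lambda>k. cmod (c k)) J"
    unfolding s_def[symmetric] y_def[symmetric] by (cases "y = 0") (auto simp: mult_le_cancel_left)
qed (rule M)

lemma eps_approximation_iff_bessel:
  assumes "0 \<le> \<epsilon>"
  shows "eps_approximation \<epsilon> UNIV F F' \<longleftrightarrow> bessel (sqrt \<epsilon>) (\<lambda>k. F k - F' k)"
proof -
  have "(norm y)\<^sup>2 \<le> \<epsilon> * (\<Sum>k\<in>J. (cmod (c k))\<^sup>2) \<longleftrightarrow>
        norm y \<le> sqrt \<epsilon> * L2_set (\<lambda>k. cmod (c k)) J" for y :: 'b and c and J :: "'a set"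
  proof -
    have "(sqrt \<epsilon> * L2_set (\<lambda>k. cmod (c k)) J)\<^sup>2 = \<epsilon> * (\<Sum>k\<in>J. (cmod (c k))\<^sup>2)"
      using assms by (simp add: L2_set_def power_mult_distrib sum_nonneg)
    moreover have "0 \<le> sqrt \<epsilon> * L2_set (\<lambda>k. cmod (c k)) J"
      using assms by simp
    ultimately show ?thesis by (metis norm_ge_zero power2_le_imp_le power_mono)
  qed
  thus ?thesis
    unfolding eps_approximation_def bessel_def using assms by simp
qed

lemma summable_on_Cauchy:
  fixes f :: "'i \<Rightarrow> 'a::banach"
  assumes "\<And>e. 0 < e \<Longrightarrow> \<exists>P. finite P \<and> (\<forall>Q. finite Q \<and> Q \<inter> P = {} \<longrightarrow> norm (sum f Q) < e)"
  shows "f summable_on UNIV"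
proof -
  have "cauchy_filter (filtermap (sum f) (finite_subsets_at_top UNIV))"
    unfolding cauchy_filter_metric_filtermap
  proof safe
    fix e :: real assume "0 < e"
    then obtain P where P: "finite P" "\<And>Q. finite Q \<Longrightarrow> Q \<inter> P = {} \<Longrightarrow> norm (sum f Q) < e / 2"
      using assms[of "e / 2"] by auto
    have "dist (sum f X) (sum f Y) < e" if "finite X" "P \<subseteq> X" "finite Y" "P \<subseteq> Y" for X Y
    proof -
      have d: "norm (sum f Z - sum f P) < e / 2" if "finite Z" "P \<subseteq> Z" for Z
        using P(2)[of "Z - P"] that by (auto simp: sum_diff)
      have "dist (sum f X) (sum f P) < e / 2" "dist (sum f Y) (sum f P) < e / 2"
        using d that by (auto simp: dist_norm)
      thus ?thesis using dist_triangle_half_l by blast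
    qed
    moreover have "eventually (\<lambda>X. finite X \<and> P \<subseteq> X) (finite_subsets_at_top UNIV)"
      using P(1) by (auto simp: eventually_finite_subsets_at_top)
    ultimately show "\<exists>R. eventually R (finite_subsets_at_top UNIV) \<and>
        (\<forall>X Y. R X \<and> R Y \<longrightarrow> dist (sum f X) (sum f Y) < e)"
      by blast
  qed
  moreover have "complete (UNIV :: 'a set)" by (rule complete_UNIV)
  ultimately obtain l where "(sum f \<longlongrightarrow> l) (finite_subsets_at_top UNIV)"
    using complete_uniform[where S = UNIV] by (force simp add: filterlim_def)
  thus ?thesis using summable_on_def has_sum_def by blast
qed

lemma bessel_summable:
  fixes F :: "'i \<Rightarrow> 'h::{complex_inner, banach}"
  assumes F: "bessel M F"
  shows "(\<lambda>k. ell2_coord c k *\<^sub>C F k) summable_on UNIV"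
proof (rule summable_on_Cauchy)
  fix e :: real assume e: "0 < e"
  \<comment> \<open>The \<open>+ 1\<close> avoids a division by 0 and makes \<open>M * d < e\<close>
    strict.\<close>
  define d where "d = e / (M + 1)"
  have M: "0 \<le> M" using F by (rule bessel_nonneg)
  hence d: "0 < d" "M * d < e" using e by (simp_all add: d_def field_simps)
  have "eventually (\<lambda>J. dist (\<Sum>i\<in>J. (cmod (ell2_coord c i))\<^sup>2) ((norm c)\<^sup>2) < d\<^sup>2)
          (finite_subsets_at_top UNIV)"
    by (rule tendstoD[OF ell2_norm_square_has_sum[unfolded has_sum_def]]) (use d in simp)
  then obtain P where P: "finite P"
      "\<And>J. finite J \<Longrightarrow> P \<subseteq> J \<Longrightarrow> dist (\<Sum>i\<in>J. (cmod (ell2_coord c i))\<^sup>2) ((norm c)\<^sup>2) < d\<^sup>2"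
    by (auto simp: eventually_finite_subsets_at_top)
  \<comment> \<open>A set disjoint from \<open>P\<close> can only contribute what \<open>P\<close>
    misses of the squared norm of \<open>c\<close>, which is less than
    \<open>d\<^sup>2\<close>.\<close>
  have "norm (\<Sum>k\<in>Q. ell2_coord c k *\<^sub>C F k) < e" if Q: "finite Q" "Q \<inter> P = {}" for Q
  proof -
    have "(\<Sum>i\<in>Q \<union> P. (cmod (ell2_coord c i))\<^sup>2) \<le> (norm c)\<^sup>2"
      using finite_sum_le_has_sum[OF ell2_norm_square_has_sum, of "Q \<union> P"] Q P by simp
    moreover have "(\<Sum>i\<in>Q \<union> P. (cmod (ell2_coord c i))\<^sup>2)
        = (\<Sum>i\<in>Q. (cmod (ell2_coord c i))\<^sup>2) + (\<Sum>i\<in>P. (cmod (ell2_coord c i))\<^sup>2)"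
      using Q P by (intro sum.union_disjoint) auto
    ultimately have "(\<Sum>i\<in>Q. (cmod (ell2_coord c i))\<^sup>2) \<le> d\<^sup>2"
      using P(2)[of P] P(1) by (simp add: dist_real_def)
    hence "L2_set (\<lambda>i. cmod (ell2_coord c i)) Q \<le> d"
      unfolding L2_set_def using d by (intro real_le_lsqrt) (auto simp: sum_nonneg)
    hence "M * L2_set (\<lambda>i. cmod (ell2_coord c i)) Q \<le> M * d"
      using M by (intro mult_left_mono)
    thus ?thesis
      using besselD[OF F Q(1), of "ell2_coord c"] d by linarith
  qed
  thus "\<exists>P. finite P \<and> (\<forall>Q. finite Q \<and> Q \<inter> P = {} \<longrightarrow> norm (\<Sum>k\<in>Q. ell2_coord c k *\<^sub>C F k) < e)"
    using P(1) by blast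
qed

context
  fixes F :: "'i \<Rightarrow> 'h::{complex_inner, banach}" and M
  assumes F: "bessel M F"
begin

lemma synthesis_has_sum: "((\<lambda>k. ell2_coord c k *\<^sub>C F k) has_sum synthesis F c) UNIV"
  unfolding synthesis_def by (rule has_sum_infsum[OF bessel_summable[OF F]])

lemma norm_synthesis_le: "norm (synthesis F c) \<le> M * norm c"
proof (rule tendsto_upperbound)
  show "((\<lambda>J. norm (\<Sum>k\<in>J. ell2_coord c k *\<^sub>C F k)) \<longlongrightarrow> norm (synthesis F c))
          (finite_subsets_at_top UNIV)"
    by (rule tendsto_norm[OF synthesis_has_sum[unfolded has_sum_def]])
  show "eventually (\<lambda>J. norm (\<Sum>k\<in>J. ell2_coord c k *\<^sub>C F k) \<le> M * norm c)
          (finite_subsets_at_top UNIV)"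
    unfolding eventually_finite_subsets_at_top
    using besselD[OF F] mult_left_mono[OF L2_set_le_norm_ell2[of c] bessel_nonneg[OF F]]
    by (meson order_trans finite.emptyI empty_subsetI)
qed (simp add: finite_subsets_at_top_neq_bot)

lemma synthesis_add: "synthesis F (c + d) = synthesis F c + synthesis F d"
proof (rule has_sum_unique[OF synthesis_has_sum])
  show "((\<lambda>k. ell2_coord (c + d) k *\<^sub>C F k) has_sum (synthesis F c + synthesis F d)) UNIV"
    using has_sum_add[OF synthesis_has_sum[of c] synthesis_has_sum[of d]]
    by (simp add: ell2_coord_add scaleC_add_left)
qed

lemma synthesis_scaleC: "synthesis F (z *\<^sub>C c) = z *\<^sub>C synthesis F c"
proof (rule has_sum_unique[OF synthesis_has_sum])
  show "((\<lambda>k. ell2_coord (z *\<^sub>C c) k *\<^sub>C F k) has_sum (z *\<^sub>C synthesis F c)) UNIV"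
    using has_sum_bounded_linear[OF bounded_linear_scaleC[of z] synthesis_has_sum[of c]]
    by (simp add: ell2_coord_scaleC scaleC_scaleC)
qed

lemma bounded_linear_synthesis: "bounded_linear (synthesis F)"
  by (rule bounded_linear_intro[where K = M])
     (use norm_synthesis_le synthesis_add synthesis_scaleC in
       \<open>auto simp: mult.commute simp flip: scaleC_of_real\<close>)

end

text \<open>The adjoint of the synthesis operator. Square summability of the coefficients comes from
  a Bessel bound, hence that premise in the facts below.\<close>

definition analysis :: "('i \<Rightarrow> 'h::complex_inner) \<Rightarrow> 'h \<Rightarrow> 'i ell2" where
  "analysis F x = Abs_ell2 (\<lambda>k. cinner x (F k))"

lemma ell2_coord_analysis:
  assumes "bessel M F"
  shows "ell2_coord (analysis F x) k = cinner x (F k)"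
  unfolding analysis_def
  using square_summable_le(1)[OF bessel_analysis_le[OF assms]]
  by (simp add: Abs_ell2_inverse)

lemma norm_analysis_le:
  assumes "bessel M F"
  shows "norm (analysis F x) \<le> M * norm x"
proof (rule power2_le_imp_le)
  show "(norm (analysis F x))\<^sup>2 \<le> (M * norm x)\<^sup>2"
    unfolding infsumI[OF ell2_norm_square_has_sum, symmetric] ell2_coord_analysis[OF assms]
    by (rule square_summable_le(2)[OF bessel_analysis_le[OF assms]])
  show "0 \<le> M * norm x" using bessel_nonneg[OF assms] by simp
qed

lemma bounded_linear_analysis:
  assumes "bessel M F"
  shows "bounded_linear (analysis F)"
proof (rule bounded_linear_intro[where K = M])
  show "analysis F (x + y) = analysis F x + analysis F y" for x y
    by (rule ell2_eqI) (simp add: ell2_coord_analysis[OF assms] ell2_coord_add cinner_add_left)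
  show "analysis F (r *\<^sub>R x) = r *\<^sub>R analysis F x" for r x
    by (rule ell2_eqI) (simp add: ell2_coord_analysis[OF assms] ell2_coord_scaleC cinner_scaleC_left
      flip: scaleC_of_real)
  show "norm (analysis F x) \<le> norm x * M" for x
    using norm_analysis_le[OF assms, of x] by (simp add: mult.commute)
qed

lemma analysis_scaleC:
  assumes "bessel M F"
  shows "analysis F (z *\<^sub>C x) = z *\<^sub>C analysis F x"
  by (rule ell2_eqI) (simp add: ell2_coord_analysis[OF assms] ell2_coord_scaleC cinner_scaleC_left)

lemma cinner_synthesis:
  fixes F :: "'i \<Rightarrow> 'h::{complex_inner, banach}"
  assumes "bessel M F"
  shows "cinner (synthesis F c) x = cinner c (analysis F x)"
proof -
  have "cinner c (analysis F x) = (\<Sum>\<^sub>\<infinity>k. ell2_coord c k * cinner (F k) x)"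
    by (simp add: cinner_ell2.rep_eq ell2_coord_analysis[OF assms] flip: cinner_commute)
  also have "\<dots> = cinner (synthesis F c) x"
    using has_sum_bounded_linear[OF bounded_linear_cinner_left[of x] synthesis_has_sum[OF assms, of c]]
    by (simp add: cinner_scaleC_left infsumI)
  finally show ?thesis ..
qed

lemma frame_operator_eq:
  fixes F :: "'i \<Rightarrow> 'h::{complex_inner, banach}"
  assumes "bessel M F"
  shows "frame_operator F = (\<lambda>x. synthesis F (analysis F x))"
proof -
  have "cadjoint (synthesis F) = analysis F"
    by (rule cadjoint_eqI) (rule cinner_synthesis[OF assms])
  thus ?thesis by (simp add: frame_operator_def comp_def)
qed

lemma synthesis_diff_family:
  fixes F :: "'i \<Rightarrow> 'h::{complex_inner, banach}"
  assumes "bessel M F" "bessel N G"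
  shows "synthesis (\<lambda>k. F k - G k) c = synthesis F c - synthesis G c"
proof (rule has_sum_unique[OF synthesis_has_sum[OF bessel_diff[OF assms]]])
  show "((\<lambda>k. ell2_coord c k *\<^sub>C (F k - G k)) has_sum (synthesis F c - synthesis G c)) UNIV"
    using has_sum_add[OF synthesis_has_sum[OF assms(1), of c]
        has_sum_bounded_linear[OF bounded_linear_minus[OF bounded_linear_ident]
          synthesis_has_sum[OF assms(2), of c]]]
    by (simp add: scaleC_diff_right)
qed

lemma analysis_diff_family:
  assumes "bessel M F" "bessel N G"
  shows "analysis (\<lambda>k. F k - G k) x = analysis F x - analysis G x"
  by (rule ell2_eqI)
     (simp add: ell2_coord_analysis[OF assms(1)] ell2_coord_analysis[OF assms(2)]
       ell2_coord_analysis[OF bessel_diff[OF assms]] ell2_coord_diff cinner_diff_right)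

text \<open>Taking square roots turns the frame inequalities into norm bounds for the synthesis and
  analysis operators, to which the triangle inequality applies.\<close>

lemma frame_bounds_UNIV_iff:
  fixes F :: "'i::countable \<Rightarrow> 'h::complex_inner"
  shows "frame_bounds UNIV F A B \<longleftrightarrow> A > 0 \<and> B > 0 \<and> bessel (sqrt B) F \<and>
    (\<forall>x. sqrt A * norm x \<le> norm (analysis F x))"
proof -
  have eq: "(norm (analysis F x))\<^sup>2 = (\<Sum>\<^sub>\<infinity>k. (cmod (cinner x (F k)))\<^sup>2)" if "bessel M F" for M x
    using infsumI[OF ell2_norm_square_has_sum[of "analysis F x"]]
    by (simp add: ell2_coord_analysis[OF that])
  show ?thesis
  proof
    assume fr: "frame_bounds UNIV F A B"
    hence AB: "A > 0" "B > 0" by (auto simp: frame_bounds_def)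
    have b: "bessel (sqrt B) F"
    proof (rule bessel_of_analysis_le)
      fix x and J :: "'i set" assume J: "finite J"
      have "(\<Sum>k\<in>J. (cmod (cinner x (F k)))\<^sup>2) \<le> (\<Sum>\<^sub>\<infinity>k. (cmod (cinner x (F k)))\<^sup>2)"
        using fr J by (intro finite_sum_le_infsum) (auto simp: frame_bounds_def)
      also have "\<dots> \<le> B * (norm x)\<^sup>2" using fr by (auto simp: frame_bounds_def)
      finally show "L2_set (\<lambda>k. cmod (cinner x (F k))) J \<le> sqrt B * norm x"
        unfolding L2_set_def using real_sqrt_le_mono by (fastforce simp: real_sqrt_mult)
    qed (use AB in simp)
    have "sqrt A * norm x \<le> norm (analysis F x)" for x
    proof (rule power2_le_imp_le)
      show "(sqrt A * norm x)\<^sup>2 \<le> (norm (analysis F x))\<^sup>2"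
        using fr AB by (simp add: eq[OF b] frame_bounds_def power_mult_distrib)
    qed simp
    thus "A > 0 \<and> B > 0 \<and> bessel (sqrt B) F \<and> (\<forall>x. sqrt A * norm x \<le> norm (analysis F x))"
      using AB b by blast
  next
    assume *: "A > 0 \<and> B > 0 \<and> bessel (sqrt B) F \<and> (\<forall>x. sqrt A * norm x \<le> norm (analysis F x))"
    hence b: "bessel (sqrt B) F" by blast
    have "A * (norm x)\<^sup>2 \<le> (norm (analysis F x))\<^sup>2" for x
      using power_mono[of "sqrt A * norm x" "norm (analysis F x)" 2] * by (simp add: power_mult_distrib)
    moreover have "(norm (analysis F x))\<^sup>2 \<le> B * (norm x)\<^sup>2" for x
      using power_mono[OF norm_analysis_le[OF b, of x], of 2] * by (simp add: power_mult_distrib)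
    ultimately show "frame_bounds UNIV F A B"
      unfolding frame_bounds_def eq[OF b, symmetric]
      using * square_summable_le(1)[OF bessel_analysis_le[OF b]] by auto
  qed
qed

section \<open>Frame operators\<close>

text \<open>As \<open>t\<close> is nonzero, the solutions of \<open>T x = y\<close> are the fixed
  points of \<open>G\<close>, a contraction with constant \<open>q\<close>; existence and uniqueness
  come together.\<close>

lemma bij_if_near_identity:
  fixes T :: "'h::banach \<Rightarrow> 'h"
  assumes T: "bounded_linear T" and t: "t \<noteq> 0" and q: "0 \<le> q" "q < 1"
    and near: "\<And>x. norm (x - t *\<^sub>R T x) \<le> q * norm x"
  shows "bij T"
  unfolding bij_iff
proof
  fix y
  interpret bounded_linear T by fact
  define G where "G x = x - t *\<^sub>R (T x - y)" for x
  have "\<forall>x x'. dist (G x) (G x') \<le> q * dist x x'"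
  proof (intro allI)
    fix x x'
    have "G x - G x' = (x - x') - t *\<^sub>R T (x - x')"
      by (simp add: G_def diff algebra_simps)
    thus "dist (G x) (G x') \<le> q * dist x x'"
      using near[of "x - x'"] by (simp add: dist_norm)
  qed
  hence "\<exists>!x. G x = x" by (rule banach_fix_type[OF q])
  thus "\<exists>!x. T x = y" using t by (simp add: G_def)
qed

locale countable_frame =
  fixes F :: "'i::countable \<Rightarrow> 'h::{complex_inner, banach}" and A B :: real
  assumes frame: "frame_bounds UNIV F A B"
begin

lemma A_pos: "A > 0" and B_pos: "B > 0" and bessel: "bessel (sqrt B) F"
  and analysis_ge: "sqrt A * norm x \<le> norm (analysis F x)"
  using frame unfolding frame_bounds_UNIV_iff by auto

lemma frame_operator_apply: "frame_operator F x = synthesis F (analysis F x)"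
  by (simp add: frame_operator_eq[OF bessel])

lemma bounded_linear_frame_operator: "bounded_linear (frame_operator F)"
  unfolding frame_operator_eq[OF bessel]
  by (intro bounded_linear_compose[OF bounded_linear_synthesis[OF bessel]]
      bounded_linear_analysis[OF bessel])

lemma frame_operator_scaleC: "frame_operator F (z *\<^sub>C x) = z *\<^sub>C frame_operator F x"
  by (simp add: frame_operator_apply synthesis_scaleC[OF bessel] analysis_scaleC[OF bessel])

lemma inner_frame_operator: "inner (frame_operator F x) x = (norm (analysis F x))\<^sup>2"
  by (simp add: frame_operator_apply inner_eq_Re_cinner cinner_synthesis[OF bessel] cinner_self)

lemma norm_frame_operator_le: "norm (frame_operator F x) \<le> B * norm x"
proof -
  have "norm (frame_operator F x) \<le> sqrt B * (sqrt B * norm x)"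
    unfolding frame_operator_apply
    by (rule order_trans[OF norm_synthesis_le[OF bessel]])
       (intro mult_left_mono norm_analysis_le[OF bessel] bessel_nonneg[OF bessel])
  thus ?thesis using B_pos by (simp flip: mult.assoc)
qed

lemma inner_frame_operator_ge: "A * (norm x)\<^sup>2 \<le> inner (frame_operator F x) x"
  using power_mono[OF analysis_ge[of x], of 2] A_pos
  by (simp add: inner_frame_operator power_mult_distrib)

lemma norm_frame_operator_ge: "A * norm x \<le> norm (frame_operator F x)"
proof (cases "x = 0")
  case False
  have "(A * norm x) * norm x \<le> norm (frame_operator F x) * norm x"
    using inner_frame_operator_ge[of x] norm_cauchy_schwarz[of "frame_operator F x" x]
    by (simp add: power2_eq_square mult.assoc)
  thus ?thesis using False by simp
qed simp

text \<open>Since \<open>A \<parallel>x\<parallel>\<^sup>2 \<le> \<langle>S x, x\<rangle>\<close> and \<open>\<parallel>S x\<parallel> \<le> C \<parallel>x\<parallel>\<close>, the map \<open>x \<mapsto> x - t S x\<close> is a contraction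
  for \<open>t = A / C\<^sup>2\<close>.\<close>

lemma bij_frame_operator: "bij (frame_operator F)"
proof -
  \<comment> \<open>In the zero space the frame inequalities do not force \<open>A \<le> B\<close>;
    the maximum secures \<open>A \<le> C\<close> and thus \<open>0 \<le> q\<close>. The value of
    \<open>t\<close> minimizes \<open>- (2 * t * A) + t\<^sup>2 * C\<^sup>2\<close>.\<close>
  define C where "C = max A B"
  define t where "t = A / C\<^sup>2"
  define q where "q = 1 - A\<^sup>2 / C\<^sup>2"
  have C: "0 < C" "A \<le> C" "B \<le> C" using A_pos by (auto simp: C_def)
  have tq: "- (2 * t * A) + t\<^sup>2 * C\<^sup>2 = q - 1"
    using C by (simp add: t_def q_def field_simps power2_eq_square)
  have q: "0 \<le> q" "q < 1"
    using C A_pos by (auto simp: q_def power_mono)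
  show ?thesis
  proof (rule bij_if_near_identity[OF bounded_linear_frame_operator, of t "sqrt q"])
    show "t \<noteq> 0" using A_pos C by (simp add: t_def)
    show "0 \<le> sqrt q" "sqrt q < 1" using q by simp_all
    fix x
    have "norm (frame_operator F x) \<le> C * norm x"
      using norm_frame_operator_le[of x] mult_right_mono[OF C(3), of "norm x"] by simp
    hence S: "(norm (frame_operator F x))\<^sup>2 \<le> C\<^sup>2 * (norm x)\<^sup>2"
      using power_mono[of "norm (frame_operator F x)" "C * norm x" 2] by (simp add: power_mult_distrib)
    have "(norm (x - t *\<^sub>R frame_operator F x))\<^sup>2
        = (norm x)\<^sup>2 - 2 * t * inner (frame_operator F x) x + t\<^sup>2 * (norm (frame_operator F x))\<^sup>2"
      unfolding power2_norm_eq_inner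
      by (simp add: inner_diff_left inner_diff_right inner_commute power2_eq_square algebra_simps)
    also have "\<dots> \<le> (norm x)\<^sup>2 - 2 * t * (A * (norm x)\<^sup>2) + t\<^sup>2 * (C\<^sup>2 * (norm x)\<^sup>2)"
      using S inner_frame_operator_ge[of x] A_pos
      by (intro add_mono diff_mono mult_left_mono) (auto simp: t_def)
    also have "\<dots> = (norm x)\<^sup>2 + (- (2 * t * A) + t\<^sup>2 * C\<^sup>2) * (norm x)\<^sup>2"
      by (simp add: algebra_simps)
    also have "\<dots> = (sqrt q * norm x)\<^sup>2"
      unfolding tq using q by (simp add: power_mult_distrib algebra_simps)
    finally show "norm (x - t *\<^sub>R frame_operator F x) \<le> sqrt q * norm x"
      by (rule power2_le_imp_le) (use q in simp)
  qed
qed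

lemma frame_operator_inv [simp]: "frame_operator F (inv (frame_operator F) y) = y"
  by (rule surj_f_inv_f[OF bij_is_surj[OF bij_frame_operator]])

lemma norm_inv_frame_operator_le: "norm (inv (frame_operator F) y) \<le> norm y / A"
  using norm_frame_operator_ge[of "inv (frame_operator F) y"] A_pos by (simp add: field_simps)

lemma inv_frame_operator_eqI: "frame_operator F x = y \<Longrightarrow> inv (frame_operator F) y = x"
  using inv_f_f[OF bij_is_inj[OF bij_frame_operator]] by blast

lemma bounded_linear_inv_frame_operator: "bounded_linear (inv (frame_operator F))"
proof -
  interpret bounded_linear "frame_operator F" by (rule bounded_linear_frame_operator)
  show ?thesis
    by (rule bounded_linear_intro[where K = "1 / A"])
       (use norm_inv_frame_operator_le in \<open>auto intro!: inv_frame_operator_eqI simp: add scaleR\<close>)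
qed

lemma inv_frame_operator_scaleC:
  "inv (frame_operator F) (z *\<^sub>C x) = z *\<^sub>C inv (frame_operator F) x"
  by (rule inv_frame_operator_eqI) (simp add: frame_operator_scaleC)

text \<open>The pseudo-inverse of the synthesis operator: its adjoint after the inverse of the frame
  operator.\<close>

definition right_inverse :: "'h \<Rightarrow> 'i ell2" where
  "right_inverse y = analysis F (inv (frame_operator F) y)"

lemma synthesis_right_inverse [simp]: "synthesis F (right_inverse y) = y"
  using frame_operator_apply[of "inv (frame_operator F) y"] by (simp add: right_inverse_def)

lemma bounded_linear_right_inverse: "bounded_linear right_inverse"
  unfolding right_inverse_def
  by (intro bounded_linear_compose[OF bounded_linear_analysis[OF bessel]]
      bounded_linear_inv_frame_operator)

lemma right_inverse_scaleC: "right_inverse (z *\<^sub>C x) = z *\<^sub>C right_inverse x"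
  by (simp add: right_inverse_def inv_frame_operator_scaleC analysis_scaleC[OF bessel])

text \<open>With z = S^(-1) y the squared norm is <S z, z> = <y, z>, and the lower frame bound
  estimates \<open>z\<close> by the right inverse itself. Multiplying the bounds of the two factors
  would give sqrt B / A, too weak to treat every \<epsilon> < A.\<close>

lemma norm_right_inverse_le: "norm (right_inverse y) \<le> norm y / sqrt A"
proof (cases "right_inverse y = 0")
  case False
  define z where "z = inv (frame_operator F) y"
  have "(norm (right_inverse y))\<^sup>2 = inner y z"
    using inner_frame_operator[of z] by (simp add: z_def right_inverse_def)
  also have "\<dots> \<le> norm y * norm z" by (rule norm_cauchy_schwarz)
  also have "\<dots> \<le> norm y * (norm (right_inverse y) / sqrt A)"
    using analysis_ge[of z] A_pos
    by (intro mult_left_mono) (auto simp: z_def right_inverse_def field_simps)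
  finally have "norm (right_inverse y) * norm (right_inverse y)
      \<le> (norm y / sqrt A) * norm (right_inverse y)"
    by (simp add: power2_eq_square)
  thus ?thesis by (rule mult_right_le_imp_le) (use False in simp)
qed (use A_pos in simp)

end

section \<open>Perturbation of frames\<close>

locale perturbed_frame = countable_frame F A B
  for F :: "'i::countable \<Rightarrow> 'h::{complex_inner, banach}" and A B +
  fixes F' :: "'i \<Rightarrow> 'h" and \<epsilon> :: real
  assumes \<epsilon>: "0 < \<epsilon>" "\<epsilon> < A" and approximation: "eps_approximation \<epsilon> UNIV F F'"
begin

abbreviation "A' \<equiv> A * (1 - sqrt (\<epsilon> / A))\<^sup>2"
abbreviation "B' \<equiv> B * (1 + sqrt (\<epsilon> / B))\<^sup>2"

text \<open>The perturbed bounds are the squares of sqrt A - sqrt \<epsilon> and sqrt B + sqrt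
  \<epsilon>, which is what the triangle inequality yields for the operators.\<close>

lemma sqrt_A': "sqrt A' = sqrt A - sqrt \<epsilon>" and A'_pos: "A' > 0"
proof -
  have "sqrt (\<epsilon> / A) < 1" using \<epsilon> A_pos by simp
  thus "A' > 0" using A_pos by simp
  have "sqrt A' = sqrt A * (1 - sqrt (\<epsilon> / A))"
    using \<open>sqrt (\<epsilon> / A) < 1\<close> by (simp add: real_sqrt_mult)
  thus "sqrt A' = sqrt A - sqrt \<epsilon>"
    using A_pos by (simp add: algebra_simps real_sqrt_divide)
qed

lemma sqrt_B': "sqrt B' = sqrt B + sqrt \<epsilon>" and B'_pos: "B' > 0"
proof -
  have "0 \<le> sqrt (\<epsilon> / B)" using \<epsilon> B_pos by simp
  hence *: "0 < 1 + sqrt (\<epsilon> / B)" by linarith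
  thus "B' > 0" using B_pos by simp
  have "sqrt B' = sqrt B * (1 + sqrt (\<epsilon> / B))"
    using * by (simp add: real_sqrt_mult)
  thus "sqrt B' = sqrt B + sqrt \<epsilon>"
    using B_pos by (simp add: algebra_simps real_sqrt_divide)
qed

lemma bessel_difference: "bessel (sqrt \<epsilon>) (\<lambda>k. F k - F' k)"
  using approximation \<epsilon> eps_approximation_iff_bessel[of \<epsilon> F F'] by simp

lemma bessel': "bessel (sqrt B') F'"
  using bessel_diff[OF bessel bessel_difference] unfolding sqrt_B' by simp

lemma frame': "frame_bounds UNIV F' A' B'"
  unfolding frame_bounds_UNIV_iff
proof (intro conjI allI A'_pos B'_pos bessel')
  fix x
  have "norm (analysis F x) \<le> norm (analysis F' x) + norm (analysis F x - analysis F' x)"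
    by (rule norm_triangle_sub)
  also have "norm (analysis F x - analysis F' x) \<le> sqrt \<epsilon> * norm x"
    using norm_analysis_le[OF bessel_difference] by (simp add: analysis_diff_family[OF bessel bessel'])
  finally show "sqrt A' * norm x \<le> norm (analysis F' x)"
    using analysis_ge[of x] unfolding sqrt_A' by (simp add: left_diff_distrib)
qed

sublocale perturbed: countable_frame F' A' B'
  by unfold_locales (rule frame')

lemma norm_synthesis_diff_le: "norm (synthesis F c - synthesis F' c) \<le> sqrt \<epsilon> * norm c"
  using norm_synthesis_le[OF bessel_difference] by (simp add: synthesis_diff_family[OF bessel bessel'])

lemma norm_analysis_diff_le: "norm (analysis F x - analysis F' x) \<le> sqrt \<epsilon> * norm x"
  using norm_analysis_le[OF bessel_difference] by (simp add: analysis_diff_family[OF bessel bessel'])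

lemma opnorm_synthesis_diff: "opnorm_le (\<lambda>c. synthesis F c - synthesis F' c) (sqrt \<epsilon>)"
  by (intro opnorm_leI bounded_linear_sub bounded_linear_synthesis[OF bessel]
      bounded_linear_synthesis[OF bessel'] norm_synthesis_diff_le) (use \<epsilon> in simp)

abbreviation "K \<equiv> sqrt (\<epsilon> * B) * (2 + sqrt (\<epsilon> / B))"

lemma K_eq: "K = sqrt \<epsilon> * sqrt B + sqrt B' * sqrt \<epsilon>"
  unfolding sqrt_B' using B_pos \<epsilon> by (simp add: real_sqrt_mult real_sqrt_divide algebra_simps)

lemma K_nonneg: "0 \<le> K"
  using \<epsilon> B_pos by simp

text \<open>Write W and W' for the adjoints of V and V'. Then S - S' = (V - V') W + V' (W - W'), and
  the two summands account for the two terms of \<open>K_eq\<close>.\<close>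

lemma norm_frame_operator_diff_le:
  "norm (frame_operator F x - frame_operator F' x) \<le> K * norm x"
proof -
  interpret V': bounded_linear "synthesis F'" by (rule bounded_linear_synthesis[OF bessel'])
  have "norm (frame_operator F x - frame_operator F' x)
      = norm ((synthesis F (analysis F x) - synthesis F' (analysis F x))
          + synthesis F' (analysis F x - analysis F' x))"
    by (simp add: frame_operator_apply perturbed.frame_operator_apply V'.diff)
  also have "\<dots> \<le> norm (synthesis F (analysis F x) - synthesis F' (analysis F x))
      + norm (synthesis F' (analysis F x - analysis F' x))"
    by (rule norm_triangle_ineq)
  also have "\<dots> \<le> sqrt \<epsilon> * (sqrt B * norm x) + sqrt B' * (sqrt \<epsilon> * norm x)"
  proof (rule add_mono)
    show "norm (synthesis F (analysis F x) - synthesis F' (analysis F x)) \<le> sqrt \<epsilon> * (sqrt B * norm x)"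
      by (rule order_trans[OF norm_synthesis_diff_le mult_left_mono[OF norm_analysis_le[OF bessel]]])
         (use \<epsilon> in simp)
    show "norm (synthesis F' (analysis F x - analysis F' x)) \<le> sqrt B' * (sqrt \<epsilon> * norm x)"
      by (rule order_trans[OF norm_synthesis_le[OF bessel'] mult_left_mono[OF norm_analysis_diff_le]])
         (use B'_pos in simp)
  qed
  finally show ?thesis unfolding K_eq by (simp add: algebra_simps)
qed

lemma opnorm_frame_operator_diff:
  "opnorm_le (\<lambda>x. frame_operator F x - frame_operator F' x) K"
  by (intro opnorm_leI bounded_linear_sub bounded_linear_frame_operator
      perturbed.bounded_linear_frame_operator norm_frame_operator_diff_le K_nonneg)

text \<open>S^(-1) - S'^(-1) = S'^(-1) (S' - S) S^(-1), with the factors bounded by 1 / A', K and 1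
  / A; the product A A' is the stated denominator.\<close>

lemma opnorm_inv_frame_operator_diff:
  "opnorm_le (\<lambda>x. inv (frame_operator F) x - inv (frame_operator F') x)
     (K / (A\<^sup>2 * (1 - sqrt (\<epsilon> / A))\<^sup>2))"
proof (intro opnorm_leI bounded_linear_sub bounded_linear_inv_frame_operator
      perturbed.bounded_linear_inv_frame_operator)
  show "0 \<le> K / (A\<^sup>2 * (1 - sqrt (\<epsilon> / A))\<^sup>2)" using K_nonneg by simp
  fix x
  interpret S': bounded_linear "frame_operator F'" by (rule perturbed.bounded_linear_frame_operator)
  define y where "y = inv (frame_operator F) x"
  have "frame_operator F' (y - inv (frame_operator F') x) = - (frame_operator F y - frame_operator F' y)"
    by (simp add: S'.diff y_def)
  hence "A' * norm (y - inv (frame_operator F') x) \<le> norm (frame_operator F y - frame_operator F' y)"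
    using perturbed.norm_frame_operator_ge[of "y - inv (frame_operator F') x"]
    by (metis norm_minus_cancel)
  also have "\<dots> \<le> K * norm y" by (rule norm_frame_operator_diff_le)
  also have "\<dots> \<le> K * (norm x / A)"
    unfolding y_def by (intro mult_left_mono norm_inv_frame_operator_le K_nonneg)
  finally have "norm (y - inv (frame_operator F') x) \<le> K * (norm x / A) / A'"
    by (subst pos_le_divide_eq[OF A'_pos]) (simp add: mult.commute)
  also have "\<dots> = K / (A\<^sup>2 * (1 - sqrt (\<epsilon> / A))\<^sup>2) * norm x"
    by (simp add: power2_eq_square)
  finally show "norm (inv (frame_operator F) x - inv (frame_operator F') x)
      \<le> K / (A\<^sup>2 * (1 - sqrt (\<epsilon> / A))\<^sup>2) * norm x"
    by (simp add: y_def)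
qed

text \<open>With R the right inverse of V, the identity minus V' R equals (V - V') R, whose norm is
  at most sqrt \<epsilon> / sqrt A < 1.\<close>

lemma synthesis'_right_inverse_bij: "bij (\<lambda>x. synthesis F' (right_inverse x))"
proof (rule bij_if_near_identity[where t = 1 and q = "sqrt \<epsilon> / sqrt A"])
  show "bounded_linear (\<lambda>x. synthesis F' (right_inverse x))"
    by (intro bounded_linear_compose[OF bounded_linear_synthesis[OF bessel']]
        bounded_linear_right_inverse)
  show "sqrt \<epsilon> / sqrt A < 1" using \<epsilon> A_pos by simp
  fix x
  have "norm (synthesis F (right_inverse x) - synthesis F' (right_inverse x))
      \<le> sqrt \<epsilon> * (norm x / sqrt A)"
    by (rule order_trans[OF norm_synthesis_diff_le mult_left_mono[OF norm_right_inverse_le]])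
       (use \<epsilon> in simp)
  thus "norm (x - 1 *\<^sub>R synthesis F' (right_inverse x)) \<le> sqrt \<epsilon> / sqrt A * norm x"
    by simp
qed (use \<epsilon> A_pos in simp_all)

end

section \<open>Excess\<close>

lemma frame_bounds_reindex:
  assumes "bij_betw \<pi> I' I"
  shows "frame_bounds I' (\<lambda>k. F (\<pi> k)) A B \<longleftrightarrow> frame_bounds I F A B"
proof -
  have "countable I' \<longleftrightarrow> countable I"
    using countable_image_inj_eq[of \<pi> I'] assms by (simp add: bij_betw_def)
  moreover have "(\<lambda>k. (cmod (cinner x (F (\<pi> k))))\<^sup>2) summable_on I' \<longleftrightarrow>
      (\<lambda>k. (cmod (cinner x (F k)))\<^sup>2) summable_on I" for x
    by (rule summable_on_reindex_bij_betw[OF assms])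
  moreover have "(\<Sum>\<^sub>\<infinity>k\<in>I'. (cmod (cinner x (F (\<pi> k))))\<^sup>2) = (\<Sum>\<^sub>\<infinity>k\<in>I. (cmod (cinner x (F k)))\<^sup>2)" for x
    by (rule infsum_reindex_bij_betw[OF assms])
  ultimately show ?thesis unfolding frame_bounds_def by simp
qed

lemma is_frame_reindex:
  "bij_betw \<pi> I' I \<Longrightarrow> is_frame I' (\<lambda>k. F (\<pi> k)) \<longleftrightarrow> is_frame I F"
  by (simp add: is_frame_def frame_bounds_reindex)

lemma excess_reindex:
  assumes \<pi>: "bij \<pi>"
  shows "excess UNIV (\<lambda>k. F (\<pi> k)) = excess UNIV F"
proof -
  have inj: "inj \<pi>" using \<pi> by (rule bij_is_inj)
  have bb: "bij_betw \<pi> (- J) (- \<pi> ` J)" for J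
    using inj_on_subset[OF inj subset_UNIV] bij_image_Compl_eq[OF \<pi>] by (simp add: bij_betw_def)
  have fr: "is_frame (- J) (\<lambda>k. F (\<pi> k)) \<longleftrightarrow> is_frame (- \<pi> ` J) F" for J
    by (rule is_frame_reindex[OF bb])
  have "{enat (card J) |J. finite J \<and> is_frame (- J) (\<lambda>k. F (\<pi> k))}
      = {enat (card J) |J. finite J \<and> is_frame (- J) F}" (is "?L = ?R")
  proof (intro equalityI subsetI)
    fix n assume "n \<in> ?L"
    then obtain J where "n = enat (card J)" "finite J" "is_frame (- \<pi> ` J) F"
      by (auto simp: fr)
    moreover have "card (\<pi> ` J) = card J"
      by (rule card_image[OF inj_on_subset[OF inj subset_UNIV]])
    ultimately show "n \<in> ?R" by (intro CollectI exI[of _ "\<pi> ` J"]) auto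
  next
    fix n assume "n \<in> ?R"
    then obtain J where J: "n = enat (card J)" "finite J" "is_frame (- J) F" by auto
    have eq: "\<pi> ` (\<pi> -` J) = J" using \<pi> by (simp add: bij_is_surj)
    have "finite (\<pi> -` J)" using J inj by (intro finite_vimageI)
    moreover have "card (\<pi> -` J) = card J"
      using card_image[OF inj_on_subset[OF inj subset_UNIV], of "\<pi> -` J"] unfolding eq by simp
    ultimately show "n \<in> ?L" using J by (intro CollectI exI[of _ "\<pi> -` J"]) (simp only: fr eq simp_thms)
  qed
  thus ?thesis by (simp add: excess_def Compl_eq_Diff_UNIV)
qed

lemma homogeneous_system_nontrivial_solution:
  fixes M :: "'a \<Rightarrow> 'b \<Rightarrow> 'c::field"
  assumes "finite K" "finite J" "card K < card J"
  shows "\<exists>c. (\<exists>j\<in>J. c j \<noteq> 0) \<and> (\<forall>k\<in>K. (\<Sum>j\<in>J. c j * M j k) = 0)"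
  using assms
proof (induction K arbitrary: J M rule: finite_induct)
  case empty
  then obtain j where "j \<in> J" by fastforce
  thus ?case by (intro exI[of _ "\<lambda>_. 1"]) auto
next
  case (insert k K)
  show ?case
  proof (cases "\<forall>j\<in>J. M j k = 0")
    case True
    have "card K < card J" using insert by simp
    then obtain c where "\<exists>j\<in>J. c j \<noteq> 0" "\<forall>k\<in>K. (\<Sum>j\<in>J. c j * M j k) = 0"
      using insert.IH[OF insert.prems(1)] by blast
    with True show ?thesis by (intro exI[of _ c]) auto
  next
    case False
    then obtain p where p: "p \<in> J" "M p k \<noteq> 0" by blast
    define J' where "J' = J - {p}"
    define M' where "M' j l = M j l - M j k / M p k * M p l" for j l
    have J': "finite J'" "p \<notin> J'" "J = insert p J'" "card K < card J'"
      using insert p by (auto simp: J'_def)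
    obtain c where c: "\<exists>j\<in>J'. c j \<noteq> 0" "\<And>l. l \<in> K \<Longrightarrow> (\<Sum>j\<in>J'. c j * M' j l) = 0"
      using insert.IH[OF J'(1) J'(4), of M'] by blast
    \<comment> \<open>\<open>- s\<close> is the value that equation \<open>k\<close> forces on the
      unknown \<open>p\<close> once the others are given by \<open>c\<close>.\<close>
    define s where "s = (\<Sum>j\<in>J'. c j * (M j k / M p k))"
    have sum_eq: "(\<Sum>j\<in>J. (c(p := - s)) j * M j l) = (\<Sum>j\<in>J'. c j * M' j l)" for l
    proof -
      have "(\<Sum>j\<in>J. (c(p := - s)) j * M j l) = (\<Sum>j\<in>J'. (c(p := - s)) j * M j l) - s * M p l"
        using J' by simp
      also have "(\<Sum>j\<in>J'. (c(p := - s)) j * M j l) = (\<Sum>j\<in>J'. c j * M j l)"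
        using J'(2) by (intro sum.cong) auto
      also have "\<dots> - s * M p l = (\<Sum>j\<in>J'. c j * M' j l)"
        by (simp add: s_def M'_def sum_distrib_right right_diff_distrib sum_subtractf mult.assoc)
      finally show ?thesis .
    qed
    have "M' j k = 0" for j using p by (simp add: M'_def)
    hence "(\<Sum>j\<in>J. (c(p := - s)) j * M j l) = 0" if "l \<in> insert k K" for l
      using that c(2) unfolding sum_eq by auto
    moreover have "\<exists>j\<in>J. (c(p := - s)) j \<noteq> 0" using c(1) J' by fastforce
    ultimately show ?thesis by blast
  qed
qed

section \<open>Subspaces of l^2 and the coordinates they map onto\<close>

definition csubspace :: "'h::complex_inner set \<Rightarrow> bool" where
  "csubspace W \<longleftrightarrow> 0 \<in> W \<and> (\<forall>x\<in>W. \<forall>y\<in>W. x + y \<in> W) \<and> (\<forall>x\<in>W. \<forall>c. c *\<^sub>C x \<in> W)"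

lemma csubspace_sum:
  assumes "csubspace W" "\<And>j. j \<in> J \<Longrightarrow> f j \<in> W"
  shows "sum f J \<in> W"
  using assms by (induction J rule: infinite_finite_induct) (auto simp: csubspace_def)

text \<open>For finite \<open>J\<close> this stands for dim W \<ge> card J, witnessed by concrete
  coordinates. Only the values of \<open>y\<close> on \<open>J\<close> matter.\<close>

definition coords_onto :: "'i ell2 set \<Rightarrow> 'i set \<Rightarrow> bool" where
  "coords_onto W J \<longleftrightarrow> (\<forall>y. \<exists>w\<in>W. \<forall>j\<in>J. ell2_coord w j = y j)"

text \<open>A vector with the right values on \<open>J\<close> is corrected at \<open>i\<close> by a
  multiple of \<open>u\<close>, which leaves the coordinates in \<open>J\<close> alone.\<close>

lemma coords_onto_insert:
  assumes W: "csubspace W" and J: "coords_onto W J"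
    and u: "u \<in> W" "\<forall>j\<in>J. ell2_coord u j = 0" "ell2_coord u i \<noteq> 0"
  shows "coords_onto W (insert i J)"
  unfolding coords_onto_def
proof
  fix y
  obtain w where w: "w \<in> W" "\<forall>j\<in>J. ell2_coord w j = y j"
    using J unfolding coords_onto_def by blast
  define z where "z = w + ((y i - ell2_coord w i) / ell2_coord u i) *\<^sub>C u"
  have "z \<in> W" using W w u unfolding csubspace_def z_def by blast
  moreover have "\<forall>j\<in>insert i J. ell2_coord z j = y j"
    using w u by (simp add: z_def ell2_coord_add ell2_coord_scaleC)
  ultimately show "\<exists>z\<in>W. \<forall>j\<in>insert i J. ell2_coord z j = y j" by blast
qed

text \<open>If \<open>W\<close> maps onto \<open>card J\<close> coordinates, then \<open>dim W \<ge> card J\<close>, so the image of \<open>W\<close> under an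
  injective linear map cannot be killed by fewer than \<open>card J\<close> coordinate functionals.\<close>

lemma coords_onto_transfer:
  fixes W :: "'i ell2 set" and W' :: "'k ell2 set"
  assumes W: "csubspace W" and W': "csubspace W'"
    and add: "\<And>x y. \<Psi> (x + y) = \<Psi> x + \<Psi> y" and scale: "\<And>c x. \<Psi> (c *\<^sub>C x) = c *\<^sub>C \<Psi> x"
    and maps: "\<And>x. x \<in> W \<Longrightarrow> \<Psi> x \<in> W'" and inj: "\<And>x. x \<in> W \<Longrightarrow> \<Psi> x = 0 \<Longrightarrow> x = 0"
    and J: "finite J" "coords_onto W J"
  shows "\<exists>J'. finite J' \<and> card J' = card J \<and> coords_onto W' J'"
proof -
  have zero: "\<Psi> 0 = 0" using scale[of 0 0] by simp
  have sum: "\<Psi> (sum f I) = (\<Sum>i\<in>I. \<Psi> (f i))" for f and I :: "'i set"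
    by (induction I rule: infinite_finite_induct) (simp_all add: zero add)
  have "\<forall>i. \<exists>w\<in>W. \<forall>j\<in>J. ell2_coord w j = (if i = j then 1 else 0)"
    using J(2) unfolding coords_onto_def by auto
  then obtain e where e: "\<And>i. e i \<in> W" "\<And>i j. j \<in> J \<Longrightarrow> ell2_coord (e i) j = (if i = j then 1 else 0)"
    by metis
  have "\<exists>J'. finite J' \<and> card J' = m \<and> coords_onto W' J'" if "m \<le> card J" for m
    using that
  proof (induction m)
    case 0
    have "coords_onto W' {}" using W' unfolding coords_onto_def csubspace_def by blast
    thus ?case by (intro exI[of _ "{}"]) simp
  next
    case (Suc m)
    then obtain J' where J': "finite J'" "card J' = m" "coords_onto W' J'" by auto
    \<comment> \<open>These are m equations in card J > m unknowns. A solution gives a nonzero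
      combination \<open>w\<close> of the vectors \<open>e j\<close> whose image vanishes on
      \<open>J'\<close>; the image is itself nonzero, so it has a further coordinate
      \<open>k\<close> by which \<open>J'\<close> can grow.\<close>
    obtain c where c: "\<exists>j\<in>J. c j \<noteq> 0"
        "\<And>k. k \<in> J' \<Longrightarrow> (\<Sum>j\<in>J. c j * ell2_coord (\<Psi> (e j)) k) = 0"
      using homogeneous_system_nontrivial_solution[OF J'(1) J(1)] J' Suc.prems by force
    define w where "w = (\<Sum>j\<in>J. c j *\<^sub>C e j)"
    have wW: "w \<in> W"
      unfolding w_def by (rule csubspace_sum[OF W]) (use W e in \<open>auto simp: csubspace_def\<close>)
    have w_coord: "ell2_coord w i = c i" if "i \<in> J" for i
    proof -
      have "ell2_coord w i = (\<Sum>j\<in>J. if j = i then c j else 0)"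
        unfolding w_def ell2_coord_sum
        by (intro sum.cong) (auto simp: ell2_coord_scaleC e(2)[OF that])
      thus ?thesis using that J(1) by simp
    qed
    have "w \<noteq> 0" using c(1) w_coord by force
    hence "\<Psi> w \<noteq> 0" using inj[OF wW] by blast
    then obtain k where k: "ell2_coord (\<Psi> w) k \<noteq> 0" by (metis ell2_eqI ell2_coord_zero)
    have van: "\<forall>k\<in>J'. ell2_coord (\<Psi> w) k = 0"
      using c(2) by (simp add: w_def sum scale ell2_coord_sum ell2_coord_scaleC)
    have "coords_onto W' (insert k J')"
      by (rule coords_onto_insert[OF W' J'(3) maps[OF wW] van k])
    moreover have "k \<notin> J'" using van k by blast
    ultimately show ?case using J' by (intro exI[of _ "insert k J'"]) auto
  qed
  thus ?thesis by blast
qed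

section \<open>Kernels of synthesis operators and removable elements\<close>

abbreviation kernel :: "('i \<Rightarrow> 'h::complex_inner) \<Rightarrow> 'i ell2 set" where
  "kernel F \<equiv> {c. synthesis F c = 0}"

lemma csubspace_kernel:
  fixes F :: "'i \<Rightarrow> 'h::{complex_inner, banach}"
  assumes "bessel M F"
  shows "csubspace (kernel F)"
  using synthesis_scaleC[OF assms, of 0 0]
  by (auto simp: csubspace_def synthesis_add[OF assms] synthesis_scaleC[OF assms])

text \<open>Removing elements by zeroing them keeps the full index type, so that
  \<open>countable_frame\<close> also covers the reduced family.\<close>

definition mask :: "'i set \<Rightarrow> ('i \<Rightarrow> 'h::complex_inner) \<Rightarrow> 'i \<Rightarrow> 'h" where
  "mask J F k = (if k \<in> J then 0 else F k)"

lemma frame_bounds_mask: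
  fixes F :: "'i::countable \<Rightarrow> 'h::complex_inner"
  shows "frame_bounds UNIV (mask J F) A B \<longleftrightarrow> frame_bounds (- J) F A B"
proof -
  have "(\<lambda>k. (cmod (cinner x (mask J F k)))\<^sup>2) summable_on UNIV \<longleftrightarrow>
      (\<lambda>k. (cmod (cinner x (F k)))\<^sup>2) summable_on - J" for x
    by (rule summable_on_cong_neutral) (auto simp: mask_def)
  moreover have "(\<Sum>\<^sub>\<infinity>k. (cmod (cinner x (mask J F k)))\<^sup>2) = (\<Sum>\<^sub>\<infinity>k\<in>- J. (cmod (cinner x (F k)))\<^sup>2)" for x
    by (rule infsum_cong_neutral) (auto simp: mask_def)
  ultimately show ?thesis unfolding frame_bounds_def by simp
qed

lemma bessel_mask:
  assumes F: "bessel M F"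
  shows "bessel M (mask J F)"
proof (rule bessel_of_analysis_le[OF bessel_nonneg[OF F]])
  fix x and I :: "'a set" assume I: "finite I"
  have "L2_set (\<lambda>k. cmod (cinner x (mask J F k))) I \<le> L2_set (\<lambda>k. cmod (cinner x (F k))) I"
    by (rule L2_set_mono) (auto simp: mask_def)
  also have "\<dots> \<le> M * norm x" by (rule bessel_analysis_le[OF F I])
  finally show "L2_set (\<lambda>k. cmod (cinner x (mask J F k))) I \<le> M * norm x" .
qed

lemma synthesis_split:
  fixes F :: "'i \<Rightarrow> 'h::{complex_inner, banach}"
  assumes F: "bessel M F" and J: "finite J"
  shows "synthesis F c = (\<Sum>j\<in>J. ell2_coord c j *\<^sub>C F j) + synthesis (mask J F) c"
proof (rule has_sum_unique[OF synthesis_has_sum[OF F]])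
  have "((\<lambda>k. if k \<in> J then ell2_coord c k *\<^sub>C F k else 0) has_sum
      (\<Sum>j\<in>J. ell2_coord c j *\<^sub>C F j)) UNIV"
    by (rule has_sum_finite_neutralI[OF J]) auto
  from has_sum_add[OF this synthesis_has_sum[OF bessel_mask[OF F], of c]]
  show "((\<lambda>k. ell2_coord c k *\<^sub>C F k) has_sum
      ((\<Sum>j\<in>J. ell2_coord c j *\<^sub>C F j) + synthesis (mask J F) c)) UNIV"
    by (rule has_sum_cong[THEN iffD1, rotated]) (auto simp: mask_def)
qed

lemma ell2_with_coords:
  assumes "finite J"
  obtains c where "\<And>k. ell2_coord c k = (if k \<in> J then y k else 0)"
proof
  have "(\<lambda>k. (cmod (if k \<in> J then y k else 0))\<^sup>2) summable_on UNIV
      \<longleftrightarrow> (\<lambda>k. (cmod (y k))\<^sup>2) summable_on J"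
    by (rule summable_on_cong_neutral) auto
  hence "(\<lambda>k. (cmod (if k \<in> J then y k else 0))\<^sup>2) summable_on UNIV"
    using assms by simp
  thus "ell2_coord (Abs_ell2 (\<lambda>k. if k \<in> J then y k else 0)) k = (if k \<in> J then y k else 0)" for k
    by (subst Abs_ell2_inverse) auto
qed

context countable_frame
begin

text \<open>The combination of the removed elements with coefficients \<open>y\<close> can also be
  synthesized by the remaining frame, with coefficients \<open>c\<close> vanishing on
  \<open>J\<close>. The difference of the two coefficient sequences lies in the kernel and takes the
  values \<open>y\<close> on \<open>J\<close>.\<close>

lemma coords_onto_kernel_if_frame:
  assumes J: "finite J" and fr: "frame_bounds UNIV (mask J F) A' B'"
  shows "coords_onto (kernel F) J"
  unfolding coords_onto_def
proof
  fix y :: "'i \<Rightarrow> complex"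
  interpret G: countable_frame "mask J F" A' B' by unfold_locales (rule fr)
  obtain d where d: "\<And>k. ell2_coord d k = (if k \<in> J then y k else 0)"
    using ell2_with_coords[OF J] by blast
  define c where "c = G.right_inverse (\<Sum>j\<in>J. y j *\<^sub>C F j)"
  \<comment> \<open>The right inverse consists of analysis coefficients of the masked family, whose
    members on \<open>J\<close> are 0.\<close>
  have c: "ell2_coord c j = 0" if "j \<in> J" for j
    using that by (simp add: c_def G.right_inverse_def ell2_coord_analysis[OF G.bessel] mask_def)
  have Vc: "synthesis F c = (\<Sum>j\<in>J. y j *\<^sub>C F j)"
  proof -
    have "(\<Sum>j\<in>J. ell2_coord c j *\<^sub>C F j) = 0" by (rule sum.neutral) (simp add: c)
    thus ?thesis by (simp add: synthesis_split[OF bessel J] c_def)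
  qed
  have Vd: "synthesis F d = (\<Sum>j\<in>J. y j *\<^sub>C F j)"
  proof -
    have "synthesis (mask J F) d = (\<Sum>\<^sub>\<infinity>k\<in>(UNIV :: 'i set). 0)"
      unfolding synthesis_def by (rule infsum_cong) (simp add: d mask_def)
    thus ?thesis by (simp add: synthesis_split[OF bessel J] d)
  qed
  have "synthesis F (d - c) = 0"
    using bounded_linear.linear[OF bounded_linear_synthesis[OF bessel]]
    by (simp add: linear_diff Vc Vd)
  moreover have "\<forall>j\<in>J. ell2_coord (d - c) j = y j" by (simp add: ell2_coord_diff c d)
  ultimately show "\<exists>w\<in>kernel F. \<forall>j\<in>J. ell2_coord w j = y j" by blast
qed

text \<open>A kernel vector that restricts to the \<open>i\<close>-th unit vector on
  \<open>J\<close> expresses \<open>F i\<close> by the remaining elements. The coefficients of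
  \<open>x\<close> at removed elements are thus controlled by those at the remaining ones, and a
  lower bound survives.\<close>

lemma frame_if_coords_onto_kernel:
  assumes J: "finite J" and onto: "coords_onto (kernel F) J"
  obtains A' where "frame_bounds UNIV (mask J F) A' B"
proof -
  define G where "G = mask J F"
  have G: "bessel (sqrt B) G" unfolding G_def by (rule bessel_mask[OF bessel])
  have "\<exists>w. synthesis F w = 0 \<and> (\<forall>j\<in>J. ell2_coord w j = (if j = i then 1 else 0))" for i
    using onto unfolding coords_onto_def by auto
  then obtain w where "\<forall>i. synthesis F (w i) = 0 \<and> (\<forall>j\<in>J. ell2_coord (w i) j = (if j = i then 1 else 0))"
    using choice[of "\<lambda>i w. synthesis F w = 0 \<and> (\<forall>j\<in>J. ell2_coord w j = (if j = i then 1 else 0))"]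
    by blast
  hence w: "\<And>i. synthesis F (w i) = 0"
      "\<And>i j. j \<in> J \<Longrightarrow> ell2_coord (w i) j = (if j = i then 1 else 0)"
    by auto
  \<comment> \<open>The 1 accounts for the remaining elements, the norms of the \<open>w j\<close>
    for the removed ones.\<close>
  define s where "s = 1 + (\<Sum>j\<in>J. norm (w j))"
  have s: "1 \<le> s" by (simp add: s_def sum_nonneg)
  have removed: "cmod (cinner x (F i)) \<le> norm (w i) * norm (analysis G x)" if i: "i \<in> J" for x i
  proof -
    have "(\<Sum>j\<in>J. ell2_coord (w i) j *\<^sub>C F j) = (\<Sum>j\<in>J. if j = i then F j else 0)"
      by (intro sum.cong) (auto simp: w(2))
    hence "F i + synthesis G (w i) = 0"
      using synthesis_split[OF bessel J, of "w i"] i J by (simp add: w G_def)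
    hence "F i = (-1) *\<^sub>C synthesis G (w i)"
      by (simp add: scaleC_minus_one eq_neg_iff_add_eq_0)
    hence "cinner (F i) x = - cinner (w i) (analysis G x)"
      by (simp add: cinner_scaleC_left cinner_synthesis[OF G])
    moreover have "cmod (cinner x (F i)) = cmod (cinner (F i) x)"
      by (subst cinner_commute) simp
    ultimately show ?thesis using norm_cinner_le[of "w i" "analysis G x"] by simp
  qed
  have le: "norm (analysis F x) \<le> s * norm (analysis G x)" for x
  proof -
    define D where "D k = F k - G k" for k
    have D: "bessel (sqrt B + sqrt B) D" unfolding D_def by (rule bessel_diff[OF bessel G])
    define r where "r = (\<Sum>j\<in>J. cmod (cinner x (F j)))"
    have "norm (analysis D x) \<le> r"
    proof (rule power2_le_imp_le)
      show "0 \<le> r" by (simp add: r_def sum_nonneg)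
      have "L2_set (\<lambda>k. cmod (cinner x (D k))) I \<le> r" if "finite I" for I
      proof -
        have "L2_set (\<lambda>k. cmod (cinner x (D k))) I \<le> (\<Sum>k\<in>I. cmod (cinner x (D k)))"
          by (rule L2_set_le_sum) simp
        also have "\<dots> = (\<Sum>k\<in>I \<inter> J. cmod (cinner x (F k)))"
          using that by (intro sum.mono_neutral_cong_right) (auto simp: D_def G_def mask_def)
        also have "\<dots> \<le> r" unfolding r_def using J by (intro sum_mono2) auto
        finally show ?thesis .
      qed
      from square_summable_le(2)[OF this]
      show "(norm (analysis D x))\<^sup>2 \<le> r\<^sup>2"
        unfolding infsumI[OF ell2_norm_square_has_sum, symmetric] ell2_coord_analysis[OF D] .
    qed
    also have "r \<le> (\<Sum>j\<in>J. norm (w j) * norm (analysis G x))"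
      unfolding r_def by (intro sum_mono removed)
    finally have "norm (analysis D x) \<le> (\<Sum>j\<in>J. norm (w j)) * norm (analysis G x)"
      by (simp add: sum_distrib_right)
    moreover have "analysis D x = analysis F x - analysis G x"
      unfolding D_def by (rule analysis_diff_family[OF bessel G])
    hence "norm (analysis F x) \<le> norm (analysis G x) + norm (analysis D x)"
      by (simp add: norm_triangle_sub)
    ultimately show ?thesis by (simp add: s_def distrib_right)
  qed
  have "frame_bounds UNIV G (A / s\<^sup>2) B"
    unfolding frame_bounds_UNIV_iff
  proof (intro conjI allI G B_pos)
    show "A / s\<^sup>2 > 0" using A_pos s by simp
    fix x
    have "sqrt A * norm x \<le> s * norm (analysis G x)"
      using analysis_ge[of x] le[of x] by linarith
    thus "sqrt (A / s\<^sup>2) * norm x \<le> norm (analysis G x)"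
      using s by (simp add: real_sqrt_divide field_simps)
  qed
  thus thesis using that unfolding G_def by blast
qed

lemma is_frame_remove_iff:
  assumes "finite J"
  shows "is_frame (- J) F \<longleftrightarrow> coords_onto (kernel F) J"
proof
  assume "is_frame (- J) F"
  then obtain A' B' where "frame_bounds UNIV (mask J F) A' B'"
    by (auto simp: is_frame_def frame_bounds_mask)
  thus "coords_onto (kernel F) J" by (rule coords_onto_kernel_if_frame[OF assms])
next
  assume "coords_onto (kernel F) J"
  then obtain A' where "frame_bounds UNIV (mask J F) A' B"
    by (rule frame_if_coords_onto_kernel[OF assms])
  thus "is_frame (- J) F" by (auto simp: is_frame_def frame_bounds_mask)
qed

end

text \<open>As \<open>V' R\<close> is bijective, \<open>c \<mapsto> c - R (V' R)\<^sup>-\<^sup>1 V' c\<close> maps into the kernel of \<open>V'\<close>; on the kernel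
  of \<open>V\<close> it is injective because \<open>V R\<close> is.\<close>

lemma coords_onto_kernel_transfer:
  fixes F F' :: "'i \<Rightarrow> 'h::{complex_inner, banach}"
  assumes F: "bessel M F" and F': "bessel M' F'"
    and R: "bounded_linear R" "\<And>z x. R (z *\<^sub>C x) = z *\<^sub>C R x"
    and VR: "inj (\<lambda>x. synthesis F (R x))" and V'R: "bij (\<lambda>x. synthesis F' (R x))"
    and J: "finite J" "coords_onto (kernel F) J"
  shows "\<exists>J'. finite J' \<and> card J' = card J \<and> coords_onto (kernel F') J'"
proof -
  interpret V: bounded_linear "synthesis F" by (rule bounded_linear_synthesis[OF F])
  interpret V': bounded_linear "synthesis F'" by (rule bounded_linear_synthesis[OF F'])
  interpret R: bounded_linear R by (rule R)
  define T where "T x = synthesis F' (R x)" for x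
  have T: "bij T" using V'R unfolding T_def .
  have TI [simp]: "T (inv T x) = x" for x by (rule surj_f_inv_f[OF bij_is_surj[OF T]])
  have IT: "inv T y = x" if "T x = y" for x y using inv_f_f[OF bij_is_inj[OF T]] that by blast
  have T_add: "T (x + y) = T x + T y" and T_scale: "T (z *\<^sub>C x) = z *\<^sub>C T x" for x y z
    by (simp_all add: T_def R.add V'.add R(2) synthesis_scaleC[OF F'])
  have I_add: "inv T (x + y) = inv T x + inv T y" and I_scale: "inv T (z *\<^sub>C x) = z *\<^sub>C inv T x" for x y z
    by (rule IT, simp add: T_add T_scale)+
  define \<Psi> where "\<Psi> c = c - R (inv T (synthesis F' c))" for c
  show ?thesis
  proof (rule coords_onto_transfer[where \<Psi> = \<Psi>, OF csubspace_kernel[OF F] csubspace_kernel[OF F']])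
    show "\<Psi> (x + y) = \<Psi> x + \<Psi> y" for x y
      by (simp add: \<Psi>_def V'.add I_add R.add)
    show "\<Psi> (c *\<^sub>C x) = c *\<^sub>C \<Psi> x" for c x
      by (simp add: \<Psi>_def synthesis_scaleC[OF F'] I_scale R(2) scaleC_diff_right)
    show "\<Psi> c \<in> kernel F'" for c
      using TI[of "synthesis F' c"] by (simp add: \<Psi>_def V'.diff T_def)
    show "c = 0" if c: "c \<in> kernel F" "\<Psi> c = 0" for c
    proof -
      define x where "x = inv T (synthesis F' c)"
      have "c = R x" using c(2) by (simp add: \<Psi>_def x_def)
      hence "synthesis F (R x) = synthesis F (R 0)"
        using c(1) by (simp add: R.zero V.zero)
      hence "x = 0" using VR by (meson injD)
      thus ?thesis using \<open>c = R x\<close> by (simp add: R.zero)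
    qed
  qed (use J in auto)
qed

context perturbed_frame
begin

lemma excess_eq: "excess UNIV F' = excess UNIV F"
proof -
  \<comment> \<open>One map serves both directions: composed with V the right inverse gives the
    identity, composed with V' a bijection.\<close>
  have id: "bij (\<lambda>x. synthesis F (right_inverse x))" by (simp add: bij_def)
  note bij' = synthesis'_right_inverse_bij
  note R = bounded_linear_right_inverse right_inverse_scaleC
  have "{enat (card J) |J. finite J \<and> coords_onto (kernel F') J}
      = {enat (card J) |J. finite J \<and> coords_onto (kernel F) J}"
  proof (intro equalityI subsetI; clarify)
    fix J assume "finite J" "coords_onto (kernel F') J"
    from coords_onto_kernel_transfer[OF bessel' bessel R bij_is_inj[OF bij'] id this]
    show "\<exists>J'. enat (card J) = enat (card J') \<and> finite J' \<and> coords_onto (kernel F) J'"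
      by (auto intro: sym)
  next
    fix J assume "finite J" "coords_onto (kernel F) J"
    from coords_onto_kernel_transfer[OF bessel bessel' R bij_is_inj[OF id] bij' this]
    show "\<exists>J'. enat (card J) = enat (card J') \<and> finite J' \<and> coords_onto (kernel F') J'"
      by (auto intro: sym)
  qed
  moreover have "{enat (card J) |J. finite J \<and> coords_onto (kernel F) J}
      = {enat (card J) |J. finite J \<and> is_frame (- J) F}"
    using is_frame_remove_iff by blast
  moreover have "{enat (card J) |J. finite J \<and> coords_onto (kernel F') J}
      = {enat (card J) |J. finite J \<and> is_frame (- J) F'}"
    using perturbed.is_frame_remove_iff by blast
  ultimately show ?thesis by (simp add: excess_def Compl_eq_Diff_UNIV)
qed

end

section \<open>Representatives in $L^2$\<close>

lemma L2R_cases: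
  obtains f where "sq_integrable f" "x = abs_L2R f"
proof
  show "sq_integrable (rep_L2R x)"
    using Quotient3_rep_reflp[OF Quotient3_L2R, of x] by (simp add: L2_eq_def)
  show "x = abs_L2R (rep_L2R x)"
    by (simp add: Quotient3_abs_rep[OF Quotient3_L2R])
qed

lemma L2_eq_refl: "sq_integrable f \<Longrightarrow> L2_eq f f"
  by (simp add: L2_eq_def)

lemma abs_L2R_eqI:
  assumes "sq_integrable f" "sq_integrable g" "AE x in lborel. f x = g x"
  shows "abs_L2R f = abs_L2R g"
  using Quotient3_rel[OF Quotient3_L2R, of f g] assms by (simp add: L2_eq_def)

lemma abs_L2R_diff: "sq_integrable f \<Longrightarrow> sq_integrable g \<Longrightarrow> abs_L2R f - abs_L2R g = abs_L2R (\<lambda>x. f x - g x)"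
  by (simp add: minus_L2R.abs_eq L2_eq_refl)

lemma cinner_abs_L2R:
  "sq_integrable f \<Longrightarrow> sq_integrable g \<Longrightarrow> cinner (abs_L2R f) (abs_L2R g) = (LINT x|lborel. f x * cnj (g x))"
  by (simp add: cinner_L2R.abs_eq L2_eq_refl)

lemma norm_abs_L2R:
  assumes "sq_integrable f"
  shows "(norm (abs_L2R f))\<^sup>2 = (LINT x|lborel. (cmod (f x))\<^sup>2)"
  using cinner_self[of "abs_L2R f"] Re_integral_mult_cnj_self[of f]
  by (simp add: cinner_abs_L2R[OF assms assms])

lemma nn_integral_abs_L2R:
  assumes "sq_integrable f"
  shows "(\<integral>\<^sup>+x. ennreal ((cmod (f x))\<^sup>2) \<partial>lborel) = ennreal ((norm (abs_L2R f))\<^sup>2)"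
  unfolding norm_abs_L2R[OF assms]
  using assms by (intro nn_integral_eq_integral) (auto simp: sq_integrable_def)

section \<open>Completeness of $L^2$\<close>

lemma Cauchy_fast_subseq:
  fixes X :: "nat \<Rightarrow> 'a::metric_space"
  assumes "Cauchy X" "\<And>n. 0 < e n"
  obtains r where "strict_mono r" "\<And>n. dist (X (r (Suc n))) (X (r n)) < e n"
proof -
  have "\<exists>N. \<forall>p\<ge>N. \<forall>q\<ge>N. dist (X p) (X q) < e n" for n
    using assms unfolding Cauchy_def by blast
  then obtain N where N: "\<And>n p q. N n \<le> p \<Longrightarrow> N n \<le> q \<Longrightarrow> dist (X p) (X q) < e n"
    by metis
  \<comment> \<open>The sum makes \<open>r n\<close> at least \<open>N n\<close>; the summand
    \<open>n\<close> makes \<open>r\<close> strictly increasing.\<close>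
  define r where "r n = n + (\<Sum>i\<le>n. N i)" for n
  have sm: "strict_mono r" unfolding strict_mono_Suc_iff by (simp add: r_def)
  have "N n \<le> r n" for n
    using member_le_sum[of n "{..n}" N] by (simp add: r_def)
  moreover have "r n \<le> r (Suc n)" for n by (simp add: r_def)
  ultimately have "dist (X (r (Suc n))) (X (r n)) < e n" for n
    using N order_trans by blast
  with sm show thesis by (rule that)
qed

text \<open>Writing \<open>u n\<close> for the increments of a rapidly converging subsequence, \<open>\<Sum> 2\<^sup>n |u n|\<^sup>2\<close> has finite
  integral, hence is finite almost everywhere, which makes \<open>\<Sum> u n\<close> converge pointwise there.\<close>

lemma AE_convergent_if_fast:
  assumes f: "\<And>n. sq_integrable (f n)"
    and fast: "\<And>n. norm (abs_L2R (f (Suc n)) - abs_L2R (f n)) < (1 / 2) ^ n"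
  shows "AE x in lborel. convergent (\<lambda>n. f n x)"
proof -
  have [measurable]: "f n \<in> borel_measurable borel" for n
    using f by (auto simp: sq_integrable_def)
  define u where "u n x = f (Suc n) x - f n x" for n x
  have u: "sq_integrable (u n)" for n unfolding u_def by (intro sq_integrable_diff f)
  have [measurable]: "u n \<in> borel_measurable borel" for n unfolding u_def by measurable
  have "(\<integral>\<^sup>+x. (\<Sum>n. ennreal (2 ^ n * (cmod (u n x))\<^sup>2)) \<partial>lborel)
      = (\<Sum>n. \<integral>\<^sup>+x. ennreal (2 ^ n * (cmod (u n x))\<^sup>2) \<partial>lborel)"
    by (rule nn_integral_suminf) measurable
  also have "\<dots> \<le> (\<Sum>n. ennreal ((1 / 2) ^ n))"
  proof (intro suminf_le summableI)
    fix n
    have "(\<integral>\<^sup>+x. ennreal (2 ^ n * (cmod (u n x))\<^sup>2) \<partial>lborel)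
        = ennreal (2 ^ n) * (\<integral>\<^sup>+x. ennreal ((cmod (u n x))\<^sup>2) \<partial>lborel)"
      by (subst nn_integral_cmult[symmetric]) (auto simp: ennreal_mult')
    also have "\<dots> = ennreal (2 ^ n * (norm (abs_L2R (u n)))\<^sup>2)"
      by (simp add: nn_integral_abs_L2R[OF u] ennreal_mult')
    also have "\<dots> \<le> ennreal (2 ^ n * ((1 / 2) ^ n)\<^sup>2)"
      using fast[of n] unfolding u_def abs_L2R_diff[OF f f]
      by (intro ennreal_leI mult_left_mono power_mono) auto
    also have "2 ^ n * ((1 / 2) ^ n)\<^sup>2 = (1 / 2 :: real) ^ n"
      by (simp add: power2_eq_square power_mult_distrib[symmetric] mult.assoc[symmetric])
    finally show "(\<integral>\<^sup>+x. ennreal (2 ^ n * (cmod (u n x))\<^sup>2) \<partial>lborel) \<le> ennreal ((1 / 2) ^ n)" .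
  qed
  also have "\<dots> = ennreal (\<Sum>n. (1 / 2) ^ n)"
    by (rule suminf_ennreal2) (simp_all add: summable_geometric)
  also have "\<dots> < \<infinity>" by simp
  finally have fin: "(\<integral>\<^sup>+x. (\<Sum>n. ennreal (2 ^ n * (cmod (u n x))\<^sup>2)) \<partial>lborel) \<noteq> \<infinity>" by simp
  have "AE x in lborel. (\<Sum>n. ennreal (2 ^ n * (cmod (u n x))\<^sup>2)) \<noteq> \<infinity>"
    by (rule nn_integral_PInf_AE[OF _ fin]) measurable
  thus ?thesis
  proof eventually_elim
    case (elim x)
    define h where "h = enn2real (\<Sum>n. ennreal (2 ^ n * (cmod (u n x))\<^sup>2))"
    have h: "ennreal h = (\<Sum>n. ennreal (2 ^ n * (cmod (u n x))\<^sup>2))"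
      unfolding h_def using elim by (intro ennreal_enn2real) (simp add: less_top)
    have h0: "0 \<le> h" by (simp add: h_def)
    \<comment> \<open>A single term is at most the whole sum \<open>h\<close>, and its weight 2^n
      turns this into geometric decay with ratio sqrt (1/2).\<close>
    have bound: "norm (u n x) \<le> sqrt h * (sqrt (1 / 2)) ^ n" for n
    proof -
      have "(\<Sum>n\<in>{n}. ennreal (2 ^ n * (cmod (u n x))\<^sup>2)) \<le> ennreal h"
        unfolding h by (rule sum_le_suminf[OF summableI]) simp_all
      hence "2 ^ n * (cmod (u n x))\<^sup>2 \<le> h" using h0 by (simp add: ennreal_le_iff)
      hence "(cmod (u n x))\<^sup>2 \<le> h * (1 / 2) ^ n"
        by (simp add: field_simps)
      hence "cmod (u n x) \<le> sqrt (h * (1 / 2) ^ n)" by (rule real_le_rsqrt)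
      thus ?thesis by (simp add: real_sqrt_mult real_sqrt_power)
    qed
    have "sqrt (1 / 2) < 1" by simp
    hence "summable (\<lambda>n. sqrt h * (sqrt (1 / 2)) ^ n)"
      by (intro summable_mult summable_geometric) simp
    hence "summable (\<lambda>n. u n x)"
      by (rule summable_comparison_test'[where N = 0]) (use bound in simp)
    hence "convergent (\<lambda>n. \<Sum>i<n. u i x)"
      by (simp add: summable_iff_convergent)
    moreover have "(\<Sum>i<n. u i x) = f n x - f 0 x" for n
      unfolding u_def by (rule sum_lessThan_telescope)
    ultimately have "convergent (\<lambda>n. f n x - f 0 x)" by simp
    from convergent_add[OF this convergent_const[of "f 0 x"]] show ?case by simp
  qed
qed

text \<open>Riesz-Fischer: the pointwise limit of a rapidly converging subsequence is the candidate,
  and Fatou's lemma upgrades pointwise convergence to convergence in norm.\<close>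

instance L2R :: complete_space
proof
  fix X :: "nat \<Rightarrow> L2R" assume X: "Cauchy X"
  obtain r where r: "strict_mono r"
    and rapid: "\<And>n. dist (X (r (Suc n))) (X (r n)) < (1 / 2) ^ n"
    using Cauchy_fast_subseq[OF X, of "\<lambda>n. (1 / 2) ^ n"] by auto
  have "\<exists>f. sq_integrable f \<and> X (r n) = abs_L2R f" for n by (metis L2R_cases)
  then obtain f where f: "\<And>n. sq_integrable (f n)" and Xf: "\<And>n. X (r n) = abs_L2R (f n)"
    by metis
  have [measurable]: "f n \<in> borel_measurable borel" for n
    using f by (auto simp: sq_integrable_def)
  define l where "l x = lim (\<lambda>n. f n x)" for x
  have l_meas [measurable]: "l \<in> borel_measurable borel" unfolding l_def by measurable
  have lim: "AE x in lborel. (\<lambda>n. f n x) \<longlonglongrightarrow> l x"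
    using AE_convergent_if_fast[of f] f rapid
    by (simp add: Xf dist_norm l_def convergent_LIMSEQ_iff)
  \<comment> \<open>The bound is stated with the nonnegative integral because square integrability
    of \<open>l\<close> is not yet known; it will be deduced from this very bound.\<close>
  have close: "(\<integral>\<^sup>+x. ennreal ((cmod (f m x - l x))\<^sup>2) \<partial>lborel) \<le> ennreal (e\<^sup>2)"
    if N: "\<And>n. m \<le> n \<Longrightarrow> dist (X (r m)) (X (r n)) \<le> e" for m e
  proof -
    have "(\<integral>\<^sup>+x. ennreal ((cmod (f m x - l x))\<^sup>2) \<partial>lborel)
        = (\<integral>\<^sup>+x. liminf (\<lambda>n. ennreal ((cmod (f m x - f n x))\<^sup>2)) \<partial>lborel)"
    proof (rule nn_integral_cong_AE)
      show "AE x in lborel. ennreal ((cmod (f m x - l x))\<^sup>2)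
          = liminf (\<lambda>n. ennreal ((cmod (f m x - f n x))\<^sup>2))"
        using lim
      proof eventually_elim
        case (elim x)
        have "(\<lambda>n. ennreal ((cmod (f m x - f n x))\<^sup>2)) \<longlonglongrightarrow> ennreal ((cmod (f m x - l x))\<^sup>2)"
          by (intro tendsto_ennrealI tendsto_intros elim)
        thus ?case by (rule lim_imp_Liminf[OF sequentially_bot, symmetric])
      qed
    qed
    also have "\<dots> \<le> liminf (\<lambda>n. \<integral>\<^sup>+x. ennreal ((cmod (f m x - f n x))\<^sup>2) \<partial>lborel)"
      by (rule nn_integral_liminf) measurable
    also have "\<dots> \<le> ennreal (e\<^sup>2)"
    proof (rule Liminf_le)
      have "(\<integral>\<^sup>+x. ennreal ((cmod (f m x - f n x))\<^sup>2) \<partial>lborel) \<le> ennreal (e\<^sup>2)" if "m \<le> n" for n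
        using N[OF that] unfolding nn_integral_abs_L2R[OF sq_integrable_diff[OF f f]]
        by (simp add: Xf dist_norm abs_L2R_diff[OF f f] power_mono)
      thus "eventually (\<lambda>n. (\<integral>\<^sup>+x. ennreal ((cmod (f m x - f n x))\<^sup>2) \<partial>lborel) \<le> ennreal (e\<^sup>2)) sequentially"
        unfolding eventually_sequentially by blast
    qed simp
    finally show ?thesis .
  qed
  have ev: "\<exists>M. \<forall>m\<ge>M. \<forall>n\<ge>m. dist (X (r m)) (X (r n)) \<le> e" if e: "0 < e" for e
  proof -
    obtain M where M: "\<And>m n. M \<le> m \<Longrightarrow> M \<le> n \<Longrightarrow> dist (X m) (X n) < e"
      using X e unfolding Cauchy_def by blast
    have "M \<le> r m" if "M \<le> m" for m
      using that strict_mono_imp_increasing[OF r, of m] by linarith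
    thus ?thesis using M by (meson le_trans less_imp_le)
  qed
  have sq_diff: "sq_integrable (\<lambda>x. f m x - l x)"
    if N: "\<And>n. m \<le> n \<Longrightarrow> dist (X (r m)) (X (r n)) \<le> e" for m e
    unfolding sq_integrable_def integrable_iff_bounded
    using close[OF N] by (auto simp: top.not_eq_extremum intro: le_less_trans)
  obtain M where M: "\<And>n. M \<le> n \<Longrightarrow> dist (X (r M)) (X (r n)) \<le> 1"
    using ev[of 1] by auto
  have l: "sq_integrable l"
    using sq_integrable_diff[OF f[of M] sq_diff[OF M]] by simp
  have "(X \<circ> r) \<longlonglongrightarrow> abs_L2R l"
    unfolding LIMSEQ_def
  proof (intro allI impI)
    fix e :: real assume e: "0 < e"
    obtain M where M: "\<And>m n. M \<le> m \<Longrightarrow> m \<le> n \<Longrightarrow> dist (X (r m)) (X (r n)) \<le> e / 2"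
      using ev[of "e / 2"] e by auto
    have "dist ((X \<circ> r) m) (abs_L2R l) < e" if "M \<le> m" for m
    proof -
      have "ennreal ((norm (abs_L2R (\<lambda>x. f m x - l x)))\<^sup>2) \<le> ennreal ((e / 2)\<^sup>2)"
        using close[of m "e / 2"] M[OF that]
        by (simp add: nn_integral_abs_L2R[OF sq_integrable_diff[OF f l]])
      hence "(norm (abs_L2R (\<lambda>x. f m x - l x)))\<^sup>2 \<le> (e / 2)\<^sup>2"
        by (subst (asm) ennreal_le_iff) auto
      hence "norm (abs_L2R (\<lambda>x. f m x - l x)) \<le> e / 2"
        by (rule power2_le_imp_le) (use e in simp)
      thus ?thesis using e by (simp add: Xf dist_norm abs_L2R_diff[OF f l])
    qed
    thus "\<exists>M. \<forall>m\<ge>M. dist ((X \<circ> r) m) (abs_L2R l) < e" by blast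
  qed
  from Cauchy_converges_subseq[OF X r this] show "convergent X"
    by (auto simp: convergent_def)
qed

instance L2R :: banach ..

section \<open>Supports\<close>

lemma L2_vanishes_on_abs: "sq_integrable f \<Longrightarrow> L2_vanishes_on (abs_L2R f) U \<longleftrightarrow> (AE x in lborel. x \<in> U \<longrightarrow> f x = 0)"
  by (simp add: L2_vanishes_on.abs_eq L2_eq_refl)

lemma L2_vanishes_on_mono:
  assumes "L2_vanishes_on f U" "V \<subseteq> U"
  shows "L2_vanishes_on f V"
proof -
  obtain f0 where f0: "sq_integrable f0" "f = abs_L2R f0" by (rule L2R_cases)
  from assms(1) show ?thesis
    unfolding f0(2) L2_vanishes_on_abs[OF f0(1)]
    by eventually_elim (use assms(2) in blast)
qed

text \<open>The complement of the support is a union of possibly uncountably many open sets;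
  Lindelof's theorem leaves countably many, whose exceptional null sets can be united.\<close>

lemma L2_vanishes_outside_supp: "L2_vanishes_on f (- L2_supp f)"
proof -
  obtain f0 where f0: "sq_integrable f0" "f = abs_L2R f0" by (rule L2R_cases)
  obtain \<F> where \<F>: "\<F> \<subseteq> {U. open U \<and> L2_vanishes_on f U}" "countable \<F>"
      "\<Union>\<F> = \<Union>{U. open U \<and> L2_vanishes_on f U}"
    using Lindelof[of "{U. open U \<and> L2_vanishes_on f U}"] by blast
  have "AE x in lborel. \<forall>U\<in>\<F>. x \<in> U \<longrightarrow> f0 x = 0"
    using \<F>(1) by (intro AE_ball_countable'[OF _ \<F>(2)])
      (auto simp: f0(2) L2_vanishes_on_abs[OF f0(1)])
  hence "AE x in lborel. x \<in> \<Union>\<F> \<longrightarrow> f0 x = 0" by eventually_elim blast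
  thus ?thesis
    unfolding L2_supp_def double_complement \<F>(3)[symmetric]
    unfolding f0(2) L2_vanishes_on_abs[OF f0(1)] .
qed

text \<open>Unlike inclusion of the support, this almost everywhere condition can be followed
  through shifts, cut-offs and reflections on representatives.\<close>

definition L2_in :: "L2R \<Rightarrow> real \<Rightarrow> real \<Rightarrow> bool" where
  "L2_in f lo hi \<longleftrightarrow> L2_vanishes_on f (- {lo..hi})"

lemma L2_in_abs: "sq_integrable f \<Longrightarrow> L2_in (abs_L2R f) lo hi \<longleftrightarrow> (AE x in lborel. x \<notin> {lo..hi} \<longrightarrow> f x = 0)"
  by (simp add: L2_in_def L2_vanishes_on_abs)

lemma L2_in_if_supp: "L2_supp f \<subseteq> {lo..hi} \<Longrightarrow> L2_in f lo hi"
  unfolding L2_in_def by (rule L2_vanishes_on_mono[OF L2_vanishes_outside_supp]) auto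

lemma L2_in_mono: "L2_in f lo hi \<Longrightarrow> lo' \<le> lo \<Longrightarrow> hi \<le> hi' \<Longrightarrow> L2_in f lo' hi'"
  unfolding L2_in_def by (erule L2_vanishes_on_mono) auto

lemma L2_in_eq_0:
  assumes "L2_in f lo hi" "hi \<le> lo"
  shows "f = 0"
proof -
  obtain f0 where f0: "sq_integrable f0" "f = abs_L2R f0" by (rule L2R_cases)
  have "AE x in lborel. f0 x = 0"
    using assms(1)[unfolded f0(2) L2_in_abs[OF f0(1)]] AE_lborel_singleton[of lo]
    by eventually_elim (use assms(2) in auto)
  hence "abs_L2R f0 = abs_L2R (\<lambda>_. 0)"
    by (intro abs_L2R_eqI f0 sq_integrable_0)
  thus ?thesis by (simp add: f0(2) zero_L2R_def)
qed

text \<open>The two intervals share at most the end point \<open>hi\<close>, a null set. This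
  matters because the gap conditions allow consecutive shifted supports to touch.\<close>

lemma L2_in_orthogonal:
  assumes "L2_in f lo hi" "L2_in g lo' hi'" "hi \<le> lo'"
  shows "cinner f g = 0"
proof -
  obtain f0 where f0: "sq_integrable f0" "f = abs_L2R f0" by (rule L2R_cases)
  obtain g0 where g0: "sq_integrable g0" "g = abs_L2R g0" by (rule L2R_cases)
  have "AE x in lborel. f0 x * cnj (g0 x) = 0"
    using assms(1)[unfolded f0(2) L2_in_abs[OF f0(1)]] assms(2)[unfolded g0(2) L2_in_abs[OF g0(1)]]
      AE_lborel_singleton[of hi]
    by eventually_elim (use assms(3) in auto)
  thus ?thesis
    unfolding f0(2) g0(2) cinner_abs_L2R[OF f0(1) g0(1)] by (rule integral_eq_zero_AE)
qed

section \<open>The shift operators\<close>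

lemma AE_shift:
  assumes "AE x in lborel. P (x :: real)" "Measurable.pred borel P"
  shows "AE x in lborel. P (x + t)"
  using AE_borel_affine[of 1 P t] assms by (simp add: add.commute)

lemma L2_in_shift:
  assumes f: "sq_integrable f" and "L2_in (abs_L2R f) lo hi"
  shows "AE x in lborel. x + t \<notin> {lo..hi} \<longrightarrow> f (x + t) = 0"
proof -
  have [measurable]: "f \<in> borel_measurable borel" using f by (auto simp: sq_integrable_def)
  have "AE x in lborel. x \<notin> {lo..hi} \<longrightarrow> f x = 0"
    using assms by (simp add: L2_in_abs)
  thus ?thesis by (rule AE_shift) measurable
qed

lemma U1_abs: "sq_integrable f \<Longrightarrow> U1 lam (abs_L2R f) = abs_L2R (\<lambda>x. complex_of_real (inverse lam) * f (x - 1))"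
  by (simp add: U1.abs_eq L2_eq_refl)

lemma T1_abs: "sq_integrable f \<Longrightarrow> T1 lam (abs_L2R f) = abs_L2R (\<lambda>x. complex_of_real lam * f (x + 1) * indicator {0..} x)"
  by (simp add: T1.abs_eq L2_eq_refl)

lemma sq_integrable_U1: "sq_integrable f \<Longrightarrow> sq_integrable (\<lambda>x. complex_of_real (inverse lam) * f (x - 1))"
  using sq_integrable_scale[OF sq_integrable_shift[of f "-1"]] by simp

lemma sq_integrable_T1: "sq_integrable f \<Longrightarrow> sq_integrable (\<lambda>x. complex_of_real lam * f (x + 1) * indicator {0..} x)"
  by (intro sq_integrable_cut sq_integrable_scale sq_integrable_shift) auto

lemma integral_norm_shift:
  fixes f :: "real \<Rightarrow> complex"
  shows "(LINT x|lborel. (cmod (f (x + t)))\<^sup>2) = (LINT x|lborel. (cmod (f x))\<^sup>2)"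
  using lborel_integral_real_affine[of 1 "\<lambda>x. (cmod (f x))\<^sup>2" t] by (simp add: add.commute)

lemma norm_U1:
  assumes "lam > 0"
  shows "norm (U1 lam f) = norm f / lam"
proof -
  obtain f0 where f0: "sq_integrable f0" "f = abs_L2R f0" by (rule L2R_cases)
  have "(norm (U1 lam f))\<^sup>2 = (LINT x|lborel. (inverse lam)\<^sup>2 * (cmod (f0 (x + (-1))))\<^sup>2)"
    unfolding f0(2) U1_abs[OF f0(1)] norm_abs_L2R[OF sq_integrable_U1[OF f0(1)]]
    by (simp add: norm_mult power_mult_distrib norm_inverse norm_divide power_divide power_inverse)
  also have "\<dots> = (norm f / lam)\<^sup>2"
    unfolding integral_mult_right_zero integral_norm_shift f0(2) norm_abs_L2R[OF f0(1)] power_divide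
    by (simp add: field_simps)
  finally show ?thesis using assms by (simp add: power2_eq_iff_nonneg)
qed

lemma norm_T1_le:
  assumes "lam > 0"
  shows "norm (T1 lam f) \<le> lam * norm f"
proof (rule power2_le_imp_le)
  obtain f0 where f0: "sq_integrable f0" "f = abs_L2R f0" by (rule L2R_cases)
  have "(norm (T1 lam f))\<^sup>2 = (LINT x|lborel. (cmod (complex_of_real lam * f0 (x + 1) * indicator {0..} x))\<^sup>2)"
    unfolding f0(2) T1_abs[OF f0(1)] norm_abs_L2R[OF sq_integrable_T1[OF f0(1)]] ..
  also have "\<dots> \<le> (LINT x|lborel. lam\<^sup>2 * (cmod (f0 (x + 1)))\<^sup>2)"
  proof (rule integral_mono)
    show "integrable lborel (\<lambda>x. (cmod (complex_of_real lam * f0 (x + 1) * indicator {0..} x))\<^sup>2)"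
      using sq_integrable_T1[OF f0(1)] by (simp add: sq_integrable_def)
    show "integrable lborel (\<lambda>x. lam\<^sup>2 * (cmod (f0 (x + 1)))\<^sup>2)"
      using sq_integrable_shift[OF f0(1), of 1] by (simp add: sq_integrable_def)
  qed (auto simp: norm_mult power_mult_distrib indicator_def)
  also have "\<dots> = (lam * norm f)\<^sup>2"
    unfolding integral_mult_right_zero integral_norm_shift f0(2) norm_abs_L2R[OF f0(1)] power_mult_distrib ..
  finally show "(norm (T1 lam f))\<^sup>2 \<le> (lam * norm f)\<^sup>2" .
qed (use assms in simp)

lemma T1_add: "T1 lam (f + g) = T1 lam f + T1 lam g"
  by transfer (auto simp: L2_eq_def distrib_left distrib_right
      intro!: sq_integrable_T1[simplified] sq_integrable_add)

lemma T1_scaleC: "T1 lam (c *\<^sub>C f) = c *\<^sub>C T1 lam f"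
  by transfer (auto simp: L2_eq_def mult_ac intro!: sq_integrable_scale sq_integrable_cut sq_integrable_shift)

lemma bounded_linear_T1: "lam > 0 \<Longrightarrow> bounded_linear (T1 lam)"
  by (rule bounded_linear_intro[where K = lam])
     (use norm_T1_le in \<open>auto simp: T1_add T1_scaleC mult.commute simp flip: scaleC_of_real\<close>)

lemma L2_in_U1:
  assumes "L2_in f lo hi"
  shows "L2_in (U1 lam f) (lo + 1) (hi + 1)"
proof -
  obtain f0 where f0: "sq_integrable f0" "f = abs_L2R f0" by (rule L2R_cases)
  show ?thesis
    unfolding f0(2) U1_abs[OF f0(1)] L2_in_abs[OF sq_integrable_U1[OF f0(1)]]
    using L2_in_shift[OF f0(1) assms[unfolded f0(2)], of "-1"]
    by eventually_elim auto
qed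

lemma L2_in_T1:
  assumes "L2_in f lo hi"
  shows "L2_in (T1 lam f) 0 (hi - 1)"
proof -
  obtain f0 where f0: "sq_integrable f0" "f = abs_L2R f0" by (rule L2R_cases)
  show ?thesis
    unfolding f0(2) T1_abs[OF f0(1)] L2_in_abs[OF sq_integrable_T1[OF f0(1)]]
    using L2_in_shift[OF f0(1) assms[unfolded f0(2)], of 1]
    by eventually_elim (auto simp: indicator_def)
qed

lemma T1_U1:
  assumes "lam > 0" "L2_in f 0 hi"
  shows "T1 lam (U1 lam f) = f"
proof -
  obtain f0 where f0: "sq_integrable f0" "f = abs_L2R f0" by (rule L2R_cases)
  have "AE x in lborel. x \<notin> {0..hi} \<longrightarrow> f0 x = 0"
    using assms(2) by (simp add: f0 L2_in_abs)
  hence "AE x in lborel. complex_of_real lam * (complex_of_real (inverse lam) * f0 (x + 1 - 1)) * indicator {0..} x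
      = f0 x"
    by eventually_elim (use assms(1) in \<open>auto simp: indicator_def\<close>)
  thus ?thesis
    unfolding f0(2) U1_abs[OF f0(1)] T1_abs[OF sq_integrable_U1[OF f0(1)]]
    by (intro abs_L2R_eqI sq_integrable_T1[OF sq_integrable_U1[OF f0(1)]] f0)
qed

lemma L2_in_U1_funpow: "L2_in f lo hi \<Longrightarrow> L2_in ((U1 lam ^^ n) f) (lo + n) (hi + n)"
proof (induction n)
  case (Suc n)
  from L2_in_U1[OF Suc.IH[OF Suc.prems]] show ?case by (simp add: add_ac)
qed simp

lemma L2_in_T1_funpow: "L2_in f 0 hi \<Longrightarrow> L2_in ((T1 lam ^^ n) f) 0 (hi - n)"
proof (induction n)
  case (Suc n)
  from L2_in_T1[OF Suc.IH[OF Suc.prems]] show ?case by (simp add: algebra_simps)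
qed simp

lemma norm_U1_funpow: "lam > 0 \<Longrightarrow> norm ((U1 lam ^^ n) f) = norm f / lam ^ n"
  by (induction n) (simp_all add: norm_U1)

text \<open>Functions shifted by \<open>U1\<close> out of [0, \<infinity>[ still live there, so no
  cut-off acts and every \<open>T1\<close> undoes one \<open>U1\<close>.\<close>

lemma T1_U1_funpow:
  assumes "lam > 0" "L2_in f 0 hi"
  shows "(T1 lam ^^ m) ((U1 lam ^^ (m + n)) f) = (U1 lam ^^ n) f"
proof (induction m)
  case (Suc m)
  have "L2_in ((U1 lam ^^ (m + n)) f) 0 (hi + real (m + n))"
    by (rule L2_in_mono[OF L2_in_U1_funpow[OF assms(2)]]) auto
  from T1_U1[OF assms(1) this] have "T1 lam ((U1 lam ^^ Suc (m + n)) f) = (U1 lam ^^ (m + n)) f"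
    by simp
  \<comment> \<open>The innermost \<open>T1\<close> is split off, since it is the one that meets the
    outermost \<open>U1\<close>.\<close>
  moreover have "(T1 lam ^^ Suc m) g = (T1 lam ^^ m) (T1 lam g)" for g
    by (simp only: funpow_Suc_right comp_apply)
  ultimately show ?case
    using Suc.IH by (simp only: add_Suc)
qed simp

text \<open>The first \<open>m\<close> applications restore \<open>f\<close>; the other
  \<open>n\<close> push [0, hi] past the origin, where the cut-off leaves at most a point.\<close>

lemma T1_U1_funpow_eq_0:
  assumes "lam > 0" "L2_in f 0 hi" "hi \<le> n"
  shows "(T1 lam ^^ (m + n)) ((U1 lam ^^ m) f) = 0"
proof -
  have "(T1 lam ^^ (m + n)) ((U1 lam ^^ m) f) = (T1 lam ^^ n) ((T1 lam ^^ m) ((U1 lam ^^ (m + 0)) f))"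
    by (simp add: funpow_add add.commute[of m n])
  also have "\<dots> = (T1 lam ^^ n) f" unfolding T1_U1_funpow[OF assms(1,2)] by simp
  also have "\<dots> = 0"
    by (rule L2_in_eq_0[OF L2_in_T1_funpow[OF assms(2)]]) (use assms(3) in simp)
  finally show ?thesis .
qed

lemma bounded_linear_T1_funpow:
  assumes "lam > 0"
  shows "bounded_linear (T1 lam ^^ n)"
proof (induction n)
  case (Suc n)
  show ?case
    using bounded_linear_compose[OF bounded_linear_T1[OF assms] Suc.IH] by (simp add: comp_def)
qed (simp add: id_def bounded_linear_ident)

section \<open>Reflection of the real line\<close>

lemma sq_integrable_reflect: "sq_integrable f \<Longrightarrow> sq_integrable (\<lambda>x. f (p - x))"
  using lborel_integrable_real_affine[of "\<lambda>x. (cmod (f x))\<^sup>2" "-1" p]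
  unfolding sq_integrable_def by auto

lift_definition L2_reflect :: "real \<Rightarrow> L2R \<Rightarrow> L2R" is "\<lambda>p f x. f (p - x)"
proof -
  fix p f g assume *: "L2_eq f g"
  hence [measurable]: "f \<in> borel_measurable borel" "g \<in> borel_measurable borel"
    by (auto simp: L2_eq_def sq_integrable_def)
  have "AE x in lborel. f (p - x) = g (p - x)"
    using AE_borel_affine[of "-1" "\<lambda>x. f x = g x" p] * by (simp add: L2_eq_def)
  with * show "L2_eq (\<lambda>x. f (p - x)) (\<lambda>x. g (p - x))"
    by (simp add: L2_eq_def sq_integrable_reflect)
qed

lemma L2_reflect_abs: "sq_integrable f \<Longrightarrow> L2_reflect p (abs_L2R f) = abs_L2R (\<lambda>x. f (p - x))"
  by (simp add: L2_reflect.abs_eq L2_eq_refl)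

lemma norm_L2_reflect: "norm (L2_reflect p f) = norm f"
proof -
  obtain f0 where f0: "sq_integrable f0" "f = abs_L2R f0" by (rule L2R_cases)
  have "(norm (L2_reflect p f))\<^sup>2 = (norm f)\<^sup>2"
    unfolding f0(2) L2_reflect_abs[OF f0(1)] norm_abs_L2R[OF sq_integrable_reflect[OF f0(1)]]
      norm_abs_L2R[OF f0(1)]
    using lborel_integral_real_affine[of "-1" "\<lambda>x. (cmod (f0 x))\<^sup>2" p] by simp
  thus ?thesis by (simp add: power2_eq_iff_nonneg)
qed

lemma L2_reflect_add: "L2_reflect p (f + g) = L2_reflect p f + L2_reflect p g"
  by transfer (auto simp: L2_eq_def intro!: sq_integrable_reflect sq_integrable_add)

lemma L2_reflect_scaleC: "L2_reflect p (c *\<^sub>C f) = c *\<^sub>C L2_reflect p f"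
  by transfer (auto simp: L2_eq_def intro!: sq_integrable_reflect sq_integrable_scale)

lemma bounded_linear_L2_reflect: "bounded_linear (L2_reflect p)"
  by (rule bounded_linear_intro[where K = 1])
     (auto simp: L2_reflect_add L2_reflect_scaleC norm_L2_reflect simp flip: scaleC_of_real)

lemma L2_reflect_reflect: "L2_reflect p (L2_reflect p f) = f"
  by transfer (auto simp: L2_eq_def)

lemma L2_reflect_U2: "L2_reflect p (U2 lam f) = U1 lam (L2_reflect p f)"
proof -
  obtain f0 where f0: "sq_integrable f0" "f = abs_L2R f0" by (rule L2R_cases)
  have "sq_integrable (\<lambda>x. complex_of_real (inverse lam) * f0 (x + 1))"
    by (intro sq_integrable_scale sq_integrable_shift f0)
  thus ?thesis
    unfolding f0(2)
    by (simp add: L2_reflect_abs U1_abs U2.abs_eq L2_eq_refl f0(1) sq_integrable_reflect algebra_simps)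
qed

text \<open>The half-line ]-\<infinity>, L] goes to [0, \<infinity>[ under x -> L - x, so here the
  reflection parameter is tied to the cut-off, while the pure shift \<open>U2\<close> commutes in
  this sense with every \<open>p\<close>.\<close>

lemma L2_reflect_T2: "L2_reflect L (T2 lam L f) = T1 lam (L2_reflect L f)"
proof -
  obtain f0 where f0: "sq_integrable f0" "f = abs_L2R f0" by (rule L2R_cases)
  have "sq_integrable (\<lambda>x. complex_of_real lam * f0 (x - 1) * indicator {..L} x)"
    using sq_integrable_shift[OF f0(1), of "-1"] by (intro sq_integrable_cut sq_integrable_scale) auto
  moreover have "indicator {..L} (L - x) = (indicator {0..} x :: complex)" for x
    by (auto simp: indicator_def)
  ultimately show ?thesis
    unfolding f0(2)
    by (simp add: L2_reflect_abs T1_abs T2.abs_eq L2_eq_refl f0(1) sq_integrable_reflect algebra_simps)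
qed

lemma L2_reflect_U2_funpow: "L2_reflect p ((U2 lam ^^ n) f) = (U1 lam ^^ n) (L2_reflect p f)"
  by (induction n) (simp_all add: L2_reflect_U2)

lemma L2_reflect_T2_funpow: "L2_reflect L ((T2 lam L ^^ n) f) = (T1 lam ^^ n) (L2_reflect L f)"
  by (induction n) (simp_all add: L2_reflect_T2)

lemma L2_in_reflect:
  assumes "L2_in f lo hi"
  shows "L2_in (L2_reflect p f) (p - hi) (p - lo)"
proof -
  obtain f0 where f0: "sq_integrable f0" "f = abs_L2R f0" by (rule L2R_cases)
  have [measurable]: "f0 \<in> borel_measurable borel" using f0 by (auto simp: sq_integrable_def)
  have "AE x in lborel. x \<notin> {lo..hi} \<longrightarrow> f0 x = 0"
    using assms by (simp add: f0 L2_in_abs)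
  hence "AE x in lborel. p + (-1) * x \<notin> {lo..hi} \<longrightarrow> f0 (p + (-1) * x) = 0"
    by (intro AE_borel_affine) auto
  thus ?thesis
    unfolding f0(2) L2_reflect_abs[OF f0(1)] L2_in_abs[OF sq_integrable_reflect[OF f0(1)]]
    by eventually_elim auto
qed

section \<open>Superposing shifted functions\<close>

context
  fixes lam B :: real and G :: "nat \<Rightarrow> L2R" and b :: "nat \<Rightarrow> real" and \<alpha> :: "nat \<Rightarrow> nat"
  assumes lam: "1 < lam"
    and G_norm: "\<And>n. (norm (G n))\<^sup>2 \<le> B"
    and G_in: "\<And>n. L2_in (G n) 0 (b n)"
    and \<alpha>: "strict_mono \<alpha>"
    and gap: "\<And>n. b n \<le> real (\<alpha> (Suc n)) - real (\<alpha> n)"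
begin

private lemma alpha_le: "m \<le> n \<Longrightarrow> \<alpha> m + (n - m) \<le> \<alpha> n"
proof (induction n rule: dec_induct)
  case (step n)
  have "\<alpha> n < \<alpha> (Suc n)" by (rule strict_monoD[OF \<alpha>]) simp
  thus ?case using step by simp
qed simp

private lemma B_nonneg: "0 \<le> B"
  by (rule order_trans[OF zero_le_power2 G_norm])

lemma summable_superposition: "summable (\<lambda>n. (U1 lam ^^ \<alpha> n) (G n))"
proof (rule summable_comparison_test'[where N = 0])
  show "summable (\<lambda>n. sqrt B * (1 / lam) ^ n)"
    using lam by (intro summable_mult summable_geometric) simp
  fix n
  \<comment> \<open>A strictly increasing sequence of naturals satisfies n \<le> \<alpha> n, so the
    shifted terms decay geometrically.\<close>
  have "lam ^ n \<le> lam ^ \<alpha> n"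
    using lam alpha_le[of 0 n] by (intro power_increasing) auto
  moreover have "norm (G n) \<le> sqrt B" by (rule real_le_rsqrt[OF G_norm])
  ultimately have "norm (G n) / lam ^ \<alpha> n \<le> sqrt B / lam ^ n"
    using lam B_nonneg by (intro frac_le) auto
  thus "norm ((U1 lam ^^ \<alpha> n) (G n)) \<le> sqrt B * (1 / lam) ^ n"
    using lam by (simp add: norm_U1_funpow power_one_over divide_inverse power_inverse)
qed

lemma superposition_error:
  "(norm (G k - (T1 lam ^^ \<alpha> k) (\<Sum>n. (U1 lam ^^ \<alpha> n) (G n))))\<^sup>2
    \<le> B * lam\<^sup>2 / (lam\<^sup>2 - 1) * lam powr (- 2 * (real (\<alpha> (Suc k)) - real (\<alpha> k)))"
proof -
  have lam0: "lam > 0" using lam by simp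
  interpret T: bounded_linear "T1 lam ^^ \<alpha> k" by (rule bounded_linear_T1_funpow[OF lam0])
  define s where "s n = (T1 lam ^^ \<alpha> k) ((U1 lam ^^ \<alpha> n) (G n))" for n
  define v where "v j = (U1 lam ^^ (\<alpha> (Suc k + j) - \<alpha> k)) (G (Suc k + j))" for j
  have s_less: "s n = 0" if "n < k" for n
  proof -
    have mn: "\<alpha> (Suc n) \<le> \<alpha> k" "\<alpha> n \<le> \<alpha> (Suc n)"
      using that strict_mono_less_eq[OF \<alpha>] by simp_all
    hence "b n \<le> real (\<alpha> k - \<alpha> n)" using gap[of n] by simp
    from T1_U1_funpow_eq_0[OF lam0 G_in this, of "\<alpha> n"] show ?thesis
      using mn by (simp add: s_def)
  qed
  have s_eq: "s n = (U1 lam ^^ (\<alpha> n - \<alpha> k)) (G n)" if "k \<le> n" for n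
  proof -
    have "\<alpha> k \<le> \<alpha> n" using that strict_mono_less_eq[OF \<alpha>] by simp
    with T1_U1_funpow[OF lam0 G_in[of n], of "\<alpha> k" "\<alpha> n - \<alpha> k"] show ?thesis
      by (simp add: s_def)
  qed
  have s_summable: "summable s" unfolding s_def by (rule T.summable[OF summable_superposition])
  have "(T1 lam ^^ \<alpha> k) (\<Sum>n. (U1 lam ^^ \<alpha> n) (G n)) = suminf s"
    unfolding s_def by (rule T.suminf[OF summable_superposition])
  also have "\<dots> = (\<Sum>j. s (j + Suc k)) + (\<Sum>n<Suc k. s n)"
    by (rule suminf_split_initial_segment[OF s_summable])
  also have "(\<Sum>n<Suc k. s n) = G k" using s_less s_eq[of k] by simp
  also have "(\<lambda>j. s (j + Suc k)) = v" using s_eq by (auto simp: v_def add.commute)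
  finally have eq: "G k - (T1 lam ^^ \<alpha> k) (\<Sum>n. (U1 lam ^^ \<alpha> n) (G n)) = - suminf v"
    by simp
  have v_summable: "summable v"
    using summable_ignore_initial_segment[OF s_summable, of "Suc k"] \<open>(\<lambda>j. s (j + Suc k)) = v\<close>
    by simp
  define r where "r = 1 / lam\<^sup>2"
  define \<Delta> where "\<Delta> = \<alpha> (Suc k) - \<alpha> k"
  have lam2: "1 < lam\<^sup>2" using lam by (simp add: one_less_power)
  have r: "0 < r" "r < 1" using lam2 lam0 by (simp_all add: r_def)
  note B = B_nonneg
  have v_norm: "(norm (v j))\<^sup>2 \<le> B * r ^ \<Delta> * r ^ j" for j
  proof -
    define e where "e = \<alpha> (Suc k + j) - \<alpha> k"
    \<comment> \<open>Beyond the gap \<Delta> every step of \<alpha> adds at least 1, which makes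
      the squared norms decay like \<open>r ^ j\<close>.\<close>
    have e: "\<Delta> + j \<le> e"
      using alpha_le[of "Suc k" "Suc k + j"] strict_mono_less_eq[OF \<alpha>, of k "Suc k"]
      by (simp add: e_def \<Delta>_def)
    have "(norm (v j))\<^sup>2 = (norm (G (Suc k + j)))\<^sup>2 * r ^ e"
      using lam0 by (simp add: v_def e_def norm_U1_funpow r_def power_divide power_mult[symmetric] mult.commute)
    also have "\<dots> \<le> B * r ^ (\<Delta> + j)"
      using r e B by (intro mult_mono G_norm power_decreasing) auto
    finally show ?thesis by (simp add: power_add)
  qed
  \<comment> \<open>By the gap condition the right end may be taken to be the left end belonging to
    \<open>Suc j\<close>.\<close>
  have v_in: "L2_in (v j) (real (\<alpha> (Suc k + j)) - real (\<alpha> k)) (real (\<alpha> (Suc (Suc k + j))) - real (\<alpha> k))" for j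
  proof -
    have "\<alpha> k \<le> \<alpha> (Suc k + j)" using strict_mono_less_eq[OF \<alpha>] by simp
    thus ?thesis unfolding v_def
      by (intro L2_in_mono[OF L2_in_U1_funpow[OF G_in]]) (use gap[of "Suc k + j"] in auto)
  qed
  have orth: "orthogonal (v i) (v j)" if "i < j" for i j
  proof -
    have "\<alpha> (Suc (Suc k + i)) \<le> \<alpha> (Suc k + j)" using that strict_mono_less_eq[OF \<alpha>] by simp
    hence "cinner (v i) (v j) = 0" by (intro L2_in_orthogonal[OF v_in v_in]) simp
    thus ?thesis by (simp add: orthogonal_def inner_eq_Re_cinner)
  qed
  \<comment> \<open>Pythagoras needs finite sums; the bound is uniform in \<open>N\<close> and so
    passes to the limit.\<close>
  have partial: "(norm (\<Sum>j<N. v j))\<^sup>2 \<le> B * r ^ \<Delta> * (1 / (1 - r))" for N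
  proof -
    have "pairwise (\<lambda>i j. orthogonal (v i) (v j)) {..<N}"
      using orth by (metis (no_types, lifting) linorder_neqE_nat orthogonal_commute pairwiseI)
    hence "(norm (\<Sum>j<N. v j))\<^sup>2 = (\<Sum>j<N. (norm (v j))\<^sup>2)"
      by (intro norm_sum_Pythagorean) auto
    also have "\<dots> \<le> (\<Sum>j<N. B * r ^ \<Delta> * r ^ j)" by (intro sum_mono v_norm)
    also have "\<dots> = B * r ^ \<Delta> * (\<Sum>j<N. r ^ j)" by (simp add: sum_distrib_left)
    also have "(\<Sum>j<N. r ^ j) \<le> (\<Sum>j. r ^ j)"
      using r by (intro sum_le_suminf summable_geometric) auto
    also have "(\<Sum>j. r ^ j) = 1 / (1 - r)" using r by (intro suminf_geometric) simp
    finally show ?thesis using B r by (simp add: mult_left_mono)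
  qed
  have "(norm (suminf v))\<^sup>2 \<le> B * r ^ \<Delta> * (1 / (1 - r))"
    by (rule LIMSEQ_le_const2[OF tendsto_power[OF tendsto_norm[OF summable_LIMSEQ[OF v_summable]]]])
       (use partial in blast)
  also have "r ^ \<Delta> = lam powr (- 2 * (real (\<alpha> (Suc k)) - real (\<alpha> k)))"
  proof -
    have "real (\<alpha> (Suc k)) - real (\<alpha> k) = real \<Delta>"
      using strict_mono_less_eq[OF \<alpha>, of k "Suc k"] by (simp add: \<Delta>_def)
    moreover have "lam powr (- 2 * real \<Delta>) = inverse (lam powr (real (2 * \<Delta>)))"
      by (simp add: powr_minus)
    hence "lam powr (- 2 * real \<Delta>) = r ^ \<Delta>"
      unfolding powr_realpow[OF lam0] by (simp add: r_def power_mult power_one_over divide_inverse power_inverse)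
    ultimately show ?thesis by simp
  qed
  also have "1 / (1 - r) = lam\<^sup>2 / (lam\<^sup>2 - 1)"
    using lam2 lam0 by (simp add: r_def field_simps)
  finally show ?thesis unfolding eq by (simp add: mult_ac)
qed

end

section \<open>The support dichotomy\<close>

lemma L2_nonzero_on_unit_interval:
  obtains \<phi> where "\<phi> \<noteq> 0" "L2_in \<phi> m (m + 1)"
proof -
  define u :: "real \<Rightarrow> complex" where "u = indicator {m..m + 1}"
  have sq: "(cmod (u x))\<^sup>2 = indicator {m..m + 1} x" for x by (simp add: u_def indicator_def)
  have u: "sq_integrable u"
    unfolding sq_integrable_def sq by (simp add: u_def)
  have "(norm (abs_L2R u))\<^sup>2 = 1"
    unfolding norm_abs_L2R[OF u] sq by simp
  hence "abs_L2R u \<noteq> 0" by auto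
  moreover have "L2_in (abs_L2R u) m (m + 1)"
    unfolding L2_in_abs[OF u] by (simp add: u_def)
  ultimately show thesis by (rule that)
qed

lemma frame_complete:
  assumes "frame_bounds UNIV F A B" "\<And>k. cinner x (F k) = 0"
  shows "x = 0"
proof -
  have "A * (norm x)\<^sup>2 \<le> (\<Sum>\<^sub>\<infinity>k. (cmod (cinner x (F k)))\<^sup>2)" "A > 0"
    using assms(1) by (auto simp: frame_bounds_def)
  hence "A * (norm x)\<^sup>2 \<le> 0" "A > 0" by (simp_all add: assms(2))
  thus ?thesis by (simp add: mult_le_0_iff)
qed

lemma finite_compact_supports_bounded:
  assumes "finite K" "\<And>k. compact (L2_supp (f k))"
  shows "\<exists>P\<ge>0. \<forall>k\<in>K. L2_supp (f k) \<subseteq> {- P..P}"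
proof -
  have "bounded (\<Union>k\<in>K. L2_supp (f k))"
    using assms by (intro bounded_UN) (auto intro: compact_imp_bounded)
  then obtain P where P: "0 < P" "\<forall>x\<in>(\<Union>k\<in>K. L2_supp (f k)). norm x \<le> P"
    by (auto simp: bounded_pos)
  have "x \<in> {- P..P}" if "k \<in> K" "x \<in> L2_supp (f k)" for k x
    using P(2) that by (fastforce simp: abs_le_iff)
  thus ?thesis using P(1) by (intro exI[of _ P]) auto
qed

text \<open>Otherwise all supports would end before a common \<open>m\<close>: finitely many by
  compactness, the others because they meet the negative axis and have length at most
  \<open>D\<close>. A nonzero function living beyond \<open>m\<close> would be orthogonal to the
  whole frame.\<close>

lemma infinite_supports_right:
  fixes f :: "nat \<Rightarrow> L2R"
  assumes frame: "frame_bounds UNIV f A B" and compact: "\<And>k. compact (L2_supp (f k))"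
    and supp: "\<And>k. L2_supp (f k) \<subseteq> {p k..q k}" and bdd: "bdd_above (range (\<lambda>k. q k - p k))"
  shows "infinite {k. L2_supp (f k) \<subseteq> {0..}}"
proof
  assume fin: "finite {k. L2_supp (f k) \<subseteq> {0..}}"
  obtain P where P: "0 \<le> P" "\<forall>k\<in>{k. L2_supp (f k) \<subseteq> {0..}}. L2_supp (f k) \<subseteq> {- P..P}"
    using finite_compact_supports_bounded[where f = f, OF fin compact] by blast
  obtain D where D: "\<And>k. q k - p k \<le> D" using bdd by (auto simp: bdd_above_def)
  define m where "m = max D P"
  obtain \<phi> where \<phi>: "\<phi> \<noteq> 0" "L2_in \<phi> m (m + 1)" by (rule L2_nonzero_on_unit_interval)
  have "cinner \<phi> (f k) = 0" for k
  proof -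
    have "\<exists>lo. L2_supp (f k) \<subseteq> {lo..m}"
    proof (cases "L2_supp (f k) \<subseteq> {0..}")
      case True
      with P(2) have "L2_supp (f k) \<subseteq> {- P..P}" by blast
      thus ?thesis by (intro exI[of _ "- P"]) (fastforce simp: m_def)
    next
      case False
      then obtain x where "x \<in> L2_supp (f k)" "x < 0" by force
      hence "p k < 0" using supp[of k] by fastforce
      hence "q k \<le> m" using D[of k] by (simp add: m_def)
      thus ?thesis using supp[of k] by (intro exI[of _ "p k"]) auto
    qed
    then obtain lo where "L2_in (f k) lo m" using L2_in_if_supp by blast
    hence "cinner (f k) \<phi> = 0" using \<phi>(2) by (rule L2_in_orthogonal) simp
    thus ?thesis by (subst cinner_commute) simp
  qed
  thus False using frame_complete[OF frame] \<phi>(1) by blast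
qed

text \<open>Otherwise all supports would start after a common \<open>- P\<close>, those in [0,
  \<infinity>[ trivially and the finitely many others by compactness; a function living to the left
  of \<open>- P\<close> contradicts the lower frame bound.\<close>

lemma infinite_supports_left:
  fixes f :: "nat \<Rightarrow> L2R"
  assumes frame: "frame_bounds UNIV f A B" and compact: "\<And>k. compact (L2_supp (f k))"
  shows "infinite {k. \<not> L2_supp (f k) \<subseteq> {0..}}"
proof
  assume fin: "finite {k. \<not> L2_supp (f k) \<subseteq> {0..}}"
  obtain P where P: "0 \<le> P" "\<forall>k\<in>{k. \<not> L2_supp (f k) \<subseteq> {0..}}. L2_supp (f k) \<subseteq> {- P..P}"
    using finite_compact_supports_bounded[where f = f, OF fin compact] by blast
  obtain \<phi> where \<phi>: "\<phi> \<noteq> 0" "L2_in \<phi> (- P - 1) (- P - 1 + 1)" by (rule L2_nonzero_on_unit_interval)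
  have "cinner \<phi> (f k) = 0" for k
  proof -
    obtain Q where Q: "L2_supp (f k) \<subseteq> {- Q..Q}"
      using finite_compact_supports_bounded[of "{k}" f, OF _ compact] by auto
    have "\<exists>hi. L2_supp (f k) \<subseteq> {- P..hi}"
    proof (cases "L2_supp (f k) \<subseteq> {0..}")
      case True
      thus ?thesis using Q P(1) by (intro exI[of _ Q]) fastforce
    qed (use P(2) in auto)
    then obtain hi where "L2_in (f k) (- P) hi" using L2_in_if_supp by blast
    from L2_in_orthogonal[OF \<phi>(2) this] show ?thesis by simp
  qed
  thus False using frame_complete[OF frame] \<phi>(1) by blast
qed

section \<open>The approximating frame\<close>

lemma eps_approximation_if_sum_le:
  assumes le: "\<And>J. finite J \<Longrightarrow> J \<subseteq> I \<Longrightarrow> (\<Sum>k\<in>J. (norm (F k - F' k))\<^sup>2) \<le> \<epsilon>"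
  shows "eps_approximation \<epsilon> I F F'"
  unfolding eps_approximation_def
proof (intro allI impI, elim conjE)
  fix J c assume J: "finite J" "J \<subseteq> I"
  have "norm (\<Sum>k\<in>J. c k *\<^sub>C (F k - F' k)) \<le> (\<Sum>k\<in>J. \<bar>cmod (c k)\<bar> * \<bar>norm (F k - F' k)\<bar>)"
    by (rule order_trans[OF norm_sum]) (simp add: norm_scaleC)
  also have "\<dots> \<le> L2_set (\<lambda>k. cmod (c k)) J * L2_set (\<lambda>k. norm (F k - F' k)) J"
    by (rule L2_set_mult_ineq)
  finally have "(norm (\<Sum>k\<in>J. c k *\<^sub>C (F k - F' k)))\<^sup>2
      \<le> (L2_set (\<lambda>k. cmod (c k)) J * L2_set (\<lambda>k. norm (F k - F' k)) J)\<^sup>2"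
    by (rule power_mono) simp
  also have "\<dots> = (\<Sum>k\<in>J. (norm (F k - F' k))\<^sup>2) * (\<Sum>k\<in>J. (cmod (c k))\<^sup>2)"
    by (simp add: L2_set_def power_mult_distrib sum_nonneg)
  also have "\<dots> \<le> \<epsilon> * (\<Sum>k\<in>J. (cmod (c k))\<^sup>2)"
    by (intro mult_right_mono le J sum_nonneg) auto
  finally show "(norm (\<Sum>k\<in>J. c k *\<^sub>C (F k - F' k)))\<^sup>2 \<le> \<epsilon> * (\<Sum>k\<in>J. (cmod (c k))\<^sup>2)" .
qed

text \<open>The sum of (1/2)^(k+1) over all k from 0 is 1, so each family uses up at most half of
  \<epsilon>.\<close>

lemma eps_approximation_case_sum:
  fixes g g' h h' :: "nat \<Rightarrow> 'h::complex_inner"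
  assumes \<epsilon>: "0 \<le> \<epsilon>"
    and g: "\<And>k. (norm (g k - g' k))\<^sup>2 \<le> \<epsilon> / 2 * (1 / 2) ^ Suc k"
    and h: "\<And>k. (norm (h k - h' k))\<^sup>2 \<le> \<epsilon> / 2 * (1 / 2) ^ Suc k"
  shows "eps_approximation \<epsilon> UNIV (case_sum g h) (case_sum g' h')"
proof (rule eps_approximation_if_sum_le)
  fix J :: "(nat + nat) set" assume J: "finite J"
  have geometric: "(\<Sum>k\<in>I. \<epsilon> / 2 * (1 / 2) ^ Suc k) \<le> \<epsilon> / 2" if "finite I" for I :: "nat set"
  proof -
    have "(\<Sum>k\<in>I. (1 / 2 :: real) ^ Suc k) \<le> (\<Sum>k. (1 / 2) ^ Suc k)"
      using that power_half_series by (intro sum_le_suminf) (auto simp: sums_iff)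
    also have "\<dots> = 1" using power_half_series by (simp add: sums_iff)
    finally have "\<epsilon> / 2 * (\<Sum>k\<in>I. (1 / 2) ^ Suc k) \<le> \<epsilon> / 2 * 1"
      using \<epsilon> by (intro mult_left_mono) auto
    thus ?thesis by (simp add: sum_distrib_left)
  qed
  define e where "e k = (norm (case_sum g h k - case_sum g' h' k))\<^sup>2" for k
  have fin: "finite (Inl -` J)" "finite (Inr -` J)"
    using J by (auto intro: finite_vimageI)
  have "k \<in> J \<longleftrightarrow> k \<in> Inl ` (Inl -` J) \<union> Inr ` (Inr -` J)" for k by (cases k) auto
  hence "J = Inl ` (Inl -` J) \<union> Inr ` (Inr -` J)" by blast
  hence "(\<Sum>k\<in>J. e k) = (\<Sum>k\<in>Inl ` (Inl -` J) \<union> Inr ` (Inr -` J). e k)" by simp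
  also have "\<dots> = (\<Sum>k\<in>Inl ` (Inl -` J). e k) + (\<Sum>k\<in>Inr ` (Inr -` J). e k)"
    by (intro sum.union_disjoint finite_imageI fin) auto
  also have "\<dots> = (\<Sum>k\<in>Inl -` J. (norm (g k - g' k))\<^sup>2) + (\<Sum>k\<in>Inr -` J. (norm (h k - h' k))\<^sup>2)"
    by (simp add: sum.reindex e_def del: image_vimage_eq)
  also have "\<dots> \<le> (\<Sum>k\<in>Inl -` J. \<epsilon> / 2 * (1 / 2) ^ Suc k) + (\<Sum>k\<in>Inr -` J. \<epsilon> / 2 * (1 / 2) ^ Suc k)"
    by (intro add_mono sum_mono g h)
  also have "\<dots> \<le> \<epsilon>" using geometric[OF fin(1)] geometric[OF fin(2)] by linarith
  finally show "(\<Sum>k\<in>J. (norm (case_sum g h k - case_sum g' h' k))\<^sup>2) \<le> \<epsilon>" unfolding e_def .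
qed

text \<open>Exponentiating the hypothesis gives lam^(-2t) \<le> 2^(-k) * \<epsilon>/(2B) * 1/q with
  q = lam^2 / (lam^2 - 1); the factors B and q of the error estimate then cancel.\<close>

lemma gap_error_bound:
  fixes lam B \<epsilon> t :: real
  assumes lam: "1 < lam" and B: "0 < B" and \<epsilon>: "0 < \<epsilon>"
    and t: "(real k * ln 2 + ln (2 * B / \<epsilon>) + ln (lam\<^sup>2 / (lam\<^sup>2 - 1))) / (2 * ln lam) \<le> t"
  shows "B * lam\<^sup>2 / (lam\<^sup>2 - 1) * lam powr (- 2 * t) \<le> \<epsilon> / 2 * (1 / 2) ^ k"
proof -
  have lam2: "1 < lam\<^sup>2" using lam by (simp add: one_less_power)
  define q where "q = lam\<^sup>2 / (lam\<^sup>2 - 1)"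
  have q: "0 < q" unfolding q_def using lam2 by (intro divide_pos_pos) auto
  have "real k * ln 2 + ln (2 * B / \<epsilon>) + ln q \<le> 2 * t * ln lam"
    using t lam by (simp add: q_def pos_divide_le_eq mult_ac)
  hence "lam powr (- 2 * t) \<le> exp (- (real k * ln 2) - ln (2 * B / \<epsilon>) - ln q)"
    using lam by (simp add: powr_def)
  also have "\<dots> = (1 / 2) ^ k * (\<epsilon> / (2 * B)) / q"
  proof -
    have "exp (- (real k * ln 2)) = (1 / 2 :: real) ^ k"
      by (simp add: exp_minus exp_of_nat_mult power_one_over inverse_eq_divide)
    moreover have "0 < 2 * B / \<epsilon>" using B \<epsilon> by simp
    ultimately have "exp (- (real k * ln 2) - ln (2 * B / \<epsilon>) - ln q) = (1 / 2) ^ k / (2 * B / \<epsilon>) / q"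
      using q by (simp only: exp_diff exp_ln)
    thus ?thesis by simp
  qed
  finally have "B * q * lam powr (- 2 * t) \<le> B * q * ((1 / 2) ^ k * (\<epsilon> / (2 * B)) / q)"
    using B q by (intro mult_left_mono) auto
  also have "\<dots> = \<epsilon> / 2 * (1 / 2) ^ k" using B q by (simp add: field_simps)
  finally show ?thesis by (simp add: q_def)
qed

text \<open>The Bessel bound for a single coefficient 1. This is how B enters the error
  estimates.\<close>

lemma frame_element_norm_le:
  fixes F :: "'i::countable \<Rightarrow> 'h::complex_inner"
  assumes "frame_bounds UNIV F A B"
  shows "(norm (F k))\<^sup>2 \<le> B"
proof -
  have B: "0 < B" and F: "bessel (sqrt B) F" using assms by (auto simp: frame_bounds_UNIV_iff)
  have "norm (F k) \<le> sqrt B"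
    using besselD[OF F, of "{k}" "\<lambda>_. 1"] by simp
  thus ?thesis using B by (metis less_imp_le norm_ge_zero power_mono real_sqrt_pow2)
qed

lemma bij_case_sum:
  assumes "bij_betw \<sigma> UNIV {k. P k}" "bij_betw \<tau> UNIV {k. \<not> P k}"
  shows "bij (case_sum \<sigma> \<tau>)"
proof -
  have \<sigma>: "inj \<sigma>" "range \<sigma> = {k. P k}" and \<tau>: "inj \<tau>" "range \<tau> = {k. \<not> P k}"
    using assms by (auto simp: bij_betw_def)
  have "P (\<sigma> x)" "\<not> P (\<tau> y)" for x y using \<sigma>(2) \<tau>(2) by auto
  hence "\<sigma> x \<noteq> \<tau> y" "\<tau> y \<noteq> \<sigma> x" for x y by metis+
  hence "inj (case_sum \<sigma> \<tau>)"
    using \<sigma>(1) \<tau>(1) by (auto simp: inj_def split: sum.splits)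
  moreover have "k \<in> range (case_sum \<sigma> \<tau>)" for k
  proof (cases "P k")
    case True
    then obtain x where "k = \<sigma> x" using \<sigma>(2) by blast
    thus ?thesis by (intro range_eqI[of _ _ "Inl x"]) simp
  next
    case False
    then obtain x where "k = \<tau> x" using \<tau>(2) by blast
    thus ?thesis by (intro range_eqI[of _ _ "Inr x"]) simp
  qed
  ultimately show ?thesis by (auto simp: bij_def)
qed

text \<open>The second halves of the estimates reduce to the first ones: reflecting in \<open>L / 2\<close> turns \<open>U2\<close>
  and \<open>T2\<close> into \<open>U1\<close> and \<open>T1\<close>, and the support of \<open>h n\<close>, which meets the negative axis, into a
  subset of \<open>[0, L - c n]\<close>.\<close>

lemma superposition_reflected:
  assumes lam: "1 < lam"
    and h_norm: "\<And>n. (norm (h n))\<^sup>2 \<le> B" and h_in: "\<And>n. L2_in (h n) (c n) L"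
    and \<gamma>: "strict_mono \<gamma>" and gap: "\<And>n. L - c n \<le> real (\<gamma> (Suc n)) - real (\<gamma> n)"
  shows "summable (\<lambda>n. (U2 lam ^^ \<gamma> n) (h n))"
    and "(norm (h k - (T2 lam L ^^ \<gamma> k) (\<Sum>n. (U2 lam ^^ \<gamma> n) (h n))))\<^sup>2
      \<le> B * lam\<^sup>2 / (lam\<^sup>2 - 1) * lam powr (- 2 * (real (\<gamma> (Suc k)) - real (\<gamma> k)))"
proof -
  interpret R: bounded_linear "L2_reflect L" by (rule bounded_linear_L2_reflect)
  have G_norm: "(norm (L2_reflect L (h n)))\<^sup>2 \<le> B" for n
    using h_norm by (simp add: norm_L2_reflect)
  have G_in: "L2_in (L2_reflect L (h n)) 0 (L - c n)" for n
    using L2_in_reflect[OF h_in, of L] by simp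
  have R_U: "L2_reflect L ((U1 lam ^^ \<gamma> n) (L2_reflect L (h n))) = (U2 lam ^^ \<gamma> n) (h n)" for n
    by (simp add: L2_reflect_reflect flip: L2_reflect_U2_funpow)
  show summable: "summable (\<lambda>n. (U2 lam ^^ \<gamma> n) (h n))"
    using R.summable[OF summable_superposition[OF lam G_norm G_in \<gamma> gap]] by (simp add: R_U)
  have "(\<Sum>n. (U1 lam ^^ \<gamma> n) (L2_reflect L (h n))) = L2_reflect L (\<Sum>n. (U2 lam ^^ \<gamma> n) (h n))"
    using R.suminf[OF summable] by (simp add: L2_reflect_U2_funpow)
  hence "L2_reflect L (h k) - (T1 lam ^^ \<gamma> k) (\<Sum>n. (U1 lam ^^ \<gamma> n) (L2_reflect L (h n)))
      = L2_reflect L (h k - (T2 lam L ^^ \<gamma> k) (\<Sum>n. (U2 lam ^^ \<gamma> n) (h n)))"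
    by (simp add: R.diff L2_reflect_T2_funpow)
  with superposition_error[OF lam G_norm G_in \<gamma> gap, of k]
  show "(norm (h k - (T2 lam L ^^ \<gamma> k) (\<Sum>n. (U2 lam ^^ \<gamma> n) (h n))))\<^sup>2
      \<le> B * lam\<^sup>2 / (lam\<^sup>2 - 1) * lam powr (- 2 * (real (\<gamma> (Suc k)) - real (\<gamma> k)))"
    by (simp add: norm_L2_reflect)
qed

theorem theorem2p12:
  fixes f :: "nat \<Rightarrow> L2R" and A B lam :: real
  assumes frame: "frame_bounds UNIV f A B"
    and compact_supports: "\<And>k. compact (L2_supp (f k))"
    and lam: "lam > 1"
  shows "((\<exists>p q. (\<forall>k. L2_supp (f k) \<subseteq> {p k..q k}) \<and> bdd_above (range (\<lambda>k. q k - p k))) \<longrightarrow>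
            infinite {k. L2_supp (f k) \<subseteq> {0..}} \<and> infinite {k. \<not> L2_supp (f k) \<subseteq> {0..}})
    \<and> (\<forall>\<sigma> \<tau> g h a b c d L \<alpha> \<gamma> \<phi>\<^sub>1 \<phi>\<^sub>2.
        bij_betw \<sigma> UNIV {k. L2_supp (f k) \<subseteq> {0..}} \<and>
        bij_betw \<tau> UNIV {k. \<not> L2_supp (f k) \<subseteq> {0..}} \<and>
        g = (\<lambda>k::nat. f (\<sigma> k)) \<and>
        h = (\<lambda>k::nat. f (\<tau> k)) \<and>
        (\<forall>k. L2_supp (g k) \<subseteq> {a k..b k}) \<and>
        (\<forall>k. L2_supp (h k) \<subseteq> {c k..d k}) \<and>
        bdd_above (range (\<lambda>k. max (b k - a k) (d k - c k))) \<and>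
        L = (SUP k. max (b k - a k) (d k - c k)) \<and>
        strict_mono \<alpha> \<and> strict_mono \<gamma> \<and>
        (\<forall>k. real (\<alpha> (Suc k)) - real (\<alpha> k) \<ge> b k) \<and>
        (\<forall>k. real (\<gamma> (Suc k)) - real (\<gamma> k) \<ge> L - c k) \<and>
        \<phi>\<^sub>1 = (\<Sum>n. (U1 lam ^^ \<alpha> n) (g n)) \<and>
        \<phi>\<^sub>2 = (\<Sum>n. (U2 lam ^^ \<gamma> n) (h n))
        \<longrightarrow>
        summable (\<lambda>n. (U1 lam ^^ \<alpha> n) (g n)) \<and>
        summable (\<lambda>n. (U2 lam ^^ \<gamma> n) (h n)) \<and>
        (\<forall>k. (norm (g k - (T1 lam ^^ \<alpha> k) \<phi>\<^sub>1))\<^sup>2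
               \<le> B * lam\<^sup>2 / (lam\<^sup>2 - 1) * lam powr (- 2 * (real (\<alpha> (Suc k)) - real (\<alpha> k))) \<and>
             (norm (h k - (T2 lam L ^^ \<gamma> k) \<phi>\<^sub>2))\<^sup>2
               \<le> B * lam\<^sup>2 / (lam\<^sup>2 - 1) * lam powr (- 2 * (real (\<gamma> (Suc k)) - real (\<gamma> k)))) \<and>
        (\<forall>\<epsilon>. 0 < \<epsilon> \<and> \<epsilon> < A \<and> \<alpha> 0 = 0 \<and> \<gamma> 0 = 0 \<and>
          (\<forall>k. real (\<alpha> (Suc k)) - real (\<alpha> k) \<ge>
             max (b k) ((real (Suc k) * ln 2 + ln (2 * B / \<epsilon>) + ln (lam\<^sup>2 / (lam\<^sup>2 - 1))) / (2 * ln lam))) \<and>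
          (\<forall>k. real (\<gamma> (Suc k)) - real (\<gamma> k) \<ge>
             max (L - c k) ((real (Suc k) * ln 2 + ln (2 * B / \<epsilon>) + ln (lam\<^sup>2 / (lam\<^sup>2 - 1))) / (2 * ln lam)))
          \<longrightarrow>
          (let F = case_sum g h :: nat + nat \<Rightarrow> L2R;
               F' = case_sum (\<lambda>k. (T1 lam ^^ \<alpha> k) \<phi>\<^sub>1) (\<lambda>k. (T2 lam L ^^ \<gamma> k) \<phi>\<^sub>2);
               V = synthesis F; V' = synthesis F';
               S = frame_operator F; S' = frame_operator F'
           in frame_bounds UNIV F A B \<and>
              eps_approximation \<epsilon> UNIV F F' \<and>
              frame_bounds UNIV F' (A * (1 - sqrt (\<epsilon> / A))\<^sup>2) (B * (1 + sqrt (\<epsilon> / B))\<^sup>2) \<and>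
              excess UNIV F' = excess UNIV f \<and>
              bounded_linear V \<and> bounded_linear V' \<and>
              opnorm_le (\<lambda>x. V x - V' x) (sqrt \<epsilon>) \<and>
              opnorm_le (\<lambda>x. S x - S' x) (sqrt (\<epsilon> * B) * (2 + sqrt (\<epsilon> / B))) \<and>
              bij S \<and> bij S' \<and>
              opnorm_le (\<lambda>x. inv S x - inv S' x)
                (sqrt (\<epsilon> * B) * (2 + sqrt (\<epsilon> / B)) / (A\<^sup>2 * (1 - sqrt (\<epsilon> / A))\<^sup>2)))))"
proof (rule conjI, goal_cases)
  case 1
  show ?case
    using infinite_supports_right[OF frame compact_supports]
      infinite_supports_left[OF frame compact_supports] by blast
next
  case 2
  have main: "summable (\<lambda>n. (U1 lam ^^ \<alpha> n) (g n)) \<and>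
      summable (\<lambda>n. (U2 lam ^^ \<gamma> n) (h n)) \<and>
      (\<forall>k. (norm (g k - (T1 lam ^^ \<alpha> k) \<phi>\<^sub>1))\<^sup>2
             \<le> B * lam\<^sup>2 / (lam\<^sup>2 - 1) * lam powr (- 2 * (real (\<alpha> (Suc k)) - real (\<alpha> k))) \<and>
           (norm (h k - (T2 lam L ^^ \<gamma> k) \<phi>\<^sub>2))\<^sup>2
             \<le> B * lam\<^sup>2 / (lam\<^sup>2 - 1) * lam powr (- 2 * (real (\<gamma> (Suc k)) - real (\<gamma> k))))"
    (is "?S1 \<and> ?S2 \<and> (\<forall>k. ?E1 k \<and> ?E2 k)")
    if \<sigma>: "bij_betw \<sigma> UNIV {k. L2_supp (f k) \<subseteq> {0..}}"
      and \<tau>: "bij_betw \<tau> UNIV {k. \<not> L2_supp (f k) \<subseteq> {0..}}"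
      and g: "g = (\<lambda>k::nat. f (\<sigma> k))" and h: "h = (\<lambda>k::nat. f (\<tau> k))"
      and g_supp: "\<forall>k. L2_supp (g k) \<subseteq> {a k..b k}" and h_supp: "\<forall>k. L2_supp (h k) \<subseteq> {c k..d k}"
      and bdd: "bdd_above (range (\<lambda>k. max (b k - a k) (d k - c k)))"
      and L: "L = (SUP k. max (b k - a k) (d k - c k))"
      and \<alpha>: "strict_mono \<alpha>" and \<gamma>: "strict_mono \<gamma>"
      and gap_\<alpha>: "\<forall>k. real (\<alpha> (Suc k)) - real (\<alpha> k) \<ge> b k"
      and gap_\<gamma>: "\<forall>k. real (\<gamma> (Suc k)) - real (\<gamma> k) \<ge> L - c k"
      and \<phi>: "\<phi>\<^sub>1 = (\<Sum>n. (U1 lam ^^ \<alpha> n) (g n))" "\<phi>\<^sub>2 = (\<Sum>n. (U2 lam ^^ \<gamma> n) (h n))"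
    for \<sigma> \<tau> :: "nat \<Rightarrow> nat" and g h a b c d L \<alpha> \<gamma> \<phi>\<^sub>1 \<phi>\<^sub>2
  proof -
    have g_norm: "(norm (g n))\<^sup>2 \<le> B" and h_norm: "(norm (h n))\<^sup>2 \<le> B" for n
      using frame_element_norm_le[OF frame] by (simp_all add: g h)
    have g_in: "L2_in (g n) 0 (b n)" for n
    proof (rule L2_in_if_supp)
      have "L2_supp (g n) \<subseteq> {0..}" using \<sigma> by (auto simp: g bij_betw_def)
      thus "L2_supp (g n) \<subseteq> {0..b n}" using g_supp by fastforce
    qed
    have h_in: "L2_in (h n) (c n) L" for n
    proof (rule L2_in_if_supp)
      have "\<not> L2_supp (h n) \<subseteq> {0..}" using \<tau> by (auto simp: h bij_betw_def)
      \<comment> \<open>A point of the support to the left of 0 forces \<open>c n < 0\<close>; as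
        the interval has length at most \<open>L\<close>, its right end is then at most
        \<open>L\<close>.\<close>
      then obtain x where "x \<in> L2_supp (h n)" "x < 0" by force
      hence "c n < 0" using h_supp by (meson atLeastAtMost_iff le_less_trans subsetD)
      moreover have "max (b n - a n) (d n - c n) \<le> L"
        unfolding L by (rule cSUP_upper[OF UNIV_I bdd])
      ultimately have "d n \<le> L" by simp
      thus "L2_supp (h n) \<subseteq> {c n..L}" using h_supp by fastforce
    qed
    have ?S1
      by (rule summable_superposition[OF lam g_norm g_in \<alpha> gap_\<alpha>[rule_format]])
    moreover have ?S2
      by (rule superposition_reflected(1)[OF lam h_norm h_in \<gamma> gap_\<gamma>[rule_format]])
    moreover have "?E1 k" for k
      unfolding \<phi> by (rule superposition_error[OF lam g_norm g_in \<alpha> gap_\<alpha>[rule_format]])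
    moreover have "?E2 k" for k
      unfolding \<phi> by (rule superposition_reflected(2)[OF lam h_norm h_in \<gamma> gap_\<gamma>[rule_format]])
    ultimately show ?thesis by blast
  qed
  \<comment> \<open>The combined family is \<open>f\<close> reindexed along the bijection
    \<open>case_sum \<sigma> \<tau>\<close>, so it inherits the frame bounds and the excess of
    \<open>f\<close>; the error estimates supply the rest of the locale.\<close>
  have approximation: "perturbed_frame (case_sum g h :: nat + nat \<Rightarrow> L2R) A B
      (case_sum (\<lambda>k. (T1 lam ^^ \<alpha> k) \<phi>\<^sub>1) (\<lambda>k. (T2 lam L ^^ \<gamma> k) \<phi>\<^sub>2)) \<epsilon>
      \<and> excess UNIV (case_sum g h :: nat + nat \<Rightarrow> L2R) = excess UNIV f"
    if \<sigma>: "bij_betw \<sigma> UNIV {k. L2_supp (f k) \<subseteq> {0..}}"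
      and \<tau>: "bij_betw \<tau> UNIV {k. \<not> L2_supp (f k) \<subseteq> {0..}}"
      and g: "g = (\<lambda>k::nat. f (\<sigma> k))" and h: "h = (\<lambda>k::nat. f (\<tau> k))"
      and \<epsilon>: "0 < \<epsilon>" "\<epsilon> < A"
      and error: "\<forall>k. (norm (g k - (T1 lam ^^ \<alpha> k) \<phi>\<^sub>1))\<^sup>2
             \<le> B * lam\<^sup>2 / (lam\<^sup>2 - 1) * lam powr (- 2 * (real (\<alpha> (Suc k)) - real (\<alpha> k))) \<and>
           (norm (h k - (T2 lam L ^^ \<gamma> k) \<phi>\<^sub>2))\<^sup>2
             \<le> B * lam\<^sup>2 / (lam\<^sup>2 - 1) * lam powr (- 2 * (real (\<gamma> (Suc k)) - real (\<gamma> k)))"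
      and gap_\<alpha>: "\<forall>k. real (\<alpha> (Suc k)) - real (\<alpha> k) \<ge>
        max (b k) ((real (Suc k) * ln 2 + ln (2 * B / \<epsilon>) + ln (lam\<^sup>2 / (lam\<^sup>2 - 1))) / (2 * ln lam))"
      and gap_\<gamma>: "\<forall>k. real (\<gamma> (Suc k)) - real (\<gamma> k) \<ge>
        max (L - c k) ((real (Suc k) * ln 2 + ln (2 * B / \<epsilon>) + ln (lam\<^sup>2 / (lam\<^sup>2 - 1))) / (2 * ln lam))"
    for \<sigma> \<tau> :: "nat \<Rightarrow> nat" and g h b c L \<epsilon> \<phi>\<^sub>1 \<phi>\<^sub>2 and \<alpha> \<gamma> :: "nat \<Rightarrow> nat"
  proof -
    have B: "0 < B" using frame by (simp add: frame_bounds_def)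
    have bij: "bij (case_sum \<sigma> \<tau>)" by (rule bij_case_sum[OF \<sigma> \<tau>])
    have F_eq: "case_sum g h = (\<lambda>k. f (case_sum \<sigma> \<tau> k))"
      by (auto simp: g h split: sum.splits)
    have "eps_approximation \<epsilon> UNIV (case_sum g h)
        (case_sum (\<lambda>k. (T1 lam ^^ \<alpha> k) \<phi>\<^sub>1) (\<lambda>k. (T2 lam L ^^ \<gamma> k) \<phi>\<^sub>2))"
    proof (rule eps_approximation_case_sum)
      fix k
      \<comment> \<open>Sequences start at index 0 here, so the counter in the logarithmic gap
        condition is \<open>Suc k\<close>.\<close>
      note bound = gap_error_bound[OF lam B \<epsilon>(1), of "Suc k"]
      show "(norm (g k - (T1 lam ^^ \<alpha> k) \<phi>\<^sub>1))\<^sup>2 \<le> \<epsilon> / 2 * (1 / 2) ^ Suc k"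
        using gap_\<alpha>[rule_format, of k] unfolding max.bounded_iff
        by (intro order_trans[OF error[rule_format, of k, THEN conjunct1] bound]) blast
      show "(norm (h k - (T2 lam L ^^ \<gamma> k) \<phi>\<^sub>2))\<^sup>2 \<le> \<epsilon> / 2 * (1 / 2) ^ Suc k"
        using gap_\<gamma>[rule_format, of k] unfolding max.bounded_iff
        by (intro order_trans[OF error[rule_format, of k, THEN conjunct2] bound]) blast
    qed (use \<epsilon> in simp)
    moreover have "frame_bounds UNIV (case_sum g h) A B"
      unfolding F_eq using frame_bounds_reindex[OF bij] frame by blast
    moreover have "excess UNIV (case_sum g h) = excess UNIV f"
      unfolding F_eq by (rule excess_reindex[OF bij])
    ultimately show ?thesis using \<epsilon>
      unfolding perturbed_frame_def countable_frame_def perturbed_frame_axioms_def by blast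
  qed
  show ?case
  proof (intro allI impI, elim conjE, goal_cases)
    case prems: (1 \<sigma> \<tau> g h a b c d L \<alpha> \<gamma> \<phi>\<^sub>1 \<phi>\<^sub>2)
    note estimates = main[OF prems]
    show ?case
    proof (intro conjI allI impI, goal_cases)
      case (5 \<epsilon>)
      hence \<epsilon>: "0 < \<epsilon>" "\<epsilon> < A" by blast+
      from estimates have error: "\<forall>k. (norm (g k - (T1 lam ^^ \<alpha> k) \<phi>\<^sub>1))\<^sup>2
             \<le> B * lam\<^sup>2 / (lam\<^sup>2 - 1) * lam powr (- 2 * (real (\<alpha> (Suc k)) - real (\<alpha> k))) \<and>
           (norm (h k - (T2 lam L ^^ \<gamma> k) \<phi>\<^sub>2))\<^sup>2
             \<le> B * lam\<^sup>2 / (lam\<^sup>2 - 1) * lam powr (- 2 * (real (\<gamma> (Suc k)) - real (\<gamma> k)))"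
        by blast
      note approx = approximation[OF prems(1-4) \<epsilon> error, of b c]
      interpret P: perturbed_frame "case_sum g h :: nat + nat \<Rightarrow> L2R" A B
          "case_sum (\<lambda>k. (T1 lam ^^ \<alpha> k) \<phi>\<^sub>1) (\<lambda>k. (T2 lam L ^^ \<gamma> k) \<phi>\<^sub>2)" \<epsilon>
        using approx 5 by blast
      have excess: "excess UNIV (case_sum g h :: nat + nat \<Rightarrow> L2R) = excess UNIV f"
        using approx 5 by blast
      show ?case
        unfolding Let_def
        by (intro conjI P.frame P.approximation P.frame' trans[OF P.excess_eq excess]
            bounded_linear_synthesis[OF P.bessel] bounded_linear_synthesis[OF P.bessel']
            P.opnorm_synthesis_diff P.opnorm_frame_operator_diff P.opnorm_inv_frame_operator_diff
            P.bij_frame_operator P.perturbed.bij_frame_operator)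
    qed (use estimates in blast)+
  qed
qed

end
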